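(* Let $m$ be a non-negative integer and let $p$ be a prime such that $p>2m+3$. Then $$2p\,\zeta_p(2m+2)\equiv -\frac{4m(1-2^{-2m})}{2m+1}\, B_{p-2m-1} \pmod{p},$$ $$\zeta_p(2m+3)\equiv -\frac{(m+1)(2m+1)}{2m+3}\, B_{p-2m-3} \pmod{p}.$$
   Context: For an integer $n\ge0$ and $r\ge 0$, $H_n(\{2\}^r)=\sum_{1\le k_1<\cdots<k_r\le n}\frac{1}{k_1^{2}\cdots k_r^{2}}$, with $H_n(\{2\}^0)=1$ and $H_n(\{2\}^r)=0$ if $n<r$. The finite analogues are defined by $$\zeta_p(2m+2)=\frac{3}{2}\sum_{k=1}^{p-1}\frac{(-1)^mH_{k-1}(\{2\}^m)}{k^2\binom{2k}{k}}+2\sum_{j=1}^m\sum_{k=1}^{p-1}\frac{(-1)^{m-j}H_{k-1}(\{2\}^{m-j})}{k^{2j+2}\binom{2k}{k}},$$ $$\zeta_p(2m+3)=\frac{5}{2}\sum_{k=1}^{p-1}\frac{(-1)^{k+m-1}H_{k-1}(\{2\}^m)}{k^3\binom{2k}{k}}+2\sum_{j=1}^m\sum_{k=1}^{p-1}\frac{(-1)^{k+m-j-1}H_{k-1}(\{2\}^{m-j})}{k^{2j+3}\binom{2k}{k}}.$$ $B_k$ are the Bernoulli numbers defined by $\frac{x}{e^x-1}=\sum_{k\ge0}B_k\frac{x^k}{k!}$. For rational numbers $x,y$, $x\equiv y\pmod{p}$ means that $x-y$ has $p$-adic valuation at least $1$. *)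

theory Defs
  imports "HOL-Computational_Algebra.Computational_Algebra"
begin

(* A tuple k_1 < ... < k_r with entries in {1..n} is encoded as the r-element set of its entries. *)
definition H2 :: "nat \<Rightarrow> nat \<Rightarrow> rat" where
  "H2 n r = (\<Sum>K | K \<subseteq> {1..n} \<and> card K = r. \<Prod>k\<in>K. 1 / of_nat k ^ 2)"

(* In the exponents below k >= 1 and j <= m, so the natural number subtractions never truncate. *)
definition zeta_fin_even :: "nat \<Rightarrow> nat \<Rightarrow> rat" where
  "zeta_fin_even p m =
     3 / 2 * (\<Sum>k = 1..p - 1.
       (-1) ^ m * H2 (k - 1) m / (of_nat k ^ 2 * of_nat ((2 * k) choose k)))
     + 2 * (\<Sum>j = 1..m. \<Sum>k = 1..p - 1.
       (-1) ^ (m - j) * H2 (k - 1) (m - j)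
         / (of_nat k ^ (2 * j + 2) * of_nat ((2 * k) choose k)))"

definition zeta_fin_odd :: "nat \<Rightarrow> nat \<Rightarrow> rat" where
  "zeta_fin_odd p m =
     5 / 2 * (\<Sum>k = 1..p - 1.
       (-1) ^ (k + m - 1) * H2 (k - 1) m / (of_nat k ^ 3 * of_nat ((2 * k) choose k)))
     + 2 * (\<Sum>j = 1..m. \<Sum>k = 1..p - 1.
       (-1) ^ (k + m - j - 1) * H2 (k - 1) (m - j)
         / (of_nat k ^ (2 * j + 3) * of_nat ((2 * k) choose k)))"

(* The finite zeta value of argument s; meaningful for s >= 2 only. *)
definition zeta_fin :: "nat \<Rightarrow> nat \<Rightarrow> rat" where
  "zeta_fin p s =
     (if even s then zeta_fin_even p ((s - 2) div 2) else zeta_fin_odd p ((s - 3) div 2))"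

lemma zeta_fin_even_arg: "zeta_fin p (2 * m + 2) = zeta_fin_even p m"
  by (simp add: zeta_fin_def)

lemma zeta_fin_odd_arg: "zeta_fin p (2 * m + 3) = zeta_fin_odd p m"
  by (simp add: zeta_fin_def)

definition bernoulli_egf :: "rat fps" where
  "bernoulli_egf = fps_X / (fps_exp 1 - 1)"

definition bernoulli :: "nat \<Rightarrow> rat" where
  "bernoulli k = fact k * fps_nth bernoulli_egf k"

(* The quotient of power series is exact, although the denominator is not a unit. *)
lemma bernoulli_egf_mult: "bernoulli_egf * (fps_exp 1 - 1) = fps_X"
proof -
  have sub: "subdegree (fps_exp 1 - 1 :: rat fps) = 1"
    by (rule subdegreeI) auto
  then have nz: "(fps_exp 1 - 1 :: rat fps) \<noteq> 0"
    by auto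
  have "(fps_exp 1 - 1 :: rat fps) dvd fps_X"
    using nz sub by (subst fps_dvd_iff) auto
  then show ?thesis
    unfolding bernoulli_egf_def by simp
qed

(* Only used for x \<noteq> 0; the valuation of 0 is infinite. *)
definition padic_val :: "nat \<Rightarrow> rat \<Rightarrow> int" where
  "padic_val p x =
     int (multiplicity (int p) (fst (quotient_of x)))
     - int (multiplicity (int p) (snd (quotient_of x)))"

definition rat_cong :: "rat \<Rightarrow> rat \<Rightarrow> nat \<Rightarrow> bool" where
  "rat_cong x y p \<longleftrightarrow> x - y = 0 \<or> padic_val p (x - y) \<ge> 1"

end

theory Submission
  imports Defs "HOL-Number_Theory.Residues"
begin

text \<open>
  Put P_k(t) = prod_{j<k} (1 - t/j^2).  The coefficient of t^m in P_k is
  h_k = (-1)^m H_{k-1}({2}^m), so both finite zeta values are t^m-coefficients of sums of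
  P_k(t), P_k(t)/(k^2 - t) against inverse central binomial coefficients, as in the generating
  functions of Koecher (odd arguments) and Leshchiner (even arguments).

  The exact part is Apery's telescoping with a parameter: 1/(n^2 - t) is a telescoping sum over
  k < n of multiples of P_k(t), plus a last term with P_n(t)/((n^2 - t) binom(2n,n))
  (\<open>telescoping_expansion\<close>).  Summing over n < p, with weight 1/n or with sign (-1)^(n-1),
  makes the inner sums telescope a second time.  The lower ends of these sums complete the finite
  zeta value; the upper ends form a remainder, which is half the sum of the terms h_k / (p (p - k)),
  times 1/k in the odd case, each up to a factor that is 1 modulo p^2.  So (\<open>zeta_fin_odd_exact\<close>,
  \<open>zeta_fin_even_exact\<close>, \<open>congp_apery_remainder\<close>)

    2 p zeta_p(2m+2) = - sum_k h_k/k  modulo p,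
    2 p zeta_p(2m+3) = - sum_k h_k/k^2 - p sum_k h_k/k^3  modulo p^2,

  all sums over 1 <= k < p.

  The sum of h_k/k^2 telescopes to minus the coefficient of t^(m+1) in P_p.  Since
  P_p(x^2) = prod (1 - x/j) prod (1 + x/j), that coefficient is twice an elementary symmetric
  function of 1/1, ..., 1/(p-1) modulo p^2.  Reversal turns it into one of 1, ..., p-1, and
  Newton's identities reduce it to a power sum, that is, to p times a Bernoulli number
  (\<open>sqpoly_p_congp_2\<close>, \<open>inv_elem_prod_congp\<close>).

  The sums of h_k/k and h_k/k^3 are coefficients of the polynomials sum_k P_k(t)/k^s, of degree
  below p - 1.  Their values at t = n^2 for 1 <= n < p are (-1)^(n-1)/n for s = 1 and
  (H_n + H_{n-1})/n^2 for s = 3 (\<open>sum_sqpoly_over_k\<close>, \<open>sum_sqpoly_over_k3\<close>), with H_n the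
  harmonic numbers, so Lagrange interpolation writes the coefficients as sums over j of these values
  divided by powers of j.  The Lagrange weights have one factor p in the denominator, hence these
  sums are needed modulo p^2.  Their terms change sign under j -> p - j modulo p, and comparing
  the terms at j and p - j modulo p^2 produces the missing factor p
  (\<open>even_weight_congp\<close>, \<open>odd_weight_congp\<close>).  What remains is an alternating power sum and two
  double harmonic sums modulo p, which Faulhaber's formula expresses by a single Bernoulli number.
\<close>

hide_const (open) up_ring.coeff up_ring.monom module.smult

section \<open>Congruences between p-integral rational numbers\<close>

locale odd_prime =
  fixes p :: nat
  assumes prime_p: "prime p" and odd_p: "odd p"
begin

text \<open>The local ring of the integers at p.\<close>

definition Zp :: "rat set" where
  "Zp = {x. \<exists>a b. \<not> int p dvd b \<and> x = of_int a / of_int b}"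

text \<open>The denominators that may be cancelled are exactly the units of the local ring.\<close>

definition unit :: "rat \<Rightarrow> bool" where
  "unit x \<longleftrightarrow> x \<noteq> 0 \<and> x \<in> Zp \<and> inverse x \<in> Zp"

text \<open>Congruence modulo p^k is defined for arbitrary rationals: only the difference has to lie in
  p^k times the local ring.  This allows statements about p x where x itself has p in its
  denominator, such as the Lagrange weights below.\<close>

definition congp :: "nat \<Rightarrow> rat \<Rightarrow> rat \<Rightarrow> bool" where
  "congp k x y \<longleftrightarrow> (x - y) / of_nat p ^ k \<in> Zp"

lemma p_pos: "p > 0" and p_gt_1: "p > 1" and p_gt_2: "p > 2"
proof -
  show "p > 1" using prime_p prime_gt_1_nat by blast
  then show "p > 0" by simp
  show "p > 2" using odd_p \<open>p > 1\<close> by (cases "p = 2") auto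
qed

lemma p_nonzero [simp]: "p \<noteq> 0"
  using p_pos by simp

lemma Zp_of_int [simp]: "of_int a \<in> Zp"
proof -
  have "\<not> int p dvd 1" using p_gt_1 by simp
  moreover have "(of_int a :: rat) = of_int a / of_int 1" by simp
  ultimately show ?thesis unfolding Zp_def by blast
qed

lemma Zp_of_nat [simp]: "of_nat a \<in> Zp"
  using Zp_of_int[of "int a"] by simp

lemma Zp_0 [simp]: "0 \<in> Zp" and Zp_1 [simp]: "1 \<in> Zp" and Zp_numeral [simp]: "numeral w \<in> Zp"
  using Zp_of_nat[of 0] Zp_of_nat[of 1] Zp_of_nat[of "numeral w"] by simp_all

lemma Zp_mult [simp]: assumes "x \<in> Zp" "y \<in> Zp" shows "x * y \<in> Zp"
proof -
  obtain a b c d where 1: "\<not> int p dvd b" "x = of_int a / of_int b" "\<not> int p dvd d" "y = of_int c / of_int d"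
    using assms unfolding Zp_def by auto
  have "\<not> int p dvd b * d" using 1 prime_p prime_dvd_mult_iff[of "int p" b d] by auto
  moreover have "x * y = of_int (a * c) / of_int (b * d)" using 1 by simp
  ultimately show ?thesis unfolding Zp_def by blast
qed

lemma Zp_add [simp]: assumes "x \<in> Zp" "y \<in> Zp" shows "x + y \<in> Zp"
proof -
  obtain a b c d where 1: "\<not> int p dvd b" "x = of_int a / of_int b" "\<not> int p dvd d" "y = of_int c / of_int d"
    using assms unfolding Zp_def by auto
  have n: "\<not> int p dvd b * d" using 1 prime_p prime_dvd_mult_iff[of "int p" b d] by auto
  have "b \<noteq> 0" "d \<noteq> 0" using 1 by auto
  hence "x + y = of_int (a * d + c * b) / of_int (b * d)" using 1 by (simp add: field_simps)
  with n show ?thesis unfolding Zp_def by blast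
qed

lemma Zp_minus [simp]: "x \<in> Zp \<Longrightarrow> - x \<in> Zp"
  using Zp_mult[OF Zp_of_int[of "-1"], of x] by simp

lemma Zp_diff [simp]: "x \<in> Zp \<Longrightarrow> y \<in> Zp \<Longrightarrow> x - y \<in> Zp"
  using Zp_add[of x "- y"] by simp

lemma Zp_power [simp]: "x \<in> Zp \<Longrightarrow> x ^ n \<in> Zp"
  by (induction n) auto

lemma Zp_sum: "(\<And>i. i \<in> A \<Longrightarrow> f i \<in> Zp) \<Longrightarrow> sum f A \<in> Zp"
  by (induction A rule: infinite_finite_induct) auto

lemma Zp_prod: "(\<And>i. i \<in> A \<Longrightarrow> f i \<in> Zp) \<Longrightarrow> prod f A \<in> Zp"
  by (induction A rule: infinite_finite_induct) auto

lemma unit_of_int: assumes "\<not> int p dvd a" shows "unit (of_int a)"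
proof -
  have "a \<noteq> 0" using assms by auto
  moreover have "inverse (of_int a) = (of_int 1 / of_int a :: rat)" by (simp add: field_simps)
  ultimately show ?thesis using assms unfolding unit_def Zp_def
    by (metis (mono_tags, lifting) Zp_def Zp_of_int mem_Collect_eq of_int_eq_0_iff)
qed

lemma unit_of_nat [simp]: "0 < j \<Longrightarrow> j < p \<Longrightarrow> unit (of_nat j)"
  using unit_of_int[of "int j"] nat_dvd_not_less by auto

lemma unit_Zp: "unit x \<Longrightarrow> x \<in> Zp" and unit_nonzero: "unit x \<Longrightarrow> x \<noteq> 0"
  by (auto simp: unit_def)

lemma unit_1 [simp]: "unit 1"
  by (simp add: unit_def)

lemma unit_mult [simp]: "unit x \<Longrightarrow> unit y \<Longrightarrow> unit (x * y)"
  by (auto simp: unit_def)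

lemma unit_minus [simp]: "unit x \<Longrightarrow> unit (- x)"
  by (auto simp: unit_def)

lemma unit_power [simp]: "unit x \<Longrightarrow> unit (x ^ n)"
  by (induction n) auto

lemma unit_prod: "(\<And>i. i \<in> A \<Longrightarrow> unit (f i)) \<Longrightarrow> unit (prod f A)"
  by (induction A rule: infinite_finite_induct) auto

lemma unit_fact [simp]: "n < p \<Longrightarrow> unit (fact n)"
  unfolding fact_prod of_nat_prod by (rule unit_prod) auto

lemma unit_minus_p [simp]: "0 < j \<Longrightarrow> j < p \<Longrightarrow> unit (of_nat p - of_nat j)"
  using unit_of_nat[of "p - j"] by (simp add: of_nat_diff)

lemma unit_plus_p [simp]: assumes "0 < j" "j < p" shows "unit (of_nat p + of_nat j)"
proof -
  have "\<not> int p dvd int (p + j)"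
    using assms nat_dvd_not_less[of j p] unfolding int_dvd_int_iff by simp
  from unit_of_int[OF this] show ?thesis by simp
qed

lemma Zp_divide [simp]: "x \<in> Zp \<Longrightarrow> unit y \<Longrightarrow> x / y \<in> Zp"
  by (simp add: unit_def divide_inverse)

lemma congp_refl [simp]: "congp k x x"
  by (simp add: congp_def)

lemma congp_sym: "congp k x y \<Longrightarrow> congp k y x"
  using Zp_minus[of "(x - y) / of_nat p ^ k"] by (simp add: congp_def minus_divide_left)

lemma congp_trans [trans]: "congp k x y \<Longrightarrow> congp k y z \<Longrightarrow> congp k x z"
  using Zp_add[of "(x - y) / of_nat p ^ k" "(y - z) / of_nat p ^ k"]
  by (simp add: congp_def add_divide_distrib[symmetric])

text \<open>Instances of substitution that let calculations mix equations between large sums with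
  congruences by first-order unification.\<close>

lemma eq_congp_trans [trans]: "x = y \<Longrightarrow> congp k y z \<Longrightarrow> congp k x z"
  and congp_eq_trans [trans]: "congp k x y \<Longrightarrow> y = z \<Longrightarrow> congp k x z"
  by simp_all

lemma congp_add: "congp k x x' \<Longrightarrow> congp k y y' \<Longrightarrow> congp k (x + y) (x' + y')"
  using Zp_add[of "(x - x') / of_nat p ^ k" "(y - y') / of_nat p ^ k"]
  by (simp add: congp_def add_divide_distrib[symmetric] algebra_simps)

lemma congp_minus: "congp k x x' \<Longrightarrow> congp k (- x) (- x')"
  using Zp_minus[of "(x - x') / of_nat p ^ k"]
  by (simp add: congp_def minus_divide_left)

lemma congp_diff: "congp k x x' \<Longrightarrow> congp k y y' \<Longrightarrow> congp k (x - y) (x' - y')"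
  using congp_add[OF _ congp_minus, of k x x' y y'] by simp

lemma congp_sum: "(\<And>i. i \<in> A \<Longrightarrow> congp k (f i) (g i)) \<Longrightarrow> congp k (sum f A) (sum g A)"
  by (induction A rule: infinite_finite_induct) (auto intro: congp_add)

lemma congp_cmult: assumes "c \<in> Zp" "congp k x y" shows "congp k (c * x) (c * y)"
  using Zp_mult[OF assms(1), of "(x - y) / of_nat p ^ k"] assms(2)
  by (simp add: congp_def right_diff_distrib)

lemma congp_mult: assumes "congp k x x'" "congp k y y'" "x \<in> Zp" "y' \<in> Zp"
  shows "congp k (x * y) (x' * y')"
proof -
  have "congp k (x * y) (x * y')" using assms congp_cmult by auto
  also have "congp k (x * y') (x' * y')" using congp_cmult[OF assms(4,1)] by (simp add: mult.commute)
  finally show ?thesis .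
qed

lemma congp_Zp: "congp k x y \<Longrightarrow> y \<in> Zp \<Longrightarrow> x \<in> Zp"
  using Zp_add[OF Zp_mult[of "(x - y) / of_nat p ^ k" "of_nat p ^ k"], of y] by (simp add: congp_def)

lemma congp_power: assumes "congp k x y" "y \<in> Zp" shows "congp k (x ^ n) (y ^ n)"
  using assms congp_Zp[OF assms] by (induction n) (auto intro!: congp_mult)

lemma congp_cancel: assumes "unit u" "congp k (u * x) (u * y)" shows "congp k x y"
  using congp_cmult[of "inverse u" k "u * x" "u * y"] assms
  by (simp add: unit_def mult.assoc[symmetric])

lemma congp_divide: "congp k x y \<Longrightarrow> unit u \<Longrightarrow> congp k (x / u) (y / u)"
  using congp_cmult[of "inverse u" k x y] by (simp add: unit_def field_simps)

text \<open>The way down from p^2 to p: every quantity with p in its denominator is treated by computing p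
  times it modulo p^2.\<close>

lemma congp_2_p: "congp 2 (of_nat p * x) (of_nat p * y) \<longleftrightarrow> congp 1 x y"
  by (simp add: congp_def right_diff_distrib[symmetric] power2_eq_square)

lemma congp_p_mult_zero [simp]: "x \<in> Zp \<Longrightarrow> congp 1 (of_nat p * x) 0"
  by (simp add: congp_def)

lemma congp_weaken: "congp 2 x y \<Longrightarrow> congp 1 x y"
  using Zp_mult[of "of_nat p" "(x - y) / of_nat p ^ 2"] by (simp add: congp_def power2_eq_square)

lemma congp_zero_mult: assumes "congp k x 0" "congp l y 0" shows "congp (k + l) (x * y) 0"
  using Zp_mult[of "x / of_nat p ^ k" "y / of_nat p ^ l"] assms by (simp add: congp_def power_add)

lemma congp_zeroE: assumes "congp 1 x 0" obtains y where "y \<in> Zp" "x = of_nat p * y"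
  using that[of "x / of_nat p"] assms by (simp add: congp_def)

lemma congp_zero_sum: "(\<And>i. i \<in> A \<Longrightarrow> congp k (f i) 0) \<Longrightarrow> congp k (sum f A) 0"
  using congp_sum[of A k f "\<lambda>_. 0"] by simp

lemma congp_prod_one: "(\<And>i. i \<in> A \<Longrightarrow> congp k (f i) 1) \<Longrightarrow> congp k (prod f A) 1"
proof (induction A rule: infinite_finite_induct)
  case (insert a A)
  then show ?case using congp_mult[of k "f a" 1 "prod f A" 1] congp_Zp[of k "f a" 1] by simp
qed auto

text \<open>If n/d in lowest terms equals p a/b with b prime to p, then n b = p a d, so p divides n and
  therefore not d.\<close>

lemma rat_cong_if_congp: assumes "congp 1 x y" shows "rat_cong x y p"
proof (cases "x - y = 0")
  case False
  obtain n d where nd: "quotient_of (x - y) = (n, d)" by fastforce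
  have xy: "x - y = of_int n / of_int d" and d: "d > 0" and cp: "coprime n d"
    using nd quotient_of_div quotient_of_denom_pos quotient_of_coprime by auto
  have n0: "n \<noteq> 0" using False xy by auto
  obtain z where "z \<in> Zp" "x - y = of_nat p * z"
    using congp_zeroE[of "x - y"] assms by (auto simp: congp_def)
  then obtain a b where b: "\<not> int p dvd b" "x - y = of_nat p * (of_int a / of_int b)"
    unfolding Zp_def by blast
  have "b \<noteq> 0" using b by auto
  then have "(of_int (n * b) :: rat) = of_int (int p * a * d)"
    using xy b(2) d by (simp add: field_simps)
  then have "n * b = int p * a * d" by (simp only: of_int_eq_iff)
  then have "int p dvd n * b" by (metis dvd_triv_left mult.assoc)
  then have pn: "int p dvd n" using b(1) prime_p prime_dvd_mult_iff[of "int p" n b] by auto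
  then have "\<not> int p dvd d" using cp prime_p
    by (metis coprime_common_divisor not_prime_unit prime_int_nat_transfer prime_nat_int_transfer)
  then have "multiplicity (int p) d = 0" by (simp add: not_dvd_imp_multiplicity_0)
  moreover have "multiplicity (int p) n \<ge> 1"
    using pn n0 prime_p p_gt_1 by (intro multiplicity_geI) auto
  ultimately show ?thesis by (simp add: rat_cong_def padic_val_def nd)
qed (simp add: rat_cong_def)

end

section \<open>The generating polynomial of H2 and division by n^2 - t\<close>

text \<open>P_k(t), a truncation of sin(pi a)/(pi a) in the variable t = a^2.  It is normalised so that k is
  the first factor left out; then H2 at k - 1, as in the zeta sums, belongs to index k.\<close>

definition sqpoly :: "nat \<Rightarrow> rat poly" where
  "sqpoly k = (\<Prod>j = 1..<k. [:1, - (1 / of_nat j ^ 2):])"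

lemma sqpoly_1 [simp]: "sqpoly (Suc 0) = 1"
  by (simp add: sqpoly_def)

lemma sqpoly_Suc: "k \<ge> 1 \<Longrightarrow> sqpoly (Suc k) = sqpoly k * [:1, - (1 / of_nat k ^ 2):]"
  by (simp add: sqpoly_def prod.atLeastLessThan_Suc)

lemma coeff_mult_linear: "coeff (A * [:a, b:]) (Suc m) = a * coeff A (Suc m) + b * coeff A m"
  "coeff (A * [:a, b:]) 0 = a * coeff A 0" for a :: "'a :: comm_ring_1"
  by (simp_all add: coeff_pCons mult.commute[of A])

lemma coeff_sqpoly_0 [simp]: "coeff (sqpoly k) 0 = 1"
  unfolding sqpoly_def by (induction k) (auto simp: prod.atLeastLessThan_Suc coeff_mult_0 mult.commute)

lemma H2_0: "H2 n 0 = 1"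
proof -
  have "{K. K \<subseteq> {1..n} \<and> card K = 0} = {{}}"
    by (auto dest: finite_subset[OF _ finite_atLeastAtMost])
  then show ?thesis by (simp add: H2_def)
qed

lemma H2_zero_Suc: "H2 0 (Suc r) = 0"
proof -
  have "{K::nat set. K \<subseteq> {1..0} \<and> card K = Suc r} = {}"
    by auto
  then show ?thesis by (simp add: H2_def)
qed

text \<open>Subsets are split according to whether they contain the new element.\<close>

lemma H2_Suc_Suc: "H2 (Suc n) (Suc r) = H2 n (Suc r) + H2 n r / of_nat (Suc n) ^ 2"
proof -
  let ?S = "\<lambda>n r. {K. K \<subseteq> {1..n::nat} \<and> card K = r}"
  let ?f = "\<lambda>K. \<Prod>k\<in>K. 1 / (of_nat k :: rat) ^ 2"
  have fin: "finite (?S n r)" for n r by (rule finite_subset[of _ "Pow {1..n}"]) auto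
  have finK: "finite K" if "K \<in> ?S n r" for K n r using that finite_subset by auto
  have notin: "Suc n \<notin> K" if "K \<in> ?S n r" for K r using that by auto
  have split: "?S (Suc n) (Suc r) = ?S n (Suc r) \<union> insert (Suc n) ` ?S n r"
  proof (intro equalityI subsetI)
    fix K assume K: "K \<in> ?S (Suc n) (Suc r)"
    show "K \<in> ?S n (Suc r) \<union> insert (Suc n) ` ?S n r"
    proof (cases "Suc n \<in> K")
      case True
      have "K - {Suc n} \<in> ?S n r" using K True finK[OF K]
        by (auto simp: atLeastAtMostSuc_conv)
      moreover have "K = insert (Suc n) (K - {Suc n})" using True by auto
      ultimately show ?thesis by blast
    next
      case False
      then show ?thesis using K by (auto simp: atLeastAtMostSuc_conv)
    qed
  next
    fix K assume "K \<in> ?S n (Suc r) \<union> insert (Suc n) ` ?S n r"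
    then show "K \<in> ?S (Suc n) (Suc r)"
    proof
      assume "K \<in> insert (Suc n) ` ?S n r"
      then obtain L where L: "L \<in> ?S n r" "K = insert (Suc n) L" by blast
      then have "card K = Suc r"
        using notin[OF L(1)] finK[OF L(1)] by (simp add: card_insert_disjoint)
      then show ?thesis using L by (auto simp: atLeastAtMostSuc_conv)
    qed (auto simp: atLeastAtMostSuc_conv)
  qed
  have disj: "?S n (Suc r) \<inter> insert (Suc n) ` ?S n r = {}"
    using notin by blast
  have inj: "inj_on (insert (Suc n)) (?S n r)"
    using notin by (metis (no_types, lifting) inj_onI insert_ident)
  have "H2 (Suc n) (Suc r) = H2 n (Suc r) + (\<Sum>K\<in>?S n r. ?f (insert (Suc n) K))"
    unfolding H2_def split using disj inj fin by (simp add: sum.union_disjoint sum.reindex)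
  also have "(\<Sum>K\<in>?S n r. ?f (insert (Suc n) K)) = (\<Sum>K\<in>?S n r. ?f K / of_nat (Suc n) ^ 2)"
  proof (intro sum.cong refl)
    fix K assume K: "K \<in> ?S n r"
    show "?f (insert (Suc n) K) = ?f K / of_nat (Suc n) ^ 2"
      by (subst prod.insert[OF finK[OF K] notin[OF K]]) simp
  qed
  finally show ?thesis by (simp add: H2_def sum_divide_distrib)
qed

lemma coeff_sqpoly: "coeff (sqpoly (Suc n)) m = (-1) ^ m * H2 n m"
proof (induction n arbitrary: m)
  case 0
  show ?case by (cases m) (auto simp: H2_0 H2_zero_Suc)
next
  case (Suc n)
  show ?case
    by (cases m) (simp_all add: sqpoly_Suc coeff_mult_linear Suc H2_0 H2_Suc_Suc algebra_simps)
qed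

text \<open>The coefficient of t^m in the power series A(t)/(n^2 - t).  With this linear functional the
  division needs no power series; \<open>quotient_coeff_mult\<close> is the property that characterises it.\<close>

definition quotient_coeff :: "nat \<Rightarrow> rat poly \<Rightarrow> nat \<Rightarrow> rat" where
  "quotient_coeff n A m = (\<Sum>i\<le>m. coeff A i / of_nat n ^ (2 * (m - i) + 2))"

lemma quotient_coeff_0: "quotient_coeff n A 0 = coeff A 0 / of_nat n ^ 2"
  by (simp add: quotient_coeff_def power2_eq_square)

lemma quotient_coeff_Suc: "quotient_coeff n A (Suc m) = (coeff A (Suc m) + quotient_coeff n A m) / of_nat n ^ 2"
proof -
  have "(\<Sum>i\<le>m. coeff A i / of_nat n ^ (2 * (Suc m - i) + 2)) = quotient_coeff n A m / of_nat n ^ 2"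
    unfolding quotient_coeff_def sum_divide_distrib
    by (intro sum.cong) (auto simp: Suc_diff_le power2_eq_square mult.assoc)
  then show ?thesis by (simp add: quotient_coeff_def add_divide_distrib power2_eq_square)
qed

lemma quotient_coeff_mult:
  assumes "n > 0"
  shows "quotient_coeff n (A * [:of_nat n ^ 2, -1:]) m = coeff A m"
  using assms by (induction m) (simp_all add: quotient_coeff_0 quotient_coeff_Suc coeff_mult_linear)

lemma quotient_coeff_add: "quotient_coeff n (A + B) m = quotient_coeff n A m + quotient_coeff n B m"
  by (simp add: quotient_coeff_def sum.distrib add_divide_distrib)

lemma quotient_coeff_smult: "quotient_coeff n (smult c A) m = c * quotient_coeff n A m"
  by (simp add: quotient_coeff_def sum_distrib_left)

lemma quotient_coeff_0_poly [simp]: "quotient_coeff n 0 m = 0"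
  by (simp add: quotient_coeff_def)

lemma quotient_coeff_sum: "quotient_coeff n (\<Sum>k\<in>I. f k) m = (\<Sum>k\<in>I. quotient_coeff n (f k) m)"
  by (induction I rule: infinite_finite_induct) (auto simp: quotient_coeff_add)

lemma quotient_coeff_1: "quotient_coeff n 1 m = 1 / of_nat n ^ (2 * m + 2)"
  by (induction m) (simp_all add: quotient_coeff_0 quotient_coeff_Suc power2_eq_square)

section \<open>Exact evaluation of the finite zeta values\<close>

definition square_diff_prod :: "nat \<Rightarrow> nat \<Rightarrow> rat" where
  "square_diff_prod n k = (\<Prod>j = 1..k. of_nat n ^ 2 - of_nat j ^ 2)"

lemma square_diff_prod_0 [simp]: "square_diff_prod n 0 = 1" and square_diff_prod_Suc: "square_diff_prod n (Suc k) = square_diff_prod n k * (of_nat n ^ 2 - of_nat (Suc k) ^ 2)"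
  by (simp_all add: square_diff_prod_def)

lemma square_diff_prod_nonzero: "k < n \<Longrightarrow> square_diff_prod n k \<noteq> 0"
  unfolding square_diff_prod_def by (auto simp flip: of_nat_power)

text \<open>Multiplied by n, the product of the (n - j)(n + j) becomes the product of the 2k + 1 consecutive
  integers from n - k to n + k.\<close>

lemma square_diff_prod_fact: "k < n \<Longrightarrow> of_nat n * square_diff_prod n k = fact (n + k) / fact (n - k - 1)"
proof (induction k)
  case 0
  then show ?case by (cases n) (auto simp: fact_reduce)
next
  case (Suc k)
  define d where "d = n - Suc k - 1"
  have n: "n = d + k + 2" using Suc.prems by (simp add: d_def)
  have "n - k - 1 = Suc d" by (simp add: n)
  then have IH: "of_nat n * square_diff_prod n k = fact (n + k) / fact (Suc d)"
    using Suc by (simp del: fact_Suc)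
  have "of_nat n * square_diff_prod n (Suc k) = fact (n + k) / fact (Suc d) * (of_nat n ^ 2 - of_nat (Suc k) ^ 2)"
    by (simp only: square_diff_prod_Suc mult.assoc[symmetric] IH)
  also have "(of_nat n :: rat) ^ 2 - of_nat (Suc k) ^ 2 = of_nat (n + k + 1) * of_nat (Suc d)"
    by (simp add: n power2_eq_square algebra_simps)
  also have "fact (n + k) / fact (Suc d) * (of_nat (n + k + 1) * of_nat (Suc d)) = (fact (n + Suc k) / fact d :: rat)"
    by (simp add: fact_Suc del: of_nat_Suc of_nat_add)
  finally show ?case by (simp add: d_def)
qed

text \<open>Apery's partial-fraction telescoping, multiplied through by n^2 - t.  Each step splits
  n^2 - (K+1)^2 as (n^2 - t) - ((K+1)^2 - t): the first part yields a new summand, and the second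
  extends the product P to the next index.\<close>

lemma telescoping_expansion:
  assumes "K < n"
  shows "(1 :: rat poly) = smult ((-1) ^ K * fact K ^ 2 / square_diff_prod n K) (sqpoly (Suc K))
      + (\<Sum>k = 1..K. smult ((-1) ^ (k - 1) * fact (k - 1) ^ 2 / square_diff_prod n k)
                      (sqpoly k * [:of_nat n ^ 2, -1:]))"
  using assms
proof (induction K)
  case (Suc K)
  define c :: rat where "c = (-1) ^ K * fact K ^ 2 / square_diff_prod n (Suc K)"
  have nz: "(of_nat n :: rat) ^ 2 - of_nat (Suc K) ^ 2 \<noteq> 0"
    using Suc.prems by (simp add: power2_eq_iff_nonneg del: of_nat_Suc)
  have c: "(-1) ^ K * fact K ^ 2 / square_diff_prod n K = c * (of_nat n ^ 2 - of_nat (Suc K) ^ 2)"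
    unfolding c_def square_diff_prod_Suc using nz by simp
  have c': "(-1) ^ Suc K * fact (Suc K) ^ 2 / square_diff_prod n (Suc K) = - c * of_nat (Suc K) ^ 2"
    unfolding c_def by (simp add: power_mult_distrib)
  have "smult (c * (of_nat n ^ 2 - of_nat (Suc K) ^ 2)) (sqpoly (Suc K))
      = smult (- c * of_nat (Suc K) ^ 2) (sqpoly (Suc (Suc K)))
        + smult c (sqpoly (Suc K) * [:of_nat n ^ 2, -1:])"
  proof -
    have "[:c * (of_nat n ^ 2 - of_nat (Suc K) ^ 2):]
        = smult (- c * of_nat (Suc K) ^ 2) [:1, - (1 / of_nat (Suc K) ^ 2):] + smult c [:of_nat n ^ 2, -1:]"
      by (simp add: algebra_simps del: of_nat_Suc)
    from arg_cong[OF this, of "\<lambda>x. sqpoly (Suc K) * x"] show ?thesis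
      by (simp only: sqpoly_Suc[of "Suc K"] distrib_left mult_smult_right mult.commute[of _ "[:_:]"] mult_pCons_left
            pCons_0_0 add_0_right mult_zero_left)
  qed
  moreover define T where "T = (\<lambda>k. smult ((-1) ^ (k - 1) * fact (k - 1) ^ 2 / square_diff_prod n k)
                      (sqpoly k * [:of_nat n ^ 2, -1:]))"
  moreover have "1 = smult (c * (of_nat n ^ 2 - of_nat (Suc K) ^ 2)) (sqpoly (Suc K)) + (\<Sum>k = 1..K. T k)"
    using Suc.IH Suc_lessD[OF Suc.prems] unfolding c T_def .
  moreover have "T (Suc K) = smult c (sqpoly (Suc K) * [:of_nat n ^ 2, -1:])"
    by (simp only: T_def c_def diff_Suc_1)
  ultimately show ?case
    unfolding c' T_def[symmetric] by (simp only: sum.cl_ivl_Suc) simp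
qed simp

text \<open>By \<open>square_diff_prod_fact\<close> the summand is the reciprocal of 2k + 1 consecutive integers, a
  difference of two reciprocals of 2k consecutive integers divided by 2k.\<close>

lemma sum_reciprocal_square_diff_prod:
  assumes "k \<ge> 1" "k \<le> N"
  shows "(\<Sum>n = Suc k..N. 1 / (of_nat n * square_diff_prod n k))
       = (1 / fact (2 * k) - fact (N - k) / fact (N + k)) / (2 * of_nat k)"
  using assms(2)
proof (induction N rule: dec_induct)
  case base
  then show ?case by (simp add: mult_2[of k, symmetric])
next
  case (step N)
  define d where "d = N - k"
  have N: "N = k + d" using step by (simp add: d_def)
  have f: "fact (Suc N + k) = (of_nat (2 * k + d + 1) * fact (N + k) :: rat)"
    by (simp add: N algebra_simps)
  have f2: "Suc N - k = Suc d" "Suc N - k - 1 = d" using step by (auto simp: d_def)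
  have f3: "of_nat (Suc N) * square_diff_prod (Suc N) k = fact (Suc N + k) / fact d"
    using square_diff_prod_fact[of k "Suc N"] step f2(2) by simp
  have nz: "(of_nat (2 * k + d + 1) :: rat) \<noteq> 0" "(of_nat k :: rat) \<noteq> 0"
    using assms by (simp_all only: of_nat_eq_0_iff)
  have "(\<Sum>n = Suc k..Suc N. 1 / (of_nat n * square_diff_prod n k))
     = (1 / fact (2 * k) - fact d / fact (N + k)) / (2 * of_nat k) + fact d / fact (Suc N + k)"
    using step by (simp add: f3 d_def del: of_nat_Suc fact_Suc)
  also have "fact d / fact (N + k) = (of_nat (2 * k + d + 1) * fact d / fact (Suc N + k) :: rat)"
    using nz unfolding f by simp
  also have "(1 / fact (2 * k) - of_nat (2 * k + d + 1) * fact d / fact (Suc N + k)) / (2 * of_nat k)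
      + fact d / fact (Suc N + k) = (1 / fact (2 * k) - fact (Suc d) / fact (Suc N + k)) / (2 * of_nat k :: rat)"
  proof -
    have gen: "(a - (2 * j + u) * x / F) / (2 * j) + x / F = (a - u * x / F) / (2 * j)"
      if "j \<noteq> 0" for a u x F j :: rat
      using that by (simp add: diff_divide_distrib add_divide_distrib ring_distribs)
    have "of_nat (2 * k + d + 1) = 2 * of_nat k + (of_nat (Suc d) :: rat)" by simp
    then show ?thesis
      by (simp only: gen[OF nz(2)] fact_Suc[of d])
  qed
  finally show ?case unfolding f2 .
qed

text \<open>Without the factor 1/n, 2n = (n + k) + (n - k) makes twice the reciprocal the sum of two
  reciprocals of products of 2k consecutive integers, which telescopes with alternating signs.\<close>

lemma sum_alternating_reciprocal_square_diff_prod: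
  assumes "k \<le> N"
  shows "(\<Sum>n = Suc k..N. (-1) ^ (n - 1) / square_diff_prod n k)
       = ((-1) ^ k / fact (2 * k) - (-1) ^ N * fact (N - k) / fact (N + k)) / 2"
  using assms
proof (induction N rule: dec_induct)
  case base
  then show ?case by (simp add: mult_2[of k, symmetric])
next
  case (step N)
  define d where "d = N - k"
  have N: "N = k + d" using step by (simp add: d_def)
  have f: "fact (Suc N + k) = (of_nat (2 * k + d + 1) * fact (N + k) :: rat)"
    by (simp add: N algebra_simps)
  have f2: "Suc N - k = Suc d" "Suc N - k - 1 = d" using step by (auto simp: d_def)
  have f3: "of_nat (Suc N) * square_diff_prod (Suc N) k = fact (Suc N + k) / fact d"
    using square_diff_prod_fact[of k "Suc N"] step f2(2) by simp
  have f4: "1 / square_diff_prod (Suc N) k = of_nat (Suc N) * fact d / fact (Suc N + k)"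
  proof -
    have "1 / square_diff_prod (Suc N) k = of_nat (Suc N) / (of_nat (Suc N) * square_diff_prod (Suc N) k)"
      by (simp del: of_nat_Suc)
    then show ?thesis unfolding f3 by simp
  qed
  have nz: "(of_nat (2 * k + d + 1) :: rat) \<noteq> 0"
    by (simp only: of_nat_eq_0_iff)
  have "(\<Sum>n = Suc k..Suc N. (-1) ^ (n - 1) / square_diff_prod n k)
     = ((-1) ^ k / fact (2 * k) - (-1) ^ N * (fact d / fact (N + k))) / 2
       + (-1) ^ N * (1 / square_diff_prod (Suc N) k)"
    using step by (simp add: d_def del: of_nat_Suc fact_Suc)
  also have "fact d / fact (N + k) = (of_nat (2 * k + d + 1) * fact d / fact (Suc N + k) :: rat)"
    using nz unfolding f by simp
  also have "((-1) ^ k / fact (2 * k) - (-1) ^ N * (of_nat (2 * k + d + 1) * fact d / fact (Suc N + k))) / 2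
       + (-1) ^ N * (1 / square_diff_prod (Suc N) k)
       = ((-1) ^ k / fact (2 * k) - (-1) ^ Suc N * fact (Suc d) / fact (Suc N + k)) / (2 :: rat)"
  proof -
    have gen: "(a - s * (w * x / F)) / 2 + s * ((w + u) / 2 * x / F) = (a - (- s) * (u * x) / F) / 2"
      for a s w x u F :: rat
      by (simp add: diff_divide_distrib add_divide_distrib ring_distribs)
    have "of_nat (Suc N) = (of_nat (2 * k + d + 1) + of_nat (Suc d)) / (2 :: rat)"
      by (simp add: N)
    then show ?thesis
      unfolding f4 by (simp only: gen fact_Suc[of d] power_Suc of_nat_mult mult_minus1)
  qed
  finally show ?case unfolding f2 .
qed

definition hcoeff :: "nat \<Rightarrow> nat \<Rightarrow> rat" where
  "hcoeff k m = coeff (sqpoly k) m"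

lemma hcoeff_H2: "k \<ge> 1 \<Longrightarrow> hcoeff k m = (-1) ^ m * H2 (k - 1) m"
  using coeff_sqpoly[of "k - 1" m] by (simp add: hcoeff_def)

abbreviation (input) central_binom :: "nat \<Rightarrow> rat" where "central_binom k \<equiv> of_nat ((2 * k) choose k)"

lemma central_binom_fact: "central_binom k = fact (2 * k) / fact k ^ 2"
  by (simp add: binomial_fact power2_eq_square)

lemma quotient_coeff_sqpoly:
  "quotient_coeff k (sqpoly k) m = hcoeff k m / of_nat k ^ 2 + (\<Sum>j = 1..m. hcoeff k (m - j) / of_nat k ^ (2 * j + 2))"
proof -
  have "quotient_coeff k (sqpoly k) m = (\<Sum>j\<in>{0..m}. hcoeff k (m - j) / of_nat k ^ (2 * j + 2))"
    unfolding quotient_coeff_def hcoeff_def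
    by (rule sum.reindex_bij_witness[of _ "\<lambda>j. m - j" "\<lambda>j. m - j"]) auto
  then show ?thesis by (simp add: sum.atLeast_Suc_atMost[of 0 m] power2_eq_square)
qed

text \<open>The coefficient of t^m in \<open>telescoping_expansion\<close>, divided by n^2 - t, for the longest
  possible expansion k < n; its last term carries the central binomial coefficient.\<close>

lemma reciprocal_power_expansion:
  assumes "n \<ge> 1"
  shows "1 / of_nat n ^ (2 * m + 2) = 2 * (-1) ^ (n - 1) * quotient_coeff n (sqpoly n) m / central_binom n
     + (\<Sum>k = 1..n-1. (-1) ^ (k - 1) * fact (k - 1) ^ 2 / square_diff_prod n k * hcoeff k m)"
proof -
  obtain K where n: "n = Suc K" using assms by (cases n) auto
  have "of_nat n * square_diff_prod n K = fact (2 * K + 1)"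
    using square_diff_prod_fact[of K n] by (simp add: n mult_2 del: of_nat_Suc fact_Suc)
  then have d: "square_diff_prod n K = fact (2 * K + 1) / of_nat n"
    by (simp add: n field_simps del: of_nat_Suc fact_Suc)
  have c: "fact K ^ 2 / square_diff_prod n K = 2 / central_binom n"
  proof -
    have "fact (2 * n) = (2 * of_nat n * fact (2 * K + 1) :: rat)" by (simp add: n)
    moreover have "fact n = (of_nat n * fact K :: rat)" by (simp add: n)
    moreover have "(of_nat n :: rat) \<noteq> 0" using n by simp
    ultimately show ?thesis
      unfolding d central_binom_fact
      by (simp add: power_mult_distrib power2_eq_square del: fact_Suc)
  qed
  have "1 / of_nat n ^ (2 * m + 2) = quotient_coeff n 1 m" by (simp add: quotient_coeff_1)
  also have "quotient_coeff n 1 m = (-1) ^ K * (fact K ^ 2 / square_diff_prod n K) * quotient_coeff n (sqpoly n) m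
     + (\<Sum>k = 1..K. (-1) ^ (k - 1) * fact (k - 1) ^ 2 / square_diff_prod n k * hcoeff k m)"
  proof -
    have "0 < n" "K < n" using n by auto
    from arg_cong[OF telescoping_expansion[OF this(2)], of "\<lambda>A. quotient_coeff n A m"] show ?thesis
      by (simp only: quotient_coeff_add quotient_coeff_smult quotient_coeff_sum quotient_coeff_mult[OF \<open>0 < n\<close>[unfolded n]] hcoeff_def n diff_Suc_1
          times_divide_eq_right)
  qed
  finally show ?thesis unfolding c by (simp add: n)
qed

text \<open>The generating function (5k^2 - t)/(k^2 - t) = 5 + 4 sum_{j>0} (t/k^2)^j, written as
  1 + 4k^2/(k^2 - t), collects the sum over j in the definition.\<close>

lemma zeta_fin_odd_alt:
  "zeta_fin_odd (Suc N) m = (\<Sum>k = 1..N. (-1) ^ (k - 1) *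
     (hcoeff k m / (2 * of_nat k ^ 3 * central_binom k) + 2 * quotient_coeff k (sqpoly k) m / (of_nat k * central_binom k)))"
proof -
  have "zeta_fin_odd (Suc N) m = (\<Sum>k = 1..N. 5 / 2 *
       ((-1) ^ (k + m - 1) * H2 (k - 1) m / (of_nat k ^ 3 * central_binom k))
     + 2 * (\<Sum>j = 1..m. (-1) ^ (k + m - j - 1) * H2 (k - 1) (m - j)
         / (of_nat k ^ (2 * j + 3) * central_binom k)))"
    unfolding zeta_fin_odd_def
    by (subst sum.swap[where A = "{1..m}"]) (simp add: sum.distrib sum_distrib_left)
  also have "\<dots> = (\<Sum>k = 1..N. (-1) ^ (k - 1) *
     (hcoeff k m / (2 * of_nat k ^ 3 * central_binom k) + 2 * quotient_coeff k (sqpoly k) m / (of_nat k * central_binom k)))"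
  proof (intro sum.cong refl)
    fix k assume k: "k \<in> {1..N}"
    have 1: "(-1) ^ (k + m - 1) * H2 (k - 1) m = (-1) ^ (k - 1) * hcoeff k m"
      using k by (simp add: hcoeff_H2 power_add[symmetric] mult.assoc[symmetric])
    have 2: "(\<Sum>j = 1..m. (-1) ^ (k + m - j - 1) * H2 (k - 1) (m - j) / (of_nat k ^ (2 * j + 3) * central_binom k))
       = (-1) ^ (k - 1) / (of_nat k * central_binom k) * (\<Sum>j = 1..m. hcoeff k (m - j) / of_nat k ^ (2 * j + 2))"
      unfolding sum_distrib_left
    proof (intro sum.cong refl)
      fix j assume j: "j \<in> {1..m}"
      have "(-1) ^ (k + m - j - 1) * H2 (k - 1) (m - j) = (-1) ^ (k - 1) * hcoeff k (m - j)"
        using k j by (simp add: hcoeff_H2 power_add[symmetric] mult.assoc[symmetric])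
      then show "(-1) ^ (k + m - j - 1) * H2 (k - 1) (m - j) / (of_nat k ^ (2 * j + 3) * central_binom k)
         = (-1) ^ (k - 1) / (of_nat k * central_binom k) * (hcoeff k (m - j) / of_nat k ^ (2 * j + 2))"
        by (simp add: power_add power3_eq_cube power2_eq_square)
    qed
    have k0: "(of_nat k :: rat) \<noteq> 0" "central_binom k \<noteq> 0" using k by auto
    show "5 / 2 * ((-1) ^ (k + m - 1) * H2 (k - 1) m / (of_nat k ^ 3 * central_binom k))
     + 2 * (\<Sum>j = 1..m. (-1) ^ (k + m - j - 1) * H2 (k - 1) (m - j) / (of_nat k ^ (2 * j + 3) * central_binom k))
     = (-1) ^ (k - 1) *
     (hcoeff k m / (2 * of_nat k ^ 3 * central_binom k) + 2 * quotient_coeff k (sqpoly k) m / (of_nat k * central_binom k))"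
      unfolding 1 2 quotient_coeff_sqpoly using k0
      by (simp add: power3_eq_cube power2_eq_square algebra_simps add_divide_distrib)
  qed
  finally show ?thesis .
qed

text \<open>The same for (3k^2 + t)/(k^2 - t), which is 4k^2/(k^2 - t) - 1.\<close>

lemma zeta_fin_even_alt:
  "zeta_fin_even (Suc N) m = (\<Sum>k = 1..N.
     (2 * quotient_coeff k (sqpoly k) m / central_binom k - hcoeff k m / (2 * of_nat k ^ 2 * central_binom k)))"
proof -
  have "zeta_fin_even (Suc N) m = (\<Sum>k = 1..N. 3 / 2 *
       ((-1) ^ m * H2 (k - 1) m / (of_nat k ^ 2 * central_binom k))
     + 2 * (\<Sum>j = 1..m. (-1) ^ (m - j) * H2 (k - 1) (m - j)
         / (of_nat k ^ (2 * j + 2) * central_binom k)))"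
    unfolding zeta_fin_even_def
    by (subst sum.swap[where A = "{1..m}"]) (simp add: sum.distrib sum_distrib_left)
  also have "\<dots> = (\<Sum>k = 1..N.
     (2 * quotient_coeff k (sqpoly k) m / central_binom k - hcoeff k m / (2 * of_nat k ^ 2 * central_binom k)))"
  proof (intro sum.cong refl)
    fix k assume k: "k \<in> {1..N}"
    have 1: "(-1) ^ i * H2 (k - 1) i = hcoeff k i" for i
      using k by (simp add: hcoeff_H2)
    have 2: "(\<Sum>j = 1..m. hcoeff k (m - j) / (of_nat k ^ (2 * j + 2) * central_binom k))
       = (\<Sum>j = 1..m. hcoeff k (m - j) / of_nat k ^ (2 * j + 2)) / central_binom k"
      by (simp add: sum_divide_distrib)
    have k0: "(of_nat k :: rat) \<noteq> 0" "central_binom k \<noteq> 0" using k by auto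
    show "3 / 2 * ((-1) ^ m * H2 (k - 1) m / (of_nat k ^ 2 * central_binom k))
     + 2 * (\<Sum>j = 1..m. (-1) ^ (m - j) * H2 (k - 1) (m - j) / (of_nat k ^ (2 * j + 2) * central_binom k))
     = 2 * quotient_coeff k (sqpoly k) m / central_binom k - hcoeff k m / (2 * of_nat k ^ 2 * central_binom k)"
      unfolding 1 2 quotient_coeff_sqpoly using k0
      by (simp add: algebra_simps add_divide_distrib)
  qed
  finally show ?thesis .
qed

text \<open>The contributions of the upper ends of the telescoping sums over n.\<close>

definition apery_remainder :: "nat \<Rightarrow> nat \<Rightarrow> rat" where
  "apery_remainder N k = (-1) ^ (k - 1) * fact (k - 1) ^ 2 * fact (N - k) / fact (N + k)"

lemma triangle_swap:
  fixes f :: "nat \<Rightarrow> nat \<Rightarrow> rat"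
  shows "(\<Sum>n = 1..N. \<Sum>k = 1..n-1. f n k) = (\<Sum>k = 1..N. \<Sum>n = Suc k..N. f n k)"
  by (subst sum.Sigma, simp, simp, subst sum.Sigma, simp, simp)
    (rule sum.reindex_bij_witness[of _ "\<lambda>(a, b). (b, a)" "\<lambda>(a, b). (b, a)"], auto)

lemma factorial_ratio:
  assumes "k \<ge> 1"
  shows "fact (k - 1) ^ 2 / fact (2 * k) = 1 / (of_nat k ^ 2 * central_binom k)"
proof -
  have "fact k = (of_nat k * fact (k - 1) :: rat)"
    using assms by (simp add: fact_reduce)
  moreover have "f ^ 2 / F = 1 / (j ^ 2 * (F / (j * f) ^ 2))" if "j \<noteq> 0" for f F j :: rat
    using that by (simp add: power_mult_distrib)
  ultimately show ?thesis unfolding central_binom_fact using assms by simp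
qed

text \<open>Exchanging the sums over n and k, the inner sum over n splits into its two ends.  The lower end
  1/(2k)! has the same shape as the last terms of the expansions and completes them to the finite
  zeta value.\<close>

lemma zeta_fin_odd_exact:
  "zeta_fin_odd (Suc N) m = (\<Sum>n = 1..N. 1 / of_nat n ^ (2 * m + 3))
     + (\<Sum>k = 1..N. hcoeff k m * apery_remainder N k / (2 * of_nat k))"
proof -
  let ?X = "\<Sum>n = 1..N. 1 / of_nat n ^ (2 * m + 3) :: rat"
  let ?A = "\<Sum>n = 1..N. (-1) ^ (n - 1) * (2 * quotient_coeff n (sqpoly n) m / (of_nat n * central_binom n))"
  let ?B = "\<Sum>k = 1..N. (-1) ^ (k - 1) * (hcoeff k m / (2 * of_nat k ^ 3 * central_binom k))"
  let ?C = "\<Sum>k = 1..N. hcoeff k m * apery_remainder N k / (2 * of_nat k)"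
  have "(\<Sum>n = 1..N. 1 / of_nat n ^ (2 * m + 3) :: rat)
      = (\<Sum>n = 1..N. 1 / of_nat n * (1 / of_nat n ^ (2 * m + 2)) :: rat)"
    by (simp add: eval_nat_numeral)
  also have "\<dots> = (\<Sum>n = 1..N. (-1) ^ (n - 1) * (2 * quotient_coeff n (sqpoly n) m / (of_nat n * central_binom n))
     + (\<Sum>k = 1..n-1. (-1) ^ (k - 1) * fact (k - 1) ^ 2 * hcoeff k m * (1 / (of_nat n * square_diff_prod n k))))"
  proof (intro sum.cong refl)
    fix n assume "n \<in> {1..N}"
    then have "n \<ge> 1" by simp
    show "1 / of_nat n * (1 / of_nat n ^ (2 * m + 2)) = (-1) ^ (n - 1) * (2 * quotient_coeff n (sqpoly n) m / (of_nat n * central_binom n))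
     + (\<Sum>k = 1..n-1. (-1) ^ (k - 1) * fact (k - 1) ^ 2 * hcoeff k m * (1 / (of_nat n * square_diff_prod n k)))"
      unfolding reciprocal_power_expansion[OF \<open>n \<ge> 1\<close>] distrib_left sum_distrib_left
      by (intro arg_cong2[of _ _ _ _ "(+)"] sum.cong refl) (simp_all add: mult_ac)
  qed
  also have "\<dots> = (\<Sum>n = 1..N. (-1) ^ (n - 1) * (2 * quotient_coeff n (sqpoly n) m / (of_nat n * central_binom n)))
     + (\<Sum>k = 1..N. (-1) ^ (k - 1) * fact (k - 1) ^ 2 * hcoeff k m * (\<Sum>n = Suc k..N. 1 / (of_nat n * square_diff_prod n k)))"
    unfolding sum.distrib triangle_swap sum_distrib_left ..
  also have "(\<Sum>k = 1..N. (-1) ^ (k - 1) * fact (k - 1) ^ 2 * hcoeff k m * (\<Sum>n = Suc k..N. 1 / (of_nat n * square_diff_prod n k)))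
     = (\<Sum>k = 1..N. (-1) ^ (k - 1) * (hcoeff k m / (2 * of_nat k ^ 3 * central_binom k)) - hcoeff k m * apery_remainder N k / (2 * of_nat k))"
  proof (intro sum.cong refl)
    fix k assume k: "k \<in> {1..N}"
    have "(-1) ^ (k - 1) * fact (k - 1) ^ 2 * hcoeff k m * (\<Sum>n = Suc k..N. 1 / (of_nat n * square_diff_prod n k))
       = (-1) ^ (k - 1) * hcoeff k m / (2 * of_nat k) * (fact (k - 1) ^ 2 / fact (2 * k)) - hcoeff k m * apery_remainder N k / (2 * of_nat k)"
    proof -
      have gen: "s * f * h * ((1 / F - x / G) / (2 * j)) = s * h / (2 * j) * (f / F) - h * (s * f * x / G) / (2 * j)"
        for f h F x G j s :: rat
        by (simp add: diff_divide_distrib right_diff_distrib mult_ac)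
      show ?thesis
        using k by (subst sum_reciprocal_square_diff_prod) (simp_all only: apery_remainder_def gen atLeastAtMost_iff)
    qed
    also have "fact (k - 1) ^ 2 / fact (2 * k) = 1 / (of_nat k ^ 2 * central_binom k)"
      using factorial_ratio k by auto
    finally show "(-1) ^ (k - 1) * fact (k - 1) ^ 2 * hcoeff k m * (\<Sum>n = Suc k..N. 1 / (of_nat n * square_diff_prod n k))
       = (-1) ^ (k - 1) * (hcoeff k m / (2 * of_nat k ^ 3 * central_binom k)) - hcoeff k m * apery_remainder N k / (2 * of_nat k)"
      by (simp add: power3_eq_cube power2_eq_square mult_ac)
  qed
  also have "\<dots> = ?B - ?C"
    by (rule sum_subtractf)
  finally have "?X = ?A + (?B - ?C)" .
  moreover have "zeta_fin_odd (Suc N) m = ?A + ?B"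
    unfolding zeta_fin_odd_alt by (simp only: distrib_left sum.distrib)
  ultimately show ?thesis by linarith
qed

lemma zeta_fin_even_exact:
  assumes "even N"
  shows "zeta_fin_even (Suc N) m = (\<Sum>n = 1..N. (-1) ^ (n - 1) / of_nat n ^ (2 * m + 2))
     + (\<Sum>k = 1..N. hcoeff k m * apery_remainder N k) / 2"
proof -
  let ?X = "\<Sum>n = 1..N. (-1) ^ (n - 1) / of_nat n ^ (2 * m + 2) :: rat"
  let ?A = "\<Sum>n = 1..N. 2 * quotient_coeff n (sqpoly n) m / central_binom n"
  let ?B = "\<Sum>k = 1..N. hcoeff k m / (2 * of_nat k ^ 2 * central_binom k)"
  let ?C = "\<Sum>k = 1..N. hcoeff k m * apery_remainder N k"
  have sgn: "(-1) ^ (n - 1) * (-1) ^ (n - 1) = (1 :: rat)" for n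
    by (rule minus_one_mult_self)
  have "(\<Sum>n = 1..N. (-1) ^ (n - 1) / of_nat n ^ (2 * m + 2) :: rat)
      = (\<Sum>n = 1..N. (-1) ^ (n - 1) * (1 / of_nat n ^ (2 * m + 2)) :: rat)"
    by simp
  also have "\<dots> = (\<Sum>n = 1..N. 2 * quotient_coeff n (sqpoly n) m / central_binom n
     + (\<Sum>k = 1..n-1. (-1) ^ (k - 1) * fact (k - 1) ^ 2 * hcoeff k m * ((-1) ^ (n - 1) / square_diff_prod n k)))"
  proof (intro sum.cong refl)
    fix n assume "n \<in> {1..N}"
    then have "n \<ge> 1" by simp
    have 1: "(-1) ^ (n - 1) * (2 * (-1) ^ (n - 1) * q / c) = 2 * q / c" for q c :: rat
    proof -
      have "s * (2 * s * q / c) = s * s * (2 * q / c)" for s by simp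
      then show ?thesis by (simp only: sgn mult_1_left)
    qed
    show "(-1) ^ (n - 1) * (1 / of_nat n ^ (2 * m + 2)) = 2 * quotient_coeff n (sqpoly n) m / central_binom n
     + (\<Sum>k = 1..n-1. (-1) ^ (k - 1) * fact (k - 1) ^ 2 * hcoeff k m * ((-1) ^ (n - 1) / square_diff_prod n k))"
      unfolding reciprocal_power_expansion[OF \<open>n \<ge> 1\<close>] distrib_left sum_distrib_left 1
      by (intro arg_cong2[of _ _ _ _ "(+)"] sum.cong refl) (simp_all add: mult_ac)
  qed
  also have "\<dots> = (\<Sum>n = 1..N. 2 * quotient_coeff n (sqpoly n) m / central_binom n)
     + (\<Sum>k = 1..N. (-1) ^ (k - 1) * fact (k - 1) ^ 2 * hcoeff k m * (\<Sum>n = Suc k..N. (-1) ^ (n - 1) / square_diff_prod n k))"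
    unfolding sum.distrib triangle_swap sum_distrib_left ..
  also have "(\<Sum>k = 1..N. (-1) ^ (k - 1) * fact (k - 1) ^ 2 * hcoeff k m * (\<Sum>n = Suc k..N. (-1) ^ (n - 1) / square_diff_prod n k))
     = (\<Sum>k = 1..N. (-1) * (hcoeff k m / (2 * of_nat k ^ 2 * central_binom k)) + (-1/2) * (hcoeff k m * apery_remainder N k))"
  proof (intro sum.cong refl)
    fix k assume k: "k \<in> {1..N}"
    have sk: "(-1) ^ (k - 1) * (-1) ^ k = (-1 :: rat)"
      using k sgn[of k] by (cases k) (simp_all only: atLeastAtMost_iff power_Suc diff_Suc_1 mult.left_commute[of _ "-1"], simp_all)
    have "(-1) ^ (k - 1) * fact (k - 1) ^ 2 * hcoeff k m * (\<Sum>n = Suc k..N. (-1) ^ (n - 1) / square_diff_prod n k)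
       = ((-1) ^ (k - 1) * (-1) ^ k) * hcoeff k m / 2 * (fact (k - 1) ^ 2 / fact (2 * k)) - hcoeff k m * apery_remainder N k / 2"
    proof -
      have gen: "s * f * h * ((e / F - 1 * x / G) / 2) = s * e * h / 2 * (f / F) - h * (s * f * x / G) / 2"
        for f h F x G s e :: rat
        by (simp add: diff_divide_distrib right_diff_distrib mult_ac)
      have "(-1) ^ N = (1 :: rat)" using assms by simp
      then show ?thesis
        using k by (subst sum_alternating_reciprocal_square_diff_prod) (simp_all only: apery_remainder_def gen atLeastAtMost_iff)
    qed
    also have "fact (k - 1) ^ 2 / fact (2 * k) = 1 / (of_nat k ^ 2 * central_binom k)"
      using factorial_ratio k by auto
    finally show "(-1) ^ (k - 1) * fact (k - 1) ^ 2 * hcoeff k m * (\<Sum>n = Suc k..N. (-1) ^ (n - 1) / square_diff_prod n k)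
       = (-1) * (hcoeff k m / (2 * of_nat k ^ 2 * central_binom k)) + (-1/2) * (hcoeff k m * apery_remainder N k)"
      unfolding sk by (simp add: mult_ac)
  qed
  also have "\<dots> = - ?B - ?C / 2"
    by (simp only: sum.distrib sum_distrib_left[symmetric])
  finally have "?X = ?A + (- ?B - ?C / 2)" .
  moreover have "zeta_fin_even (Suc N) m = ?A - ?B"
    by (simp only: zeta_fin_even_alt sum_subtractf)
  ultimately show ?thesis by linarith
qed

section \<open>Values of the generating polynomials at squares of integers\<close>

text \<open>The product that the values of P_k at two neighbouring squares have in common: n P_k(n^2) and
  (n+1) P_k((n+1)^2) are both linear multiples of it, and its sum over k with weight 1/k telescopes.\<close>

definition wprod :: "nat \<Rightarrow> nat \<Rightarrow> rat" where
  "wprod n k = (\<Prod>j = 1..<k. (of_nat j + of_nat n) * (of_nat j - 1 - of_nat n) / of_nat j ^ 2)"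

lemma wprod_1 [simp]: "wprod n (Suc 0) = 1"
  by (simp add: wprod_def)

lemma wprod_Suc: "k \<ge> 1 \<Longrightarrow> wprod n (Suc k) =
    wprod n k * ((of_nat k + of_nat n) * (of_nat k - 1 - of_nat n) / of_nat k ^ 2)"
  by (simp add: wprod_def prod.atLeastLessThan_Suc)

lemma wprod_eq_0: "K > n \<Longrightarrow> wprod n (Suc K) = 0"
  unfolding wprod_def by (rule prod_zero) (auto intro!: bexI[of _ "Suc n"])

lemma poly_sqpoly_Suc: "k \<ge> 1 \<Longrightarrow> poly (sqpoly (Suc k)) (x ^ 2) = poly (sqpoly k) (x ^ 2) * ((of_nat k - x) * (of_nat k + x) / of_nat k ^ 2)"
  by (simp add: sqpoly_Suc field_simps power2_eq_square)

lemma poly_sqpoly_wprod: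
  assumes "k \<ge> 1"
  shows "of_nat n * poly (sqpoly k) (of_nat n ^ 2) = (of_nat n + 1 - of_nat k) * wprod n k"
    and "of_nat (Suc n) * poly (sqpoly k) (of_nat (Suc n) ^ 2) = (of_nat n + of_nat k) * wprod n k"
proof -
  have "of_nat n * poly (sqpoly k) (of_nat n ^ 2) = (of_nat n + 1 - of_nat k) * wprod n k
      \<and> of_nat (Suc n) * poly (sqpoly k) (of_nat (Suc n) ^ 2) = (of_nat n + of_nat k) * wprod n k"
    using assms
  proof (induction k rule: dec_induct)
    case (step k)
    define x y z :: rat where "x = of_nat n" and "y = of_nat k" and "z = of_nat (Suc n)"
    have z: "z = x + 1" by (simp add: x_def z_def)
    have IH: "x * poly (sqpoly k) (x ^ 2) = (x + 1 - y) * wprod n k"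
      "z * poly (sqpoly k) (z ^ 2) = (x + y) * wprod n k"
      using step by (simp_all add: x_def y_def z_def)
    have 1: "x * poly (sqpoly (Suc k)) (x ^ 2) = (x + 1 - y) * wprod n k * ((y - x) * (y + x) / y ^ 2)"
      using step(1) unfolding IH(1)[symmetric] by (subst poly_sqpoly_Suc) (simp_all add: y_def)
    have 2: "z * poly (sqpoly (Suc k)) (z ^ 2) = (x + y) * wprod n k * ((y - z) * (y + z) / y ^ 2)"
      using step(1) unfolding IH(2)[symmetric] by (subst poly_sqpoly_Suc) (simp_all add: y_def)
    have 3: "wprod n (Suc k) = wprod n k * ((y + x) * (y - 1 - x) / y ^ 2)"
      using step(1) by (simp add: wprod_Suc x_def y_def)
    have "x * poly (sqpoly (Suc k)) (x ^ 2) = (x - y) * wprod n (Suc k)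
      \<and> z * poly (sqpoly (Suc k)) (z ^ 2) = (x + (y + 1)) * wprod n (Suc k)"
    proof -
      have "(x + 1 - y) * w * ((y - x) * (y + x) / Y) = (x - y) * (w * ((y + x) * (y - 1 - x) / Y))"
        "(x + y) * w * ((y - (x + 1)) * (y + (x + 1)) / Y) = (x + (y + 1)) * (w * ((y + x) * (y - 1 - x) / Y))"
        for w Y :: rat
        by (simp_all add: algebra_simps)
      then show ?thesis using 1 2 3 by (simp only: z)
    qed
    then show ?case by (simp add: x_def y_def z_def)
  qed simp
  then show "of_nat n * poly (sqpoly k) (of_nat n ^ 2) = (of_nat n + 1 - of_nat k) * wprod n k"
    and "of_nat (Suc n) * poly (sqpoly k) (of_nat (Suc n) ^ 2) = (of_nat n + of_nat k) * wprod n k"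
    by auto
qed

text \<open>Summation by parts: k W_{k+1} - (k-1) W_k = - n (n+1) W_k / k, where W_k is the product.\<close>

lemma sum_wprod_over_k:
  "of_nat n * of_nat (Suc n) * (\<Sum>k = 1..K. wprod n k / of_nat k) = - of_nat K * wprod n (Suc K)"
proof (induction K)
  case (Suc K)
  define x y :: rat where "x = of_nat n" and "y = of_nat (Suc K)"
  have y: "y \<noteq> 0" "of_nat K = y - 1" by (simp_all add: y_def)
  have w: "wprod n (Suc (Suc K)) = wprod n (Suc K) * ((y + x) * (y - 1 - x) / y ^ 2)"
    using wprod_Suc[of "Suc K" n] by (simp add: x_def y_def)
  have "x * (x + 1) * (\<Sum>k = 1..Suc K. wprod n k / of_nat k)
      = x * (x + 1) * (\<Sum>k = 1..K. wprod n k / of_nat k) + x * (x + 1) * (wprod n (Suc K) / y)"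
    by (simp add: distrib_left[of "x * (x + 1)"] y_def)
  also have "x * (x + 1) * (\<Sum>k = 1..K. wprod n k / of_nat k) = - (y - 1) * wprod n (Suc K)"
    using Suc.IH unfolding x_def y(2)[symmetric] by (simp only: of_nat_Suc add.commute)
  also have "- (y - 1) * wprod n (Suc K) + x * (x + 1) * (wprod n (Suc K) / y) = - y * wprod n (Suc (Suc K))"
    unfolding w using y(1) by (simp add: field_simps power2_eq_square)
  finally show ?case by (simp add: x_def y_def add.commute)
qed simp

text \<open>Here W_{k+1} - W_k = - (k + n (n+1)) W_k / k^2.\<close>

lemma sum_wprod_over_k2:
  "(\<Sum>k = 1..K. wprod n k / of_nat k) + of_nat n * of_nat (Suc n) * (\<Sum>k = 1..K. wprod n k / of_nat k ^ 2)
     = 1 - wprod n (Suc K)"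
proof (induction K)
  case (Suc K)
  define x y :: rat where "x = of_nat n" and "y = of_nat (Suc K)"
  have y: "y \<noteq> 0" by (simp add: y_def)
  have w: "wprod n (Suc (Suc K)) = wprod n (Suc K) * ((y + x) * (y - 1 - x) / y ^ 2)"
    using wprod_Suc[of "Suc K" n] by (simp add: x_def y_def)
  have "(\<Sum>k = 1..Suc K. wprod n k / of_nat k) + x * (x + 1) * (\<Sum>k = 1..Suc K. wprod n k / of_nat k ^ 2)
      = ((\<Sum>k = 1..K. wprod n k / of_nat k) + x * (x + 1) * (\<Sum>k = 1..K. wprod n k / of_nat k ^ 2))
        + wprod n (Suc K) / y + x * (x + 1) * (wprod n (Suc K) / y ^ 2)"
    by (simp add: distrib_left[of "x * (x + 1)"] y_def)
  also have "(\<Sum>k = 1..K. wprod n k / of_nat k) + x * (x + 1) * (\<Sum>k = 1..K. wprod n k / of_nat k ^ 2)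
      = 1 - wprod n (Suc K)"
    using Suc.IH unfolding x_def by (simp only: of_nat_Suc add.commute)
  also have "1 - wprod n (Suc K) + wprod n (Suc K) / y + x * (x + 1) * (wprod n (Suc K) / y ^ 2)
      = 1 - wprod n (Suc (Suc K))"
    unfolding w using y(1) by (simp add: field_simps power2_eq_square)
  finally show ?case by (simp add: x_def y_def add.commute)
qed simp

lemma poly_sqpoly_eq_0: "n < k \<Longrightarrow> n > 0 \<Longrightarrow> poly (sqpoly k) (of_nat n ^ 2) = 0"
  unfolding sqpoly_def poly_prod by (rule prod_zero) (auto intro!: bexI[of _ n])

lemma sum_sqpoly_at_1:
  assumes "N \<ge> 1"
  shows "(\<Sum>k = 1..N. poly (sqpoly k) 1 / of_nat k ^ s) = 1"
proof -
  have "(\<Sum>k = Suc 1..N. poly (sqpoly k) 1 / of_nat k ^ s) = 0"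
    using poly_sqpoly_eq_0[of 1] by (intro sum.neutral) auto
  then show ?thesis using assms by (subst sum.atLeast_Suc_atMost) auto
qed

text \<open>Induction on n: the sums for n and n + 1, multiplied by n and n + 1, add up to (2n + 1) sum W_k/k, which
  vanishes because W_{N+1} contains a zero factor.\<close>

lemma sum_sqpoly_over_k:
  assumes "1 \<le> n" "n \<le> N"
  shows "(\<Sum>k = 1..N. poly (sqpoly k) (of_nat n ^ 2) / of_nat k) = (-1) ^ (n - 1) / of_nat n"
proof -
  have "of_nat n * (\<Sum>k = 1..N. poly (sqpoly k) (of_nat n ^ 2) / of_nat k) = (-1) ^ (n - 1)"
    using assms
  proof (induction n rule: dec_induct)
    case base
    then show ?case using sum_sqpoly_at_1[of N 1] by simp
  next
    case (step n)
    have w: "(\<Sum>k = 1..N. wprod n k / of_nat k) = 0"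
      using sum_wprod_over_k[of n N] step by (simp add: wprod_eq_0 del: of_nat_Suc)
    have "of_nat (Suc n) * (\<Sum>k = 1..N. poly (sqpoly k) (of_nat (Suc n) ^ 2) / of_nat k)
        + of_nat n * (\<Sum>k = 1..N. poly (sqpoly k) (of_nat n ^ 2) / of_nat k)
        = (\<Sum>k = 1..N. (2 * of_nat n + 1) * (wprod n k / of_nat k))"
      unfolding sum_distrib_left sum.distrib[symmetric]
    proof (intro sum.cong refl)
      fix k assume "k \<in> {1..N}"
      then have k: "k \<ge> 1" by simp
      show "of_nat (Suc n) * (poly (sqpoly k) (of_nat (Suc n) ^ 2) / of_nat k)
          + of_nat n * (poly (sqpoly k) (of_nat n ^ 2) / of_nat k) = (2 * of_nat n + 1) * (wprod n k / of_nat k)"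
        by (simp only: times_divide_eq_right poly_sqpoly_wprod[OF k, of n] add_divide_distrib[symmetric])
          (simp add: algebra_simps)
    qed
    also have "\<dots> = 0" by (simp only: sum_distrib_left[symmetric] w mult_zero_right)
    finally have "of_nat (Suc n) * (\<Sum>k = 1..N. poly (sqpoly k) (of_nat (Suc n) ^ 2) / of_nat k) + (-1) ^ (n - 1) = 0"
      using step.IH step.prems by (simp only: Suc_leD)
    moreover have "(-1) ^ n = - ((-1) ^ (n - 1) :: rat)"
      using step(1) by (cases n) simp_all
    ultimately show ?case
      by (simp only: diff_Suc_1 eq_neg_iff_add_eq_0)
  qed
  then show ?thesis using assms by (subst nonzero_eq_divide_eq) (simp_all add: mult.commute)
qed

text \<open>H_n + H_{n-1} for harmonic numbers of order s.  For s = 1 this combination, unlike H_n itself, is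
  symmetric under n -> p - n modulo p.\<close>

definition harm2 :: "nat \<Rightarrow> nat \<Rightarrow> rat" where
  "harm2 s n = (\<Sum>i = 1..n. 1 / of_nat i ^ s) + (\<Sum>i = 1..<n. 1 / of_nat i ^ s)"

lemma harm2_Suc: "n \<ge> 1 \<Longrightarrow> harm2 s (Suc n) = harm2 s n + 1 / of_nat (Suc n) ^ s + 1 / of_nat n ^ s"
  by (simp add: harm2_def sum.atLeastLessThan_Suc)

text \<open>Induction on n: the sums for n + 1 and n, multiplied by (n+1)^2 and n^2, differ by (2n + 1) sum W_k/k^2, and
  this equals (2n + 1)/(n (n+1)) = 1/n + 1/(n+1).\<close>

lemma sum_sqpoly_over_k3:
  assumes "1 \<le> n" "n \<le> N"
  shows "(\<Sum>k = 1..N. poly (sqpoly k) (of_nat n ^ 2) / of_nat k ^ 3) = harm2 1 n / of_nat n ^ 2"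
proof -
  have "of_nat n ^ 2 * (\<Sum>k = 1..N. poly (sqpoly k) (of_nat n ^ 2) / of_nat k ^ 3) = harm2 1 n"
    using assms
  proof (induction n rule: dec_induct)
    case base
    then show ?case using sum_sqpoly_at_1[of N 3] by (simp add: harm2_def)
  next
    case (step n)
    have w: "of_nat n * of_nat (Suc n) * (\<Sum>k = 1..N. wprod n k / of_nat k ^ 2) = 1"
      using sum_wprod_over_k2[of n N] sum_wprod_over_k[of n N] step
      by (simp add: wprod_eq_0 del: of_nat_Suc)
    have n0: "(of_nat n :: rat) \<noteq> 0" "(of_nat (Suc n) :: rat) \<noteq> 0" using step by auto
    have "of_nat (Suc n) ^ 2 * (\<Sum>k = 1..N. poly (sqpoly k) (of_nat (Suc n) ^ 2) / of_nat k ^ 3)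
        - of_nat n ^ 2 * (\<Sum>k = 1..N. poly (sqpoly k) (of_nat n ^ 2) / of_nat k ^ 3)
        = (\<Sum>k = 1..N. (2 * of_nat n + 1) * (wprod n k / of_nat k ^ 2))"
      unfolding sum_distrib_left sum_subtractf[symmetric]
    proof (intro sum.cong refl)
      fix k assume "k \<in> {1..N}"
      then have k: "k \<ge> 1" by simp
      have "of_nat (Suc n) ^ 2 * (poly (sqpoly k) (of_nat (Suc n) ^ 2) / of_nat k ^ 3)
          - of_nat n ^ 2 * (poly (sqpoly k) (of_nat n ^ 2) / of_nat k ^ 3)
          = (of_nat (Suc n) * (of_nat (Suc n) * poly (sqpoly k) (of_nat (Suc n) ^ 2))
          - of_nat n * (of_nat n * poly (sqpoly k) (of_nat n ^ 2))) / of_nat k ^ 3"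
        by (simp only: power2_eq_square mult.assoc times_divide_eq_right diff_divide_distrib)
      also have "\<dots> = (2 * of_nat n + 1) * of_nat k * wprod n k / of_nat k ^ 3"
        unfolding poly_sqpoly_wprod[OF k, of n] by (simp add: algebra_simps)
      also have "\<dots> = (2 * of_nat n + 1) * (wprod n k / of_nat k ^ 2)"
        using k by (simp add: power3_eq_cube power2_eq_square)
      finally show "of_nat (Suc n) ^ 2 * (poly (sqpoly k) (of_nat (Suc n) ^ 2) / of_nat k ^ 3)
          - of_nat n ^ 2 * (poly (sqpoly k) (of_nat n ^ 2) / of_nat k ^ 3)
          = (2 * of_nat n + 1) * (wprod n k / of_nat k ^ 2)" .
    qed
    also have "\<dots> = (2 * of_nat n + 1) * (1 / (of_nat n * of_nat (Suc n)))"
    proof -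
      have "(\<Sum>k = 1..N. wprod n k / of_nat k ^ 2) = 1 / (of_nat n * of_nat (Suc n))"
        using w n0 by (simp add: nonzero_eq_divide_eq mult.commute del: of_nat_Suc)
      then show ?thesis by (simp only: sum_distrib_left[symmetric])
    qed
    also have "\<dots> = 1 / of_nat (Suc n) + 1 / of_nat n"
      using n0 by (simp add: field_simps)
    finally show ?case using step harm2_Suc[of n 1] by simp
  qed
  then show ?thesis using assms by (subst nonzero_eq_divide_eq) (simp_all add: mult.commute)
qed

section \<open>Interpolation at squares of integers\<close>

text \<open>P_{N+1} without its factor at j, hence the Lagrange polynomial of the node t = j^2 up to a constant.
  \<open>lagrange_coeff\<close> is the inverse of its value at that node.\<close>

definition lagrange_basis :: "nat \<Rightarrow> nat \<Rightarrow> rat poly" where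
  "lagrange_basis N j = (\<Prod>i\<in>{1..N} - {j}. [:1, - (1 / of_nat i ^ 2):])"

definition lagrange_coeff :: "nat \<Rightarrow> nat \<Rightarrow> rat" where
  "lagrange_coeff N j = 2 * (-1) ^ (j - 1) * fact N ^ 2 / (fact (N - j) * fact (N + j))"

lemma degree_prod_linear_le: "degree (\<Prod>i\<in>I. [:1, - (1 / of_nat i ^ 2):] :: rat poly) \<le> card I"
proof (induction I rule: infinite_finite_induct)
  case (insert i I)
  let ?a = "[:1, - (1 / of_nat i ^ 2) :: rat:]"
  have "degree (?a * (\<Prod>i\<in>I. [:1, - (1 / of_nat i ^ 2):])) \<le> degree ?a + degree (\<Prod>i\<in>I. [:1, - (1 / of_nat i ^ 2) :: rat:])"
    by (rule degree_mult_le)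
  also have "\<dots> \<le> 1 + card I"
    using insert.IH by (intro add_mono) simp_all
  finally show ?case
    unfolding prod.insert[OF insert.hyps] card_insert_disjoint[OF insert.hyps] plus_1_eq_Suc .
qed simp_all

text \<open>Multiplying by n^2 - t at n = j restores j^2 P_{N+1}, so the coefficients are those of the
  corresponding power series quotient.\<close>

lemma coeff_lagrange_basis:
  assumes "j \<in> {1..N}"
  shows "coeff (lagrange_basis N j) m = of_nat j ^ 2 * quotient_coeff j (sqpoly (Suc N)) m"
proof -
  have j: "j > 0" "(of_nat j :: rat) \<noteq> 0" using assms by auto
  have "sqpoly (Suc N) = lagrange_basis N j * [:1, - (1 / of_nat j ^ 2):]"
    unfolding sqpoly_def lagrange_basis_def
    by (simp only: atLeastLessThanSuc_atLeastAtMost prod.remove[OF finite_atLeastAtMost assms] mult.commute)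
  moreover have "smult (of_nat j ^ 2) [:1, - (1 / of_nat j ^ 2):] = [:of_nat j ^ 2, -1 :: rat:]"
    using j(2) by (simp only: smult_pCons smult_0_right mult_1_right) simp
  ultimately have "smult (of_nat j ^ 2) (sqpoly (Suc N)) = lagrange_basis N j * [:of_nat j ^ 2, -1:]"
    by (simp only: mult_smult_right[symmetric])
  from arg_cong[OF this, of "\<lambda>A. quotient_coeff j A m"] show ?thesis
    by (simp only: quotient_coeff_mult[OF j(1)] quotient_coeff_smult)
qed

lemma poly_lagrange_basis:
  assumes "j \<ge> 1" "j \<le> N"
  shows "poly (lagrange_basis N j) (of_nat j ^ 2) * lagrange_coeff N j = 1"
proof -
  have "poly (lagrange_basis N j) (of_nat j ^ 2) = (-1) ^ (j - 1) * fact (N - j) * fact (N + j) / (2 * fact N ^ 2)"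
    using assms(2)
  proof (induction N rule: dec_induct)
    case base
    obtain K where j: "j = Suc K" using assms by (cases j) auto
    have 0: "of_nat j * square_diff_prod j K = fact (2 * K + 1)"
      using square_diff_prod_fact[of K j] by (simp add: j mult_2[symmetric] del: of_nat_Suc fact_Suc)
    have 1: "{1..j} - {j} = {1..K}" using j by auto
    have "poly (lagrange_basis j j) (of_nat j ^ 2) = (\<Prod>i = 1..K. (-1) * ((of_nat j ^ 2 - of_nat i ^ 2) / of_nat i ^ 2))"
      unfolding lagrange_basis_def 1 poly_prod by (intro prod.cong refl) (auto simp: field_simps)
    also have "\<dots> = (-1) ^ K * (square_diff_prod j K / fact K ^ 2)"
      unfolding square_diff_prod_def prod.distrib prod_dividef fact_prod of_nat_prod
      by (simp add: prod_power_distrib)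
    also have "\<dots> = (-1) ^ (j - 1) * fact (j - j) * fact (j + j) / (2 * fact j ^ 2)"
    proof -
      have "fact (j + j) = (2 * of_nat j * (of_nat j * square_diff_prod j K) :: rat)"
        unfolding 0 by (simp add: j mult_2[symmetric])
      moreover have "fact j = (of_nat j * fact K :: rat)" by (simp add: j)
      moreover have "(of_nat j :: rat) \<noteq> 0" by (simp add: j)
      ultimately show ?thesis by (simp add: j power2_eq_square del: fact_Suc of_nat_Suc)
    qed
    finally show ?case .
  next
    case (step N)
    define d where "d = N - j"
    have N: "N = j + d" "N - j = d" "Suc N - j = Suc d" using step by (auto simp: d_def)
    have 1: "{1..Suc N} - {j} = insert (Suc N) ({1..N} - {j})" using step assms by auto
    have "poly (lagrange_basis (Suc N) j) (of_nat j ^ 2)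
        = poly (lagrange_basis N j) (of_nat j ^ 2) * (1 - of_nat j ^ 2 / of_nat (Suc N) ^ 2)"
      unfolding lagrange_basis_def 1 by (subst prod.insert) (auto simp: algebra_simps)
    also have "1 - of_nat j ^ 2 / of_nat (Suc N) ^ 2 = of_nat (Suc d) * of_nat (Suc (N + j)) / (of_nat (Suc N) ^ 2 :: rat)"
    proof -
      have "(of_nat (Suc N) :: rat) ^ 2 - of_nat j ^ 2 = of_nat (Suc d) * of_nat (Suc (N + j))"
        by (simp add: N power2_eq_square algebra_simps)
      then show ?thesis by (simp add: diff_divide_eq_iff del: of_nat_Suc)
    qed
    finally show ?case
      unfolding step.IH N(2,3)
      by (simp add: fact_Suc power_mult_distrib mult_ac del: of_nat_Suc)
  qed
  then show ?thesis by (simp add: lagrange_coeff_def power2_eq_square)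
qed

lemma lagrange_interpolation:
  assumes "degree Q < N"
  shows "coeff Q m = (\<Sum>j = 1..N. lagrange_coeff N j * poly Q (of_nat j ^ 2) * of_nat j ^ 2 * quotient_coeff j (sqpoly (Suc N)) m)"
proof -
  let ?R = "\<Sum>j = 1..N. smult (lagrange_coeff N j * poly Q (of_nat j ^ 2)) (lagrange_basis N j)"
  have inj: "inj_on (\<lambda>j. of_nat j ^ 2 :: rat) {1..N}"
    by (auto simp: inj_on_def power2_eq_iff)
  have card: "card ((\<lambda>j. of_nat j ^ 2 :: rat) ` {1..N}) = N"
    using card_image[OF inj] by simp
  have "degree ?R < N"
  proof (rule degree_sum_less)
    fix j assume "j \<in> {1..N}"
    then have "card ({1..N} - {j}) < N" by auto
    then have "degree (lagrange_basis N j) < N"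
      using degree_prod_linear_le[of "{1..N} - {j}"] unfolding lagrange_basis_def by linarith
    then show "degree (smult (lagrange_coeff N j * poly Q (of_nat j ^ 2)) (lagrange_basis N j)) < N"
      using degree_smult_le le_less_trans by blast
  qed (use assms in auto)
  moreover have "poly Q x = poly ?R x" if x: "x \<in> (\<lambda>j. of_nat j ^ 2) ` {1..N}" for x
  proof -
    obtain n where n: "n \<in> {1..N}" "x = of_nat n ^ 2" using x by blast
    have 0: "poly (lagrange_basis N j) x = 0" if "j \<in> {1..N} - {n}" for j
      unfolding lagrange_basis_def poly_prod
      by (rule prod_zero) (use n that in \<open>auto intro!: bexI[of _ n]\<close>)
    have "poly ?R x = lagrange_coeff N n * poly Q x * poly (lagrange_basis N n) x"
    proof -
      have "poly ?R x = (\<Sum>j = 1..N. lagrange_coeff N j * poly Q (of_nat j ^ 2) * poly (lagrange_basis N j) x)"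
        by (simp add: poly_sum)
      also have "\<dots> = lagrange_coeff N n * poly Q x * poly (lagrange_basis N n) x
          + (\<Sum>j\<in>{1..N} - {n}. lagrange_coeff N j * poly Q (of_nat j ^ 2) * poly (lagrange_basis N j) x)"
        using n by (subst sum.remove[of _ n]) simp_all
      also have "(\<Sum>j\<in>{1..N} - {n}. lagrange_coeff N j * poly Q (of_nat j ^ 2) * poly (lagrange_basis N j) x) = 0"
        by (rule sum.neutral) (simp add: 0)
      finally show ?thesis by simp
    qed
    also have "\<dots> = poly Q x * (poly (lagrange_basis N n) x * lagrange_coeff N n)" by simp
    also have "\<dots> = poly Q x" using poly_lagrange_basis[of n N] n by simp
    finally show ?thesis by simp
  qed
  ultimately have "Q = ?R" using assms card by (intro poly_eqI_degree[where A = "(\<lambda>j. of_nat j ^ 2) ` {1..N}"]) auto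
  then have "coeff Q m = coeff ?R m" by simp
  also have "\<dots> = (\<Sum>j = 1..N. lagrange_coeff N j * poly Q (of_nat j ^ 2) * of_nat j ^ 2 * quotient_coeff j (sqpoly (Suc N)) m)"
    unfolding coeff_sum by (intro sum.cong refl) (simp add: coeff_lagrange_basis)
  finally show ?thesis .
qed

lemma degree_sum_sqpoly:
  assumes "N \<ge> 1"
  shows "degree (\<Sum>k = 1..N. smult (c k) (sqpoly k)) < N"
proof (rule degree_sum_less)
  fix k assume k: "k \<in> {1..N}"
  then have "card {1..<k} < N" by auto
  then have "degree (sqpoly k) < N"
    using degree_prod_linear_le[of "{1..<k}"] unfolding sqpoly_def by linarith
  then show "degree (smult (c k) (sqpoly k)) < N"
    using degree_smult_le le_less_trans by blast
qed (use assms in auto)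

lemma sum_hcoeff_over_k:
  assumes "N \<ge> 1"
  shows "(\<Sum>k = 1..N. hcoeff k m / of_nat k)
       = (\<Sum>j = 1..N. lagrange_coeff N j * (-1) ^ (j - 1) * of_nat j * quotient_coeff j (sqpoly (Suc N)) m)"
proof -
  define Q where "Q = (\<Sum>k = 1..N. smult (1 / of_nat k) (sqpoly k))"
  have "(\<Sum>k = 1..N. hcoeff k m / of_nat k) = coeff Q m"
    by (simp add: Q_def coeff_sum hcoeff_def)
  also have "\<dots> = (\<Sum>j = 1..N. lagrange_coeff N j * poly Q (of_nat j ^ 2) * of_nat j ^ 2 * quotient_coeff j (sqpoly (Suc N)) m)"
    unfolding Q_def by (intro lagrange_interpolation degree_sum_sqpoly assms)
  also have "\<dots> = (\<Sum>j = 1..N. lagrange_coeff N j * (-1) ^ (j - 1) * of_nat j * quotient_coeff j (sqpoly (Suc N)) m)"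
  proof (intro sum.cong refl)
    fix j assume j: "j \<in> {1..N}"
    have "poly Q (of_nat j ^ 2) = (-1) ^ (j - 1) / of_nat j"
      using sum_sqpoly_over_k[of j N] j by (simp add: Q_def poly_sum)
    then show "lagrange_coeff N j * poly Q (of_nat j ^ 2) * of_nat j ^ 2 * quotient_coeff j (sqpoly (Suc N)) m
       = lagrange_coeff N j * (-1) ^ (j - 1) * of_nat j * quotient_coeff j (sqpoly (Suc N)) m"
      using j by (simp add: power2_eq_square)
  qed
  finally show ?thesis .
qed

lemma sum_hcoeff_over_k3:
  assumes "N \<ge> 1"
  shows "(\<Sum>k = 1..N. hcoeff k m / of_nat k ^ 3)
       = (\<Sum>j = 1..N. lagrange_coeff N j * harm2 1 j * quotient_coeff j (sqpoly (Suc N)) m)"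
proof -
  define Q where "Q = (\<Sum>k = 1..N. smult (1 / of_nat k ^ 3) (sqpoly k))"
  have "(\<Sum>k = 1..N. hcoeff k m / of_nat k ^ 3) = coeff Q m"
    by (simp add: Q_def coeff_sum hcoeff_def)
  also have "\<dots> = (\<Sum>j = 1..N. lagrange_coeff N j * poly Q (of_nat j ^ 2) * of_nat j ^ 2 * quotient_coeff j (sqpoly (Suc N)) m)"
    unfolding Q_def by (intro lagrange_interpolation degree_sum_sqpoly assms)
  also have "\<dots> = (\<Sum>j = 1..N. lagrange_coeff N j * harm2 1 j * quotient_coeff j (sqpoly (Suc N)) m)"
  proof (intro sum.cong refl)
    fix j assume j: "j \<in> {1..N}"
    have "poly Q (of_nat j ^ 2) = harm2 1 j / of_nat j ^ 2"
      using sum_sqpoly_over_k3[of j N] j by (simp add: Q_def poly_sum)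
    then show "lagrange_coeff N j * poly Q (of_nat j ^ 2) * of_nat j ^ 2 * quotient_coeff j (sqpoly (Suc N)) m
       = lagrange_coeff N j * harm2 1 j * quotient_coeff j (sqpoly (Suc N)) m"
      using j by simp
  qed
  finally show ?thesis .
qed

text \<open>For the exponent 2 no interpolation is needed: P_k t/k^2 = P_k - P_{k+1}.\<close>

lemma sum_hcoeff_over_k2:
  "(\<Sum>k = 1..N. hcoeff k m / of_nat k ^ 2) = - coeff (sqpoly (Suc N)) (Suc m)"
proof (induction N)
  case (Suc N)
  then show ?case by (simp add: sqpoly_Suc coeff_mult_linear hcoeff_def del: mult_pCons_right)
qed simp

text \<open>The form suited to N + 1 = p: the weight has exactly one factor p in its denominator, and the
  remaining product is 1 modulo p.\<close>

lemma lagrange_coeff_prod: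
  assumes "1 \<le> j" "j \<le> N"
  shows "of_nat (Suc N) * lagrange_coeff N j = 2 * (of_nat (Suc N) - of_nat j) *
    (\<Prod>i = 1..<j. (of_nat i - of_nat (Suc N)) / (of_nat i + of_nat (Suc N)))"
  using assms
proof (induction j rule: dec_induct)
  case base
  then obtain M where "N = Suc M" by (cases N) auto
  then have "fact N = (of_nat N * fact (N - 1) :: rat)" "(of_nat N :: rat) \<noteq> 0"
    by simp_all
  then show ?case
    unfolding lagrange_coeff_def by (simp add: power2_eq_square)
next
  case (step j)
  define d where "d = N - Suc j"
  have N: "N - j = Suc d" "N - Suc j = d" "N = Suc j + d" using step by (auto simp: d_def)
  have s: "(-1) ^ j = - ((-1) ^ (j - 1) :: rat)" using step by (cases j) auto
  have "lagrange_coeff N (Suc j) = - lagrange_coeff N j * (of_nat (Suc d) / of_nat (Suc (N + j)))"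
    unfolding lagrange_coeff_def N(1,2) by (simp add: s mult_ac del: of_nat_Suc)
  then have "of_nat (Suc N) * lagrange_coeff N (Suc j)
     = - (of_nat (Suc N) * lagrange_coeff N j) * (of_nat (Suc d) / of_nat (Suc (N + j)))"
    by simp
  also have "\<dots> = - (2 * (of_nat (Suc N) - of_nat j) *
    (\<Prod>i = 1..<j. (of_nat i - of_nat (Suc N)) / (of_nat i + of_nat (Suc N)))) * (of_nat (Suc d) / of_nat (Suc (N + j)))"
    using step by simp
  also have "\<dots> = 2 * of_nat (Suc d) *
    ((\<Prod>i = 1..<j. (of_nat i - of_nat (Suc N)) / (of_nat i + of_nat (Suc N))) *
      ((of_nat j - of_nat (Suc N)) / (of_nat j + of_nat (Suc N))))"
  proof -
    have "- (2 * (a - b) * c) * (d / e) = 2 * d * (c * ((b - a) / e))" for a b c d e :: rat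
      by (simp add: algebra_simps diff_divide_distrib)
    moreover have "of_nat (Suc (N + j)) = (of_nat j + of_nat (Suc N) :: rat)" by simp
    ultimately show ?thesis by (simp only:)
  qed
  also have "of_nat (Suc d) = (of_nat (Suc N) - of_nat (Suc j) :: rat)" by (simp add: N(3))
  finally show ?case
    using step by (simp add: prod.atLeastLessThan_Suc del: of_nat_Suc)
qed

section \<open>Power sums and Bernoulli numbers\<close>

text \<open>The geometric sum of the e^{ix} is (e^{nx} - 1)/(e^x - 1), and 1/(e^x - 1) is the generating
  function of the Bernoulli numbers divided by x.\<close>

lemma bernoulli_power_sum:
  "(\<Sum>i<n. of_nat i ^ e) = fact e *
     (\<Sum>r\<le>e. fps_nth bernoulli_egf r * of_nat n ^ (e + 1 - r) / fact (e + 1 - r))"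
proof -
  have geo: "(\<Sum>i<n. fps_exp (of_nat i)) * (fps_exp 1 - 1) = fps_exp (of_nat n) - (1 :: rat fps)"
  proof (induction n)
    case (Suc n)
    have "fps_exp (of_nat (Suc n)) = fps_exp (of_nat n) * (fps_exp 1 :: rat fps)"
      by (simp add: fps_exp_add_mult[symmetric] add.commute)
    then show ?case using Suc by (simp add: algebra_simps)
  qed simp
  have "fps_X * (\<Sum>i<n. fps_exp (of_nat i)) = bernoulli_egf * (fps_exp (of_nat n) - 1)"
    unfolding geo[symmetric] bernoulli_egf_mult[symmetric] by (simp only: mult_ac)
  from arg_cong[OF this, of "\<lambda>F. fps_nth F (Suc e)"]
  have "(\<Sum>i<n. of_nat i ^ e / fact e) = (\<Sum>r\<le>Suc e. fps_nth bernoulli_egf r * fps_nth (fps_exp (of_nat n) - 1) (Suc e - r))"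
    by (simp only: fps_mult_nth[of bernoulli_egf] atLeast0AtMost) (simp add: fps_sum_nth)
  also have "\<dots> = (\<Sum>r\<le>e. fps_nth bernoulli_egf r * of_nat n ^ (e + 1 - r) / fact (e + 1 - r))"
    by (simp add: Suc_diff_le)
  finally show ?thesis by (simp add: sum_divide_distrib[symmetric] field_simps)
qed

text \<open>For odd n the alternating geometric sum is (1 + e^{nx})/(1 + e^x), and
  1/(e^x + 1) = 1/(e^x - 1) - 2/(e^{2x} - 1) again involves only Bernoulli numbers.\<close>

lemma bernoulli_alternating_sum:
  assumes "odd n"
  shows "(\<Sum>i<n. (-1) ^ i * of_nat i ^ e) = fact e *
     ((\<Sum>r\<le>e. fps_nth bernoulli_egf r * (1 - 2 ^ r) * of_nat n ^ (e + 1 - r) / fact (e + 1 - r))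
      + 2 * fps_nth bernoulli_egf (Suc e) * (1 - 2 ^ Suc e))"
proof -
  let ?B = "bernoulli_egf" and ?E = "fps_exp (1 :: rat)"
  \<comment> \<open>B2 is the Bernoulli series at 2x; the difference of the two series is x/(1 + e^x).\<close>
  define B2 where "B2 = fps_compose ?B (fps_const 2 * fps_X)"
  have geo: "(\<Sum>i<n. fps_const ((-1) ^ i) * fps_exp (of_nat i)) * (1 + ?E)
      = 1 - fps_const ((-1) ^ n) * fps_exp (of_nat n)" for n
  proof (induction n)
    case (Suc n)
    have "fps_exp (of_nat (Suc n)) = fps_exp (of_nat n) * ?E"
      by (simp add: fps_exp_add_mult[symmetric] add.commute)
    then show ?case using Suc by (simp add: algebra_simps fps_const_neg[symmetric] del: fps_const_neg)
  qed simp
  have "?E ^ 2 = fps_exp 2" by (simp add: fps_exp_add_mult[symmetric] power2_eq_square)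
  moreover have "fps_compose ?E (fps_const 2 * fps_X) = fps_exp 2"
    by (simp add: fps_eq_iff)
  ultimately have B2: "B2 * (?E ^ 2 - 1) = fps_const 2 * fps_X"
    using arg_cong[OF bernoulli_egf_mult, of "\<lambda>F. fps_compose F (fps_const 2 * fps_X)"]
    by (simp add: B2_def fps_compose_mult_distrib fps_compose_sub_distrib)
  have "((?B - B2) * (1 + ?E) - fps_X) * (?E - 1)
      = (?B * (?E - 1)) * (1 + ?E) - B2 * (?E ^ 2 - 1) - fps_X * (?E - 1)"
    by (simp add: algebra_simps power2_eq_square)
  also have "\<dots> = 0"
    unfolding bernoulli_egf_mult B2 by (simp add: algebra_simps fps_const_add[symmetric] numeral_fps_const[symmetric])
  finally have B: "(?B - B2) * (1 + ?E) = fps_X"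
    using bernoulli_egf_mult by auto
  have "fps_X * (\<Sum>i<n. fps_const ((-1) ^ i) * fps_exp (of_nat i))
      = (?B - B2) * ((\<Sum>i<n. fps_const ((-1) ^ i) * fps_exp (of_nat i)) * (1 + ?E))"
    unfolding B[symmetric] by (simp only: mult_ac)
  also have "\<dots> = (?B - B2) * (1 + fps_exp (of_nat n))"
    unfolding geo using assms by (simp add: fps_const_neg[symmetric] del: fps_const_neg)
  finally have eq: "fps_X * (\<Sum>i<n. fps_const ((-1) ^ i) * fps_exp (of_nat i)) = (?B - B2) * (1 + fps_exp (of_nat n))" .
  have nth: "fps_nth (?B - B2) r = fps_nth ?B r * (1 - 2 ^ r)" for r
    unfolding B2_def fps_sub_nth fps_nth_compose_linear by (simp add: right_diff_distrib)
  have "(\<Sum>i<n. (-1) ^ i * (of_nat i ^ e / fact e))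
      = (\<Sum>r\<le>Suc e. fps_nth (?B - B2) r * fps_nth (1 + fps_exp (of_nat n)) (Suc e - r))"
    using arg_cong[OF eq, of "\<lambda>F. fps_nth F (Suc e)"]
    by (simp only: fps_mult_nth[of "?B - B2"] atLeast0AtMost) (simp add: fps_sum_nth del: fps_sub_nth)
  also have "\<dots> = (\<Sum>r\<le>e. fps_nth bernoulli_egf r * (1 - 2 ^ r) * of_nat n ^ (e + 1 - r) / fact (e + 1 - r))
      + 2 * fps_nth bernoulli_egf (Suc e) * (1 - 2 ^ Suc e)"
    unfolding nth by (simp add: Suc_diff_le)
  finally show ?thesis by (simp add: sum_divide_distrib[symmetric] field_simps)
qed

section \<open>Elementary symmetric functions of integers and of their reciprocals\<close>

text \<open>The coefficients are the elementary symmetric functions of 1, ..., n (as a power series, because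
  the logarithmic derivative is used) and those of their reciprocals.\<close>

definition elem_prod :: "nat \<Rightarrow> rat fps" where
  "elem_prod n = (\<Prod>j = 1..n. 1 + fps_const (of_nat j) * fps_X)"

definition inv_elem_prod :: "nat \<Rightarrow> rat poly" where
  "inv_elem_prod n = (\<Prod>j = 1..n. [:1, 1 / of_nat j:])"

lemma elem_prod_0 [simp]: "elem_prod 0 = 1" and elem_prod_Suc: "elem_prod (Suc n) = elem_prod n * (1 + fps_const (of_nat (Suc n)) * fps_X)"
  by (simp_all add: elem_prod_def)

lemma inv_elem_prod_0 [simp]: "inv_elem_prod 0 = 1" and inv_elem_prod_Suc: "inv_elem_prod (Suc n) = inv_elem_prod n * [:1, 1 / of_nat (Suc n):]"
  by (simp_all add: inv_elem_prod_def)

lemma fps_nth_mult_linear: "fps_nth (F * (1 + fps_const c * fps_X)) 0 = fps_nth F 0"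
  "fps_nth (F * (1 + fps_const c * fps_X)) (Suc m) = fps_nth F (Suc m) + c * fps_nth F m"
  for c :: "'a :: comm_ring_1"
proof -
  have "F * (1 + fps_const c * fps_X) = F + fps_const c * (fps_X * F)"
    by (simp add: algebra_simps)
  then show "fps_nth (F * (1 + fps_const c * fps_X)) 0 = fps_nth F 0"
    "fps_nth (F * (1 + fps_const c * fps_X)) (Suc m) = fps_nth F (Suc m) + c * fps_nth F m"
    by simp_all
qed

lemma elem_prod_nth_0 [simp]: "fps_nth (elem_prod n) 0 = 1"
  by (induction n) (simp_all only: elem_prod_0 elem_prod_Suc fps_nth_mult_linear fps_one_nth, simp_all)

lemma inv_elem_prod_nth_0 [simp]: "coeff (inv_elem_prod n) 0 = 1"
  by (induction n) (simp_all only: inv_elem_prod_0 inv_elem_prod_Suc coeff_mult_linear, simp_all)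

lemma elem_prod_nth_gt: "i > n \<Longrightarrow> fps_nth (elem_prod n) i = 0"
proof (induction n arbitrary: i)
  case (Suc n)
  then show ?case by (cases i) (simp_all add: elem_prod_Suc fps_nth_mult_linear del: of_nat_Suc)
qed auto

lemma inv_elem_prod_nth_gt: "i > n \<Longrightarrow> coeff (inv_elem_prod n) i = 0"
proof (induction n arbitrary: i)
  case (Suc n)
  then show ?case by (cases i) (simp_all add: inv_elem_prod_Suc coeff_mult_linear del: of_nat_Suc mult_pCons_right)
qed auto

text \<open>An elementary symmetric function of reciprocals, times the product of all numbers, is the
  complementary elementary symmetric function of the numbers.\<close>

lemma elem_prod_reversal:
  "i + s = n \<Longrightarrow> fact n * coeff (inv_elem_prod n) s = fps_nth (elem_prod n) i"
proof (induction n arbitrary: i s)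
  case (Suc n)
  have 1: "fact n * coeff (inv_elem_prod n) s = (case i of 0 \<Rightarrow> 0 | Suc i' \<Rightarrow> fps_nth (elem_prod n) i')"
    using Suc.prems Suc.IH[of "i - 1" s] by (auto split: nat.splits simp: inv_elem_prod_nth_gt)
  have 2: "fact n * (case s of 0 \<Rightarrow> 0 | Suc s' \<Rightarrow> coeff (inv_elem_prod n) s') = fps_nth (elem_prod n) i"
    using Suc.prems Suc.IH[of i "s - 1"] by (auto split: nat.splits simp: elem_prod_nth_gt)
  have a: "fps_nth (elem_prod (Suc n)) i = fps_nth (elem_prod n) i
      + of_nat (Suc n) * (case i of 0 \<Rightarrow> 0 | Suc i' \<Rightarrow> fps_nth (elem_prod n) i')"
    unfolding elem_prod_Suc by (cases i) (simp_all only: fps_nth_mult_linear nat.case mult_zero_right add_0_right)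
  have b: "coeff (inv_elem_prod (Suc n)) s = coeff (inv_elem_prod n) s
      + 1 / of_nat (Suc n) * (case s of 0 \<Rightarrow> 0 | Suc s' \<Rightarrow> coeff (inv_elem_prod n) s')"
    unfolding inv_elem_prod_Suc by (cases s) (simp_all only: coeff_mult_linear nat.case mult_zero_right add_0_right mult_1_left)
  have "(of_nat (Suc n) :: rat) \<noteq> 0" by simp
  then have "fact (Suc n) * coeff (inv_elem_prod (Suc n)) s
      = of_nat (Suc n) * (fact n * coeff (inv_elem_prod n) s)
        + fact n * (case s of 0 \<Rightarrow> 0 | Suc s' \<Rightarrow> coeff (inv_elem_prod n) s')"
    unfolding b fact_Suc by (simp add: distrib_left del: of_nat_Suc)
  then show ?case unfolding 1 2 a by simp
qed simp

lemma elem_prod_deriv: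
  "fps_deriv (elem_prod n) = elem_prod n * (\<Sum>j = 1..n. Abs_fps (\<lambda>i. of_nat j * (- of_nat j) ^ i))"
proof (induction n)
  case (Suc n)
  define x :: rat where "x = of_nat (Suc n)"
  define G where "G = Abs_fps (\<lambda>i. x * (- x) ^ i)"
  have G: "G * (1 + fps_const x * fps_X) = fps_const x"
  proof (rule fps_ext)
    fix i show "fps_nth (G * (1 + fps_const x * fps_X)) i = fps_nth (fps_const x) i"
      by (cases i) (simp_all only: fps_nth_mult_linear, simp_all add: G_def)
  qed
  let ?S = "\<Sum>j = 1..n. Abs_fps (\<lambda>i. of_nat j * (- of_nat j) ^ i) :: rat fps"
  have "fps_deriv (elem_prod (Suc n)) = fps_deriv (elem_prod n) * (1 + fps_const x * fps_X) + elem_prod n * fps_const x"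
    unfolding elem_prod_Suc x_def[symmetric] by (simp add: algebra_simps)
  also have "\<dots> = elem_prod n * ?S * (1 + fps_const x * fps_X) + elem_prod n * (G * (1 + fps_const x * fps_X))"
    unfolding Suc.IH G ..
  also have "\<dots> = elem_prod (Suc n) * (?S + G)"
    unfolding elem_prod_Suc x_def[symmetric] by (simp add: algebra_simps)
  also have "?S + G = (\<Sum>j = 1..Suc n. Abs_fps (\<lambda>i. of_nat j * (- of_nat j) ^ i))"
    by (simp add: G_def x_def)
  finally show ?case .
qed simp

text \<open>Newton's identities, read off from the logarithmic derivative.\<close>

lemma elem_prod_newton:
  "of_nat (Suc i) * fps_nth (elem_prod n) (Suc i)
     = (\<Sum>r\<le>i. fps_nth (elem_prod n) r * ((-1) ^ (i - r) * (\<Sum>j = 1..n. of_nat j ^ Suc (i - r))))"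
proof -
  have "of_nat (Suc i) * fps_nth (elem_prod n) (Suc i) = fps_nth (fps_deriv (elem_prod n)) i"
    by simp
  also have "\<dots> = (\<Sum>r\<le>i. fps_nth (elem_prod n) r * (\<Sum>j = 1..n. of_nat j * (- of_nat j) ^ (i - r)))"
    unfolding elem_prod_deriv by (simp add: fps_mult_nth fps_sum_nth atLeast0AtMost)
  moreover have "(\<Sum>j = 1..n. of_nat j * (- of_nat j) ^ k) = (-1) ^ k * (\<Sum>j = 1..n. of_nat j ^ Suc k :: rat)" for k
    unfolding sum_distrib_left
    by (intro sum.cong refl) (simp add: power_minus[of "of_nat _"] mult_ac)
  ultimately show ?thesis by simp
qed

text \<open>P_{n+1}(x^2) = prod (1 + x/j) prod (1 - x/j).\<close>

lemma coeff_sqpoly_inv_elem_prod: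
  "coeff (sqpoly (Suc n)) i = (\<Sum>r\<le>2 * i. coeff (inv_elem_prod n) r * ((-1) ^ (2 * i - r) * coeff (inv_elem_prod n) (2 * i - r)))"
proof -
  define M where "M n = (\<Prod>j = 1..n. [:1, - (1 / of_nat j):] :: rat poly)" for n
  have M: "coeff (M n) s = (-1) ^ s * coeff (inv_elem_prod n) s" for s
  proof (induction n arbitrary: s)
    case 0
    show ?case by (cases s) (simp_all add: M_def)
  next
    case (Suc n)
    have "M (Suc n) = M n * [:1, - (1 / of_nat (Suc n)):]" by (simp add: M_def)
    then show ?case unfolding inv_elem_prod_Suc
      by (cases s) (simp_all only: coeff_mult_linear Suc, simp_all add: algebra_simps del: of_nat_Suc)
  qed
  have D: "coeff (inv_elem_prod n * M n) (2 * i) = coeff (sqpoly (Suc n)) i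
     \<and> coeff (inv_elem_prod n * M n) (Suc (2 * i)) = 0" for i
  proof (induction n arbitrary: i)
    case 0
    show ?case by (simp add: M_def)
  next
    case (Suc n)
    define x :: rat where "x = 1 / of_nat (Suc n)"
    let ?P = "inv_elem_prod n * M n"
    have "inv_elem_prod (Suc n) * M (Suc n) = ?P * ([:1, x:] * [:1, - x:])"
      by (simp add: inv_elem_prod_Suc M_def x_def mult_ac del: mult_pCons_right mult_pCons_left of_nat_Suc)
    also have "[:1, x:] * [:1, - x:] = [:1, 0, - (x ^ 2):]"
      by (simp add: power2_eq_square)
    also have "?P * [:1, 0, - (x ^ 2):] = ?P + smult (- (x ^ 2)) (pCons 0 (pCons 0 ?P))"
      by (simp add: mult.commute[of _ "pCons _ _"])
    finally have eq: "inv_elem_prod (Suc n) * M (Suc n) = ?P + smult (- (x ^ 2)) (pCons 0 (pCons 0 ?P))" .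
    have x2: "1 / of_nat (Suc n) ^ 2 = x ^ 2" by (simp add: x_def power_divide)
    show ?case
    proof (cases i)
      case 0
      then show ?thesis
        unfolding eq sqpoly_Suc[of "Suc n", simplified] using Suc[of 0]
        by (simp add: coeff_mult_linear del: mult_pCons_right)
    next
      case (Suc i')
      have "coeff (sqpoly (Suc (Suc n))) (Suc i') = coeff (sqpoly (Suc n)) (Suc i') - x ^ 2 * coeff (sqpoly (Suc n)) i'"
        using sqpoly_Suc[of "Suc n"] by (simp only: coeff_mult_linear x2)
      then show ?thesis
        unfolding eq Suc using Suc.IH[of "Suc i'"] Suc.IH[of i'] by simp
    qed
  qed
  show ?thesis using D[of i] by (simp add: coeff_mult M)
qed

section \<open>Power sums and double harmonic sums modulo p\<close>

context odd_prime
begin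

lemma congp_of_int: "int p dvd a - b \<Longrightarrow> congp 1 (of_int a) (of_int b)"
proof -
  assume "int p dvd a - b"
  then obtain c where "a - b = int p * c" by (rule dvdE)
  then have "(of_int a - of_int b :: rat) = of_nat p * of_int c"
    by (metis of_int_diff of_int_mult of_int_of_nat_eq)
  then show ?thesis by (simp add: congp_def)
qed

lemma congp_fermat: assumes "0 < j" "j < p" shows "congp 1 (of_nat j ^ (p - 1)) 1"
proof -
  have "\<not> p dvd j" using assms nat_dvd_not_less by auto
  then have "[j ^ (p - 1) = 1] (mod p)" using fermat_theorem prime_p by blast
  then have "int p dvd int (j ^ (p - 1)) - int 1" by (metis cong_iff_dvd_diff cong_int_iff)
  from congp_of_int[OF this] show ?thesis by simp
qed

lemma congp_wilson: "congp 1 (fact (p - 1)) (- 1)"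
proof -
  have "[fact (p - 1) = - 1 :: int] (mod int p)" using wilson_theorem prime_p by auto
  then have "int p dvd fact (p - 1) - (- 1)" by (simp only: cong_iff_dvd_diff)
  from congp_of_int[OF this] show ?thesis by simp
qed

lemma congp_of_nat_p: "congp 1 (of_nat p) 0"
  using congp_p_mult_zero[of 1] by simp

lemma congp_cancel_2: "congp k (2 * x) (2 * y) \<Longrightarrow> congp k x y"
  using congp_cancel[of 2 k x y] unit_of_nat[of 2] p_gt_2 by simp

text \<open>Pairing the summands at j and p - j; this is how a factor p is gained from near-antisymmetry.\<close>

lemma congp_reflect:
  assumes "\<And>j. 1 \<le> j \<Longrightarrow> j \<le> p - 1 \<Longrightarrow> congp k (f j + f (p - j)) (g j)"
  shows "congp k (2 * (\<Sum>j = 1..p-1. f j)) (\<Sum>j = 1..p-1. g j)"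
proof -
  have "(\<Sum>j = 1..p-1. f j) = (\<Sum>j = 1..p-1. f (p - j))"
    by (rule sum.reindex_bij_witness[of _ "\<lambda>j. p - j" "\<lambda>j. p - j"]) auto
  then have "2 * (\<Sum>j = 1..p-1. f j) = (\<Sum>j = 1..p-1. f j + f (p - j))"
    by (simp add: sum.distrib)
  also have "congp k \<dots> (\<Sum>j = 1..p-1. g j)"
    using assms by (intro congp_sum) auto
  finally show ?thesis .
qed

lemma congp_reflect_0:
  assumes "\<And>j. 1 \<le> j \<Longrightarrow> j \<le> p - 1 \<Longrightarrow> congp k (f j + f (p - j)) 0"
  shows "congp k (\<Sum>j = 1..p-1. f j) 0"
  using congp_reflect[of k f "\<lambda>_. 0"] assms congp_cancel_2[of k _ 0] by simp

text \<open>From the recursion (the Bernoulli series times (e^x - 1)/x is 1), whose denominators up to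
  (r + 1)! are prime to p in this range.\<close>

lemma bernoulli_Zp: "r + 2 \<le> p \<Longrightarrow> fps_nth bernoulli_egf r \<in> Zp"
proof (induction r rule: less_induct)
  case (less r)
  have "fps_nth (bernoulli_egf * (fps_exp 1 - 1)) (Suc r) = of_bool (r = 0)"
    unfolding bernoulli_egf_mult by simp
  then have "(\<Sum>i\<le>Suc r. fps_nth bernoulli_egf i * fps_nth (fps_exp 1 - 1) (Suc r - i)) = (of_bool (r = 0) :: rat)"
    by (simp only: fps_mult_nth atLeast0AtMost)
  then have "(\<Sum>i<r. fps_nth bernoulli_egf i / fact (Suc r - i)) + fps_nth bernoulli_egf r = of_bool (r = 0)"
    by (simp add: lessThan_Suc_atMost[symmetric] Suc_diff_le)
  then have "fps_nth bernoulli_egf r = of_bool (r = 0) - (\<Sum>i<r. fps_nth bernoulli_egf i / fact (Suc r - i))"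
    by linarith
  moreover have "(\<Sum>i<r. fps_nth bernoulli_egf i / fact (Suc r - i)) \<in> Zp"
    using less by (intro Zp_sum Zp_divide unit_fact) auto
  ultimately show ?case by simp
qed

lemma bernoulli_number_Zp: "r + 2 \<le> p \<Longrightarrow> bernoulli r \<in> Zp"
  unfolding bernoulli_def using bernoulli_Zp by (intro Zp_mult) (auto simp: unit_Zp)

lemma sum_lessThan_from_1: "f 0 = 0 \<Longrightarrow> (\<Sum>i<n. f i) = (\<Sum>i = 1..<n. f i :: rat)" for n :: nat
  by (cases "n = 0") (simp_all add: lessThan_atLeast0 sum.atLeast_Suc_lessThan)

lemma sum_below_p_from_1: "f 0 = 0 \<Longrightarrow> (\<Sum>i<p. f i) = (\<Sum>i = 1..p-1. f i :: rat)"
  using p_pos by (subst sum_lessThan_from_1) (auto intro!: sum.cong)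

text \<open>In the formula of \<open>bernoulli_power_sum\<close> with n = p, only the term linear in p survives
  modulo p^2.\<close>

lemma congp_power_sum:
  assumes "1 \<le> e" "e + 2 \<le> p"
  shows "congp 2 (\<Sum>j = 1..p-1. of_nat j ^ e) (of_nat p * bernoulli e)"
proof -
  have "(\<Sum>j = 1..p-1. of_nat j ^ e) = (\<Sum>j<p. of_nat j ^ e :: rat)"
    using assms by (subst sum_below_p_from_1) auto
  also have "\<dots> = (\<Sum>r\<le>e. fact e * (fps_nth bernoulli_egf r * of_nat p ^ (e + 1 - r) / fact (e + 1 - r)))"
    unfolding bernoulli_power_sum sum_distrib_left ..
  also have "\<dots> = (\<Sum>r<e. fact e * (fps_nth bernoulli_egf r * of_nat p ^ (e + 1 - r) / fact (e + 1 - r)))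
      + of_nat p * bernoulli e"
    by (simp add: lessThan_Suc_atMost[symmetric] bernoulli_def)
  also have "congp 2 \<dots> (0 + of_nat p * bernoulli e)"
  proof (intro congp_add congp_refl congp_zero_sum)
    fix r assume r: "r \<in> {..<e}"
    have "e + 1 - r = Suc (Suc (e - 1 - r))" using r by auto
    then have eq: "fact e * (fps_nth bernoulli_egf r * of_nat p ^ (e + 1 - r) / fact (e + 1 - r))
       = of_nat p ^ 2 * (of_nat p ^ (e - 1 - r) * (fact e * fps_nth bernoulli_egf r) / fact (e + 1 - r))"
      by (simp add: power2_eq_square del: fact_Suc)
    have "of_nat p ^ (e - 1 - r) * (fact e * fps_nth bernoulli_egf r) / fact (e + 1 - r) \<in> Zp"
      using assms r by (intro Zp_divide Zp_mult unit_fact bernoulli_Zp) (auto simp: unit_Zp)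
    then show "congp 2 (fact e * (fps_nth bernoulli_egf r * of_nat p ^ (e + 1 - r) / fact (e + 1 - r))) 0"
      unfolding eq congp_def diff_0_right by (subst nonzero_mult_div_cancel_left) simp_all
  qed
  finally show ?thesis by simp
qed

lemma congp_power_sum_0:
  assumes "1 \<le> e" "e + 2 \<le> p"
  shows "congp 1 (\<Sum>j = 1..p-1. of_nat j ^ e) 0"
  using congp_trans[OF congp_weaken[OF congp_power_sum[OF assms]] congp_p_mult_zero] bernoulli_number_Zp assms by blast

lemma congp_inverse_power:
  assumes "0 < j" "j < p" "s + 1 \<le> p"
  shows "congp 1 (1 / of_nat j ^ s) (of_nat j ^ (p - 1 - s))"
proof (rule congp_cancel)
  show "unit (of_nat j ^ s)" using assms by simp
  have "(of_nat j :: rat) ^ s * of_nat j ^ (p - 1 - s) = of_nat j ^ (p - 1)"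
    using assms by (simp flip: power_add)
  then show "congp 1 (of_nat j ^ s * (1 / of_nat j ^ s)) (of_nat j ^ s * of_nat j ^ (p - 1 - s))"
    using congp_sym[OF congp_fermat] assms by simp
qed

text \<open>The exponent range ensures that q - t is a multiple of p - 1 only if it is zero.\<close>

lemma congp_power_quotient_sum:
  assumes "q + 2 \<le> p + t" "t + 2 \<le> p + q"
  shows "congp 1 (\<Sum>j = 1..p-1. of_nat j ^ q / of_nat j ^ t) (if q = t then - 1 else 0)"
proof (cases q t rule: linorder_cases)
  case equal
  have "(\<Sum>j = 1..p-1. of_nat j ^ q / of_nat j ^ t) = (\<Sum>j = 1..p-1. 1 :: rat)"
    using equal by (intro sum.cong) auto
  also have "\<dots> = of_nat p - 1" using p_pos by (simp add: of_nat_diff)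
  also have "congp 1 \<dots> (0 - 1)" by (intro congp_diff congp_of_nat_p congp_refl)
  finally show ?thesis using equal by simp
next
  case greater
  have "(\<Sum>j = 1..p-1. of_nat j ^ q / of_nat j ^ t) = (\<Sum>j = 1..p-1. of_nat j ^ (q - t) :: rat)"
    using greater by (intro sum.cong) (auto simp: power_diff)
  then show ?thesis using congp_power_sum_0[of "q - t"] greater assms by simp
next
  case less
  have "(\<Sum>j = 1..p-1. of_nat j ^ q / of_nat j ^ t) = (\<Sum>j = 1..p-1. 1 / of_nat j ^ (t - q) :: rat)"
    using less by (intro sum.cong) (auto simp: power_diff)
  also have "congp 1 \<dots> (\<Sum>j = 1..p-1. of_nat j ^ (p - 1 - (t - q)))"
    using less assms by (intro congp_sum congp_inverse_power) auto
  also have "congp 1 \<dots> 0"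
    using less assms by (intro congp_power_sum_0) auto
  finally show ?thesis using less by simp
qed

lemma congp_inverse_power_sum:
  assumes "1 \<le> t" "t + 2 \<le> p"
  shows "congp 1 (\<Sum>j = 1..p-1. 1 / of_nat j ^ t) 0"
  using congp_power_quotient_sum[of 0 t] assms by simp

text \<open>Each of the t - 1 factors p - i of the quotient of factorials is congruent to - i.\<close>

lemma congp_fact_ratio:
  assumes "1 \<le> t" "s + t + 1 \<le> p"
  shows "congp 1 (fact (p - 1 - s)) ((-1) ^ (t - 1) * fact (s + t - 1) / fact s * fact (p - s - t))"
  using assms
proof (induction t rule: dec_induct)
  case base
  then show ?case by (simp add: diff_diff_left add.commute)
next
  case (step t)
  define d where "d = p - s - Suc t"
  have d: "p - s - t = Suc d" "p - s - Suc t = d" using step by (auto simp: d_def)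
  let ?c = "(-1) ^ (t - 1) * fact (s + t - 1) / fact s :: rat"
  have c: "?c \<in> Zp"
    using step by (intro Zp_divide Zp_mult) (auto simp: unit_Zp)
  have "congp 1 (fact (p - 1 - s)) (?c * fact (Suc d))"
    using step d by simp
  also have "?c * fact (Suc d) = ?c * fact d * of_nat (Suc d)"
    by simp
  also have "of_nat (Suc d) = (of_nat p - of_nat (s + t) :: rat)"
    using step by (simp add: d(1)[symmetric] of_nat_diff)
  also have "congp 1 (?c * fact d * (of_nat p - of_nat (s + t))) (?c * fact d * (0 - of_nat (s + t)))"
    using c step by (intro congp_cmult congp_diff congp_of_nat_p congp_refl Zp_mult) (auto simp: d_def unit_Zp)
  also have "?c * fact d * (0 - of_nat (s + t)) = (-1) ^ (Suc t - 1) * fact (s + Suc t - 1) / fact s * fact (p - s - Suc t)"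
  proof -
    have "(fact (s + Suc t - 1) :: rat) = of_nat (s + t) * fact (s + t - 1)"
      using step(1) fact_reduce[of "s + t", where 'a = rat] by simp
    moreover have "(-1) ^ (Suc t - 1) = - ((-1) ^ (t - 1) :: rat)"
      using step(1) by (cases t) simp_all
    moreover have "x * f / g * y * (0 - z) = - x * (z * f) / g * y" for x f g y z :: rat
      by simp
    ultimately show ?thesis unfolding d(2) by (simp only:)
  qed
  finally show ?case .
qed

text \<open>By Fermat the inner sum is a power sum, hence a polynomial in j by \<open>bernoulli_power_sum\<close>; in
  the outer sum only the monomial j^t contributes, which singles out one Bernoulli number.\<close>

lemma congp_double_harmonic_sum:
  assumes "1 \<le> s" "1 \<le> t" "s + t + 1 \<le> p"
  shows "congp 1 (\<Sum>j = 1..p-1. (\<Sum>i = 1..<j. 1 / of_nat i ^ s) / of_nat j ^ t)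
           ((-1) ^ t * fact (s + t - 1) / (fact s * fact t) * bernoulli (p - s - t))"
proof -
  define e where "e = p - 1 - s"
  define c where "c r = fact e * fps_nth bernoulli_egf r / fact (e + 1 - r)" for r
  define r0 where "r0 = p - s - t"
  have e: "1 \<le> e" "e + 2 \<le> p" and r0: "r0 \<le> e" "e + 1 - r0 = t" using assms by (auto simp: e_def r0_def)
  have c: "c r \<in> Zp" if "r \<le> e" for r
    unfolding c_def using e that by (intro Zp_divide Zp_mult bernoulli_Zp unit_fact) (auto simp: unit_Zp)
  have "congp 1 (\<Sum>j = 1..p-1. (\<Sum>i = 1..<j. 1 / of_nat i ^ s) / of_nat j ^ t)
     (\<Sum>j = 1..p-1. (\<Sum>i = 1..<j. of_nat i ^ e) / of_nat j ^ t)"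
    using assms unfolding e_def
    by (intro congp_sum congp_divide congp_inverse_power) auto
  also have "(\<Sum>j = 1..p-1. (\<Sum>i = 1..<j. of_nat i ^ e) / of_nat j ^ t)
     = (\<Sum>j = 1..p-1. (\<Sum>r\<le>e. c r * (of_nat j ^ (e + 1 - r) / of_nat j ^ t)) :: rat)"
  proof (intro sum.cong refl)
    fix j
    have "(\<Sum>i = 1..<j. of_nat i ^ e) = (\<Sum>i<j. of_nat i ^ e :: rat)"
      using e by (subst sum_lessThan_from_1) auto
    then have eq: "(\<Sum>i = 1..<j. of_nat i ^ e) = (\<Sum>r\<le>e. c r * of_nat j ^ (e + 1 - r))"
      unfolding bernoulli_power_sum c_def sum_distrib_left by (simp add: mult_ac)
    show "(\<Sum>i = 1..<j. of_nat i ^ e) / of_nat j ^ t = (\<Sum>r\<le>e. c r * (of_nat j ^ (e + 1 - r) / of_nat j ^ t))"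
      unfolding eq sum_divide_distrib by simp
  qed
  also have "\<dots> = (\<Sum>r\<le>e. c r * (\<Sum>j = 1..p-1. of_nat j ^ (e + 1 - r) / of_nat j ^ t))"
    unfolding sum_distrib_left by (rule sum.swap)
  also have "congp 1 \<dots> (\<Sum>r\<le>e. c r * (if e + 1 - r = t then - 1 else 0))"
    using assms e c by (intro congp_sum congp_cmult congp_power_quotient_sum) auto
  also have "(\<Sum>r\<le>e. c r * (if e + 1 - r = t then - 1 else 0)) = (\<Sum>r\<le>e. if r = r0 then - c r0 else 0)"
    using r0 assms by (intro sum.cong) (auto simp: e_def r0_def)
  also have "\<dots> = - c r0" using r0 by simp
  also have "\<dots> = fact (p - 1 - s) * (- (bernoulli r0 / (fact r0 * fact t)))"
    unfolding c_def r0(2) bernoulli_def e_def[symmetric] by simp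
  also have "congp 1 \<dots> ((-1) ^ (t - 1) * fact (s + t - 1) / fact s * fact (p - s - t) * (- (bernoulli r0 / (fact r0 * fact t))))"
    using assms unfolding r0_def
    by (intro congp_mult congp_fact_ratio congp_refl Zp_minus Zp_divide bernoulli_number_Zp unit_mult unit_fact)
      (auto simp: unit_Zp)
  also have "(-1) ^ (t - 1) * fact (s + t - 1) / fact s * fact (p - s - t) * (- (bernoulli r0 / (fact r0 * fact t)))
      = (-1) ^ t * fact (s + t - 1) / (fact s * fact t) * bernoulli (p - s - t)"
    using assms(2) unfolding r0_def by (cases t) simp_all
  finally show ?thesis .
qed

lemma congp_alternating_power_sum:
  assumes "1 \<le> e" "e + 3 \<le> p"
  shows "congp 1 (\<Sum>j = 1..p-1. (-1) ^ j * of_nat j ^ e)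
     (2 * (1 - 2 ^ Suc e) * bernoulli (Suc e) / of_nat (Suc e))"
proof -
  let ?b = "fps_nth bernoulli_egf"
  have "(\<Sum>j = 1..p-1. (-1) ^ j * of_nat j ^ e) = (\<Sum>j<p. (-1) ^ j * of_nat j ^ e :: rat)"
    using assms by (subst sum_below_p_from_1) auto
  also have "\<dots> = (\<Sum>r\<le>e. fact e * (?b r * (1 - 2 ^ r) * of_nat p ^ (e + 1 - r) / fact (e + 1 - r)))
      + fact e * (2 * ?b (Suc e) * (1 - 2 ^ Suc e))"
    unfolding bernoulli_alternating_sum[OF odd_p] distrib_left sum_distrib_left ..
  also have "congp 1 \<dots> (0 + fact e * (2 * ?b (Suc e) * (1 - 2 ^ Suc e)))"
  proof (intro congp_add congp_refl congp_zero_sum)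
    fix r assume r: "r \<in> {..e}"
    have "e + 1 - r = Suc (e - r)" using r by auto
    then have eq: "fact e * (?b r * (1 - 2 ^ r) * of_nat p ^ (e + 1 - r) / fact (e + 1 - r))
       = of_nat p * (of_nat p ^ (e - r) * (fact e * (?b r * (1 - 2 ^ r))) / fact (e + 1 - r))"
      by (simp del: fact_Suc)
    have "of_nat p ^ (e - r) * (fact e * (?b r * (1 - 2 ^ r))) / fact (e + 1 - r) \<in> Zp"
      using assms r by (intro Zp_divide Zp_mult unit_fact bernoulli_Zp) (auto simp: unit_Zp)
    then show "congp 1 (fact e * (?b r * (1 - 2 ^ r) * of_nat p ^ (e + 1 - r) / fact (e + 1 - r))) 0"
      unfolding eq by (rule congp_p_mult_zero)
  qed
  also have "0 + fact e * (2 * ?b (Suc e) * (1 - 2 ^ Suc e)) = 2 * (1 - 2 ^ Suc e) * bernoulli (Suc e) / of_nat (Suc e)"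
    unfolding bernoulli_def by (simp add: field_simps del: of_nat_Suc)
  finally show ?thesis .
qed

text \<open>With 1/j^s = j^(p-1-s) this is \<open>congp_alternating_power_sum\<close>; then 2^(p-s) = 1/2^(s-1) and
  p - s = - s.  The excluded case s = 1 would involve the non-integral Bernoulli number of
  index p - 1.\<close>

lemma congp_alternating_inverse_power_sum:
  assumes "2 \<le> s" "s + 2 \<le> p"
  shows "congp 1 (\<Sum>j = 1..p-1. (-1) ^ j / of_nat j ^ s)
     (- 2 * (1 - 1 / 2 ^ (s - 1)) / of_nat s * bernoulli (p - s))"
proof -
  define e where "e = p - 1 - s"
  have e: "1 \<le> e" "e + 3 \<le> p" "Suc e = p - s" using assms by (auto simp: e_def)
  have sp: "unit (of_nat s)" using assms by (intro unit_of_nat) auto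
  have B: "bernoulli (p - s) \<in> Zp" using assms by (intro bernoulli_number_Zp) auto
  have u2: "unit 2" using unit_of_nat[of 2] p_gt_2 by simp
  have up: "unit (of_nat p - of_nat s)" using assms by (intro unit_minus_p) auto
  have "congp 1 (\<Sum>j = 1..p-1. (-1) ^ j * (1 / of_nat j ^ s)) (\<Sum>j = 1..p-1. (-1) ^ j * of_nat j ^ e)"
    using assms unfolding e_def by (intro congp_sum congp_cmult congp_inverse_power) auto
  also have "congp 1 \<dots> (2 * (1 - 2 ^ Suc e) * bernoulli (Suc e) / of_nat (Suc e))"
    using e by (intro congp_alternating_power_sum) auto
  also have "2 * (1 - 2 ^ Suc e) * bernoulli (Suc e) / of_nat (Suc e) = 2 * bernoulli (p - s) * ((1 - 2 ^ (p - s)) / (of_nat p - of_nat s))"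
    using e assms by (simp add: of_nat_diff)
  also have "congp 1 \<dots> (2 * bernoulli (p - s) * ((1 - 1 / 2 ^ (s - 1)) / (- of_nat s)))"
  proof (intro congp_cmult)
    show "2 * bernoulli (p - s) \<in> Zp" using B by simp
    have 2: "congp 1 (2 ^ (p - s)) (1 / 2 ^ (s - 1))"
    proof -
      have "p - 1 - (s - 1) = p - s" using assms by simp
      then show ?thesis using congp_sym[OF congp_inverse_power[of 2 "s - 1"]] p_gt_2 assms by simp
    qed
    \<comment> \<open>The fractions are compared after multiplication by both denominators.\<close>
    have "congp 1 ((of_nat p - of_nat s) * (- of_nat s) * ((1 - 2 ^ (p - s)) / (of_nat p - of_nat s)))
        ((of_nat p - of_nat s) * (- of_nat s) * ((1 - 1 / 2 ^ (s - 1)) / (- of_nat s)))"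
    proof -
      have "congp 1 (- of_nat s * (1 - 2 ^ (p - s))) ((of_nat p - of_nat s) * (1 - 1 / 2 ^ (s - 1)))"
        using u2 congp_diff[OF congp_sym[OF congp_of_nat_p] congp_refl[of 1 "of_nat s"]]
        by (intro congp_mult congp_diff congp_refl 2) (auto intro!: Zp_minus Zp_diff Zp_divide)
      then show ?thesis using unit_nonzero[OF sp] unit_nonzero[OF up] by simp
    qed
    then show "congp 1 ((1 - 2 ^ (p - s)) / (of_nat p - of_nat s)) ((1 - 1 / 2 ^ (s - 1)) / (- of_nat s))"
      by (rule congp_cancel[rotated]) (intro unit_mult unit_minus sp up)
  qed
  also have "2 * bernoulli (p - s) * ((1 - 1 / 2 ^ (s - 1)) / (- of_nat s))
      = - 2 * (1 - 1 / 2 ^ (s - 1)) / of_nat s * bernoulli (p - s)"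
  proof -
    have "2 * b * (x / (- y)) = - 2 * x / y * b" for b x y :: rat by simp
    then show ?thesis .
  qed
  finally show ?thesis by (simp only: times_divide_eq_right mult_1_right)
qed

section \<open>Elementary symmetric functions modulo p^2\<close>

lemma elem_prod_Zp: "fps_nth (elem_prod n) i \<in> Zp"
proof (induction n arbitrary: i)
  case (Suc n)
  then show ?case
    by (cases i) (simp_all only: elem_prod_Suc fps_nth_mult_linear Zp_add Zp_mult Zp_of_nat)
qed (simp add: fps_one_nth)

text \<open>In Newton's identities all power sums are divisible by p, so all elementary symmetric functions
  are, too; hence modulo p^2 only the term with the full power sum is left.\<close>

lemma elem_prod_congp:
  assumes "1 \<le> i" "i + 2 \<le> p"
  shows "congp 1 (fps_nth (elem_prod (p - 1)) i) 0"
    and "congp 2 (of_nat i * fps_nth (elem_prod (p - 1)) i) ((-1) ^ (i - 1) * (of_nat p * bernoulli i))"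
proof -
  let ?F = "fps_nth (elem_prod (p - 1))" and ?S = "\<lambda>e. \<Sum>j = 1..p-1. of_nat j ^ e :: rat"
  have newton: "of_nat i * ?F i = (\<Sum>r<i. ?F r * ((-1) ^ (i - 1 - r) * ?S (i - r)))" if i1: "1 \<le> i" for i
  proof -
    obtain i' where i': "i = Suc i'" using i1 by (cases i) auto
    show ?thesis
      unfolding i' elem_prod_newton lessThan_Suc_atMost
      by (intro sum.cong refl) (simp add: Suc_diff_le)
  qed
  have S0: "congp 1 ((-1) ^ (i - 1 - r) * ?S (i - r)) 0" if "r < i" "i + 2 \<le> p" for i r
  proof -
    have "congp 1 ((-1) ^ (i - 1 - r) * ?S (i - r)) ((-1) ^ (i - 1 - r) * 0)"
      using that by (intro congp_cmult congp_power_sum_0) simp_all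
    then show ?thesis by simp
  qed
  have F0: "congp 1 (?F i) 0" if "1 \<le> i" "i + 2 \<le> p" for i
  proof -
    have "congp 1 (of_nat i * ?F i) (\<Sum>r<i. ?F r * 0)"
      unfolding newton[OF that(1)] using that
      by (intro congp_sum congp_cmult elem_prod_Zp S0) simp_all
    then have "congp 1 (of_nat i * ?F i) (of_nat i * 0)" by (simp only: mult_zero_right sum.neutral_const)
    moreover have "unit (of_nat i)" using that by simp
    ultimately show ?thesis by (rule congp_cancel[rotated])
  qed
  show "congp 1 (?F i) 0" using F0 assms by blast
  have "of_nat i * ?F i = ?F 0 * ((-1) ^ (i - 1) * ?S i) + (\<Sum>r = 1..<i. ?F r * ((-1) ^ (i - 1 - r) * ?S (i - r)))"
    unfolding newton[OF assms(1)] using assms by (simp only: lessThan_atLeast0) (subst sum.atLeast_Suc_lessThan, simp_all)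
  also have "congp 2 \<dots> (?F 0 * ((-1) ^ (i - 1) * (of_nat p * bernoulli i)) + 0)"
  proof (intro congp_add congp_cmult congp_power_sum congp_zero_sum elem_prod_Zp)
    fix r assume r: "r \<in> {1..<i}"
    show "congp 2 (?F r * ((-1) ^ (i - 1 - r) * ?S (i - r))) 0"
      using congp_zero_mult[OF F0[of r] S0[of r i]] r assms by (simp add: numeral_2_eq_2)
  qed (use assms in auto)
  finally show "congp 2 (of_nat i * ?F i) ((-1) ^ (i - 1) * (of_nat p * bernoulli i))" by simp
qed

text \<open>By reversal and Wilson's theorem.  As both sides are divisible by p, knowing (p-1)! modulo p
  suffices modulo p^2.\<close>

lemma inv_elem_prod_congp:
  assumes "1 \<le> s" "s + 2 \<le> p"
  shows "congp 1 (coeff (inv_elem_prod (p - 1)) s) 0"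
    and "even s \<Longrightarrow> congp 2 (of_nat (s + 1) * coeff (inv_elem_prod (p - 1)) s) (- (of_nat p * bernoulli (p - 1 - s)))"
proof -
  let ?e = "coeff (inv_elem_prod (p - 1)) s" and ?i = "p - 1 - s"
  let ?F = "fps_nth (elem_prod (p - 1)) ?i"
  have i: "1 \<le> ?i" "?i + 2 \<le> p" using assms by auto
  have rev: "fact (p - 1) * ?e = ?F"
    using assms by (intro elem_prod_reversal) auto
  have u: "unit (fact (p - 1))" using p_pos by simp
  have "congp 1 (fact (p - 1) * ?e) (fact (p - 1) * 0)"
    unfolding rev using elem_prod_congp(1)[OF i] by simp
  then show e0: "congp 1 ?e 0" using congp_cancel[OF u] by blast
  assume "even s"
  then have odd: "odd (?i - 1)" using odd_p assms by (simp add: even_diff_nat)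
  \<comment> \<open>Dividing by p first, the remaining factors are only needed modulo p.\<close>
  obtain x where x: "x \<in> Zp" "?e = of_nat p * x" using congp_zeroE[OF e0] .
  have "congp 2 (of_nat ?i * ?F) (- (of_nat p * bernoulli ?i))"
    using elem_prod_congp(2)[OF i] odd by simp
  moreover have "of_nat ?i * ?F = of_nat p * (of_nat ?i * (fact (p - 1) * x))"
    unfolding rev[symmetric] x(2) by simp
  ultimately have "congp 2 (of_nat p * (of_nat ?i * (fact (p - 1) * x))) (of_nat p * (- bernoulli ?i))"
    by (simp only: mult_minus_right)
  then have 1: "congp 1 (of_nat ?i * (fact (p - 1) * x)) (- bernoulli ?i)"
    unfolding congp_2_p .
  have 2: "congp 1 (of_nat ?i * (fact (p - 1) * x)) ((0 - of_nat (s + 1)) * (- 1 * x))"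
  proof (intro congp_mult congp_wilson congp_refl)
    have "of_nat ?i = (of_nat p - of_nat (s + 1) :: rat)" using assms by (simp add: of_nat_diff)
    then show "congp 1 (of_nat ?i) (0 - of_nat (s + 1))"
      by (simp only:) (intro congp_diff congp_of_nat_p congp_refl)
  qed (use x u in \<open>auto simp: unit_Zp\<close>)
  have "(0 - of_nat (s + 1)) * (- 1 * x) = of_nat (s + 1) * x" by (simp add: algebra_simps)
  then have "congp 1 (of_nat (s + 1) * x) (- bernoulli ?i)"
    using congp_trans[OF congp_sym[OF 2] 1] by (simp only:)
  then have "congp 2 (of_nat p * (of_nat (s + 1) * x)) (of_nat p * (- bernoulli ?i))"
    unfolding congp_2_p .
  then show "congp 2 (of_nat (s + 1) * ?e) (- (of_nat p * bernoulli (p - 1 - s)))"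
    unfolding x(2) by (simp only: mult.left_commute mult_minus_right)
qed

text \<open>In the convolution of \<open>coeff_sqpoly_inv_elem_prod\<close> the mixed terms are products of two
  multiples of p, and the two extreme terms agree.\<close>

lemma sqpoly_p_congp_2:
  assumes "1 \<le> i" "2 * i + 2 \<le> p"
  shows "congp 2 (coeff (sqpoly p) i) (2 * coeff (inv_elem_prod (p - 1)) (2 * i))"
proof -
  let ?e = "coeff (inv_elem_prod (p - 1))"
  let ?t = "\<lambda>r. ?e r * ((-1) ^ (2 * i - r) * ?e (2 * i - r))"
  have "coeff (sqpoly p) i = (\<Sum>r\<le>2 * i. ?t r)"
    using coeff_sqpoly_inv_elem_prod[of "p - 1" i] p_pos by simp
  also have "\<dots> = ?t 0 + (\<Sum>r = 1..<2 * i. ?t r) + ?t (2 * i)"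
    using assms by (simp add: lessThan_Suc_atMost[symmetric] lessThan_atLeast0 sum.atLeast_Suc_lessThan)
  also have "congp 2 \<dots> (?t 0 + 0 + ?t (2 * i))"
  proof (intro congp_add congp_refl congp_zero_sum)
    fix r assume r: "r \<in> {1..<2 * i}"
    have "congp 1 ((-1) ^ (2 * i - r) * ?e (2 * i - r)) ((-1) ^ (2 * i - r) * 0)"
      using r assms by (intro congp_cmult inv_elem_prod_congp) auto
    then show "congp 2 (?t r) 0"
      using congp_zero_mult[OF inv_elem_prod_congp(1)[of r], of 1 "(-1) ^ (2 * i - r) * ?e (2 * i - r)"] r assms
      by (simp add: numeral_2_eq_2)
  qed
  finally show ?thesis by simp
qed

lemma sqpoly_p_congp_1:
  assumes "1 \<le> i" "2 * i + 2 \<le> p"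
  shows "congp 1 (coeff (sqpoly p) i) 0"
  using congp_trans[OF congp_weaken[OF sqpoly_p_congp_2[OF assms]]
      congp_cmult[OF _ inv_elem_prod_congp(1)[of "2 * i"], of 2]] assms by simp

section \<open>Reflection of residues modulo p^2\<close>

lemma minus_one_power_Zp [simp]: "(-1) ^ n \<in> Zp"
  by (intro Zp_power Zp_minus Zp_1)

lemma congp_scale_p: "congp 1 x y \<Longrightarrow> congp 2 (of_nat p * x) (of_nat p * y)"
  by (simp only: congp_2_p)

lemma congp_inverse_reflect:
  assumes "1 \<le> j" "j \<le> p - 1"
  shows "congp 2 (1 / of_nat (p - j)) (- (1 / of_nat j + of_nat p / of_nat j ^ 2))"
proof -
  have j: "0 < j" "j < p" using assms by auto
  have "of_nat (p - j) = (of_nat p - of_nat j :: rat)" using j by (simp add: of_nat_diff)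
  moreover have "1 / (x - y) - - (1 / y + x / y ^ 2) = x ^ 2 * (1 / (y ^ 2 * (x - y)))"
    if "y \<noteq> 0" "x - y \<noteq> 0" for x y :: rat
    using that by (simp add: field_simps power2_eq_square)
  ultimately have "1 / of_nat (p - j) - - (1 / of_nat j + of_nat p / of_nat j ^ 2)
      = of_nat p ^ 2 * (1 / (of_nat j ^ 2 * of_nat (p - j)) :: rat)"
    using j by simp
  moreover have "1 / (of_nat j ^ 2 * of_nat (p - j)) \<in> Zp"
    using j by (intro Zp_divide unit_mult unit_power unit_of_nat) auto
  ultimately show ?thesis
    unfolding congp_def by (simp only: nonzero_mult_div_cancel_left power_not_zero of_nat_eq_0_iff p_nonzero not_False_eq_True)
qed

text \<open>The binomial expansion of (p - j)^(-s), up to the term linear in p.\<close>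

lemma congp_inverse_power_reflect:
  assumes "1 \<le> j" "j \<le> p - 1"
  shows "congp 2 (1 / of_nat (p - j) ^ s) ((-1) ^ s * (1 / of_nat j ^ s + of_nat p * (of_nat s / of_nat j ^ Suc s)))"
proof (induction s)
  case (Suc s)
  have j: "0 < j" "j < p" using assms by auto
  have Z: "1 / of_nat j ^ s \<in> Zp" "of_nat s / of_nat j ^ Suc s \<in> Zp" "1 / of_nat j \<in> Zp" "1 / of_nat j ^ 2 \<in> Zp" for s
    using j by (intro Zp_divide unit_power unit_of_nat; simp)+
  let ?x = "1 / of_nat j :: rat" and ?a = "1 / of_nat j ^ s :: rat"
  have "congp 2 (1 / of_nat (p - j) ^ s * (1 / of_nat (p - j)))
     ((-1) ^ s * (1 / of_nat j ^ s + of_nat p * (of_nat s / of_nat j ^ Suc s)) * - (1 / of_nat j + of_nat p / of_nat j ^ 2))"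
  proof (intro congp_mult Suc.IH congp_inverse_reflect assms)
    show "1 / of_nat (p - j) ^ s \<in> Zp" using j by (intro Zp_divide unit_power unit_of_nat) auto
    have "of_nat p / of_nat j ^ 2 \<in> Zp" using j by (intro Zp_divide unit_power unit_of_nat) auto
    then show "- (1 / of_nat j + of_nat p / of_nat j ^ 2) \<in> Zp"
      using Z by (intro Zp_minus Zp_add)
  qed
  also have "(-1) ^ s * (1 / of_nat j ^ s + of_nat p * (of_nat s / of_nat j ^ Suc s)) * - (1 / of_nat j + of_nat p / of_nat j ^ 2)
     = (-1) ^ Suc s * (1 / of_nat j ^ Suc s + of_nat p * (of_nat (Suc s) / of_nat j ^ Suc (Suc s)))
       + of_nat p ^ 2 * ((-1) ^ Suc s * (of_nat s / of_nat j ^ Suc s) * (1 / of_nat j ^ 2) :: rat)"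
  proof -
    have "e * (a + P * (S * (a * x))) * - (x + P * (x * x))
        = - e * (a * x + P * ((1 + S) * (a * x * x))) + P ^ 2 * (- e * (S * (a * x)) * (x * x))"
      for e a P S x :: rat
      by (simp add: algebra_simps power2_eq_square)
    from this[of "(-1) ^ s" ?a "of_nat p" "of_nat s" ?x] show ?thesis
      by (simp add: power2_eq_square mult_ac)
  qed
  also have "congp 2 \<dots> ((-1) ^ Suc s * (1 / of_nat j ^ Suc s + of_nat p * (of_nat (Suc s) / of_nat j ^ Suc (Suc s))) + 0)"
  proof (intro congp_add congp_refl)
    have "(-1) ^ Suc s * (of_nat s / of_nat j ^ Suc s) * (1 / of_nat j ^ 2) \<in> Zp"
      using Z by (intro Zp_mult minus_one_power_Zp)
    then show "congp 2 (of_nat p ^ 2 * ((-1) ^ Suc s * (of_nat s / of_nat j ^ Suc s) * (1 / of_nat j ^ 2))) 0"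
      unfolding congp_def diff_0_right by (subst nonzero_mult_div_cancel_left) simp_all
  qed
  finally show ?case by (simp add: mult.commute)
qed simp

lemma congp_inverse_power_reflect_1:
  assumes "1 \<le> j" "j \<le> p - 1"
  shows "congp 1 (1 / of_nat (p - j) ^ s) ((-1) ^ s * (1 / of_nat j ^ s))"
proof -
  have j: "0 < j" "j < p" using assms by auto
  have "congp 1 ((-1) ^ s * (1 / of_nat j ^ s + of_nat p * (of_nat s / of_nat j ^ Suc s))) ((-1) ^ s * (1 / of_nat j ^ s + 0))"
    using j by (intro congp_cmult congp_add congp_refl congp_p_mult_zero minus_one_power_Zp Zp_divide unit_power unit_of_nat) auto
  then show ?thesis
    using congp_trans[OF congp_weaken[OF congp_inverse_power_reflect[OF assms]]] by simp
qed

lemma congp_harmonic: assumes "p \<ge> 5" shows "congp 2 (\<Sum>j = 1..p-1. 1 / of_nat j) 0"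
proof -
  have "congp 2 (2 * (\<Sum>j = 1..p-1. 1 / of_nat j)) (\<Sum>j = 1..p-1. - (of_nat p * (1 / of_nat j ^ 2)))"
  proof (rule congp_reflect)
    fix j assume j: "1 \<le> j" "j \<le> p - 1"
    have "congp 2 (1 / of_nat j + 1 / of_nat (p - j)) (1 / of_nat j + - (1 / of_nat j + of_nat p / of_nat j ^ 2))"
      by (intro congp_add congp_refl congp_inverse_reflect j)
    then show "congp 2 (1 / of_nat j + 1 / of_nat (p - j)) (- (of_nat p * (1 / of_nat j ^ 2)))"
      by simp
  qed
  also have "(\<Sum>j = 1..p-1. - (of_nat p * (1 / of_nat j ^ 2))) = of_nat p * - (\<Sum>j = 1..p-1. 1 / of_nat j ^ 2 :: rat)"
    by (simp add: sum_negf sum_distrib_left)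
  also have "congp 2 \<dots> (of_nat p * - 0)"
    using assms by (intro congp_scale_p congp_minus congp_inverse_power_sum) auto
  finally show ?thesis using congp_cancel_2[of 2 _ 0] by simp
qed

lemma harm2_Zp: assumes "j < p" shows "harm2 s j \<in> Zp"
  unfolding harm2_def using assms
  by (intro Zp_add Zp_sum Zp_divide unit_power unit_of_nat) auto

text \<open>Induction on j, removing the reciprocals of p - j and p - j - 1 from the left-hand side.  The
  base case rests on Wolstenholme's congruence \<open>congp_harmonic\<close>.\<close>

lemma harm2_reflect:
  assumes "p \<ge> 5" "1 \<le> j" "j \<le> p - 1"
  shows "congp 2 (harm2 1 (p - j)) (harm2 1 j + of_nat p * harm2 2 j)"
  using assms(2,3)
proof (induction j rule: dec_induct)
  case base
  have "{1..p - 1} = insert (p - 1) {1..<p - 1}" using p_gt_1 by auto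
  then have "harm2 1 (p - 1) = 2 * (\<Sum>j = 1..p-1. 1 / of_nat j) - 1 / of_nat (p - 1)"
    by (simp add: harm2_def)
  also have "congp 2 \<dots> (2 * 0 - - (1 / of_nat 1 + of_nat p / of_nat 1 ^ 2))"
    using assms by (intro congp_diff congp_cmult congp_harmonic congp_inverse_reflect) auto
  finally show ?case by (simp add: harm2_def add.commute)
next
  case (step j)
  define d where "d = p - Suc j"
  have d: "p - j = Suc d" "p - Suc j = d" "d \<ge> 1" using step by (auto simp: d_def)
  have "harm2 1 d = harm2 1 (p - j) - 1 / of_nat (p - j) - 1 / of_nat (p - Suc j)"
    unfolding d using harm2_Suc[OF d(3), of 1] by simp
  also have "congp 2 \<dots> (harm2 1 j + of_nat p * harm2 2 j - - (1 / of_nat j + of_nat p / of_nat j ^ 2)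
      - - (1 / of_nat (Suc j) + of_nat p / of_nat (Suc j) ^ 2))"
    using step by (intro congp_diff congp_inverse_reflect step.IH) auto
  also have "harm2 1 j + of_nat p * harm2 2 j - - (1 / of_nat j + of_nat p / of_nat j ^ 2)
      - - (1 / of_nat (Suc j) + of_nat p / of_nat (Suc j) ^ 2) = harm2 1 (Suc j) + of_nat p * harm2 2 (Suc j)"
    using step(1) by (simp add: harm2_Suc distrib_left del: of_nat_Suc)
  finally show ?case unfolding d .
qed

lemma harm2_reflect_1:
  assumes "p \<ge> 5" "1 \<le> j" "j \<le> p - 1"
  shows "congp 1 (harm2 1 (p - j)) (harm2 1 j)"
proof -
  have "congp 1 (harm2 1 j + of_nat p * harm2 2 j) (harm2 1 j + 0)"
    using assms by (intro congp_add congp_refl congp_p_mult_zero harm2_Zp) auto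
  then show ?thesis using congp_trans[OF congp_weaken[OF harm2_reflect[OF assms]]] by simp
qed

text \<open>Each factor (i - p)/(i + p) in \<open>lagrange_coeff_prod\<close> is 1 - 2p/i modulo p^2.\<close>

lemma congp_lagrange_coeff:
  assumes "1 \<le> j" "j \<le> p - 1"
  shows "congp 2 (of_nat p * lagrange_coeff (p - 1) j) (of_nat j * (2 * (of_nat p * harm2 1 j) - 2))"
proof -
  let ?q = "\<lambda>i. (of_nat i - of_nat p) / (of_nat i + of_nat p) :: rat"
  have psq: "congp 2 (of_nat p ^ 2 * x) 0" if "x \<in> Zp" for x
    unfolding congp_def diff_0_right using that by (subst nonzero_mult_div_cancel_left) simp_all
  have pr: "congp 2 (\<Prod>i = 1..<j. ?q i) (1 - 2 * (of_nat p * (\<Sum>i = 1..<j. 1 / of_nat i)))"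
    if "1 \<le> j" "j \<le> p - 1" for j
    using that
  proof (induction j rule: dec_induct)
    case (step j)
    have j: "0 < j" "j < p" "j \<le> p - 1" using step by auto
    let ?H = "\<Sum>i = 1..<j. 1 / of_nat i :: rat" and ?x = "1 / of_nat j :: rat"
    have HZ: "?H \<in> Zp" using j by (intro Zp_sum Zp_divide unit_of_nat) auto
    have xZ: "?x \<in> Zp" using j by (intro Zp_divide unit_of_nat) auto
    have u: "unit (of_nat j + of_nat p)" using unit_plus_p[of j] j by (simp add: add.commute)
    have qZ: "?q j \<in> Zp" using u by (intro Zp_divide Zp_diff) auto
    have q: "congp 2 (?q j) (1 - 2 * (of_nat p * ?x))"
    proof -
      have "(y - x) / (y + x) - (1 - 2 * (x * (1 / y))) = x ^ 2 * (2 * (1 / y) / (y + x))"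
        if "y \<noteq> 0" "y + x \<noteq> 0" for x y :: rat
        using that by (simp add: field_simps power2_eq_square)
      then have "?q j - (1 - 2 * (of_nat p * ?x)) = of_nat p ^ 2 * (2 * ?x / (of_nat j + of_nat p))"
        using j unit_nonzero[OF u] by simp
      moreover have "2 * ?x / (of_nat j + of_nat p) \<in> Zp"
        using u xZ j by (intro Zp_divide Zp_mult) auto
      ultimately show ?thesis using psq unfolding congp_def by simp
    qed
    have "(\<Prod>i = 1..<Suc j. ?q i) = (\<Prod>i = 1..<j. ?q i) * ?q j"
      using step(1) by (simp add: prod.atLeastLessThan_Suc)
    also have "congp 2 \<dots> ((1 - 2 * (of_nat p * ?H)) * (1 - 2 * (of_nat p * ?x)))"
    proof (intro congp_mult q)
      show "congp 2 (\<Prod>i = 1..<j. ?q i) (1 - 2 * (of_nat p * ?H))" using step.IH j by simp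
      show "(\<Prod>i = 1..<j. ?q i) \<in> Zp"
      proof (rule Zp_prod)
        fix i assume "i \<in> {1..<j}"
        then have "unit (of_nat i + of_nat p)" using unit_plus_p[of i] j by (simp add: add.commute)
        then show "?q i \<in> Zp" by (intro Zp_divide Zp_diff) auto
      qed
      show "1 - 2 * (of_nat p * ?x) \<in> Zp" using xZ by (intro Zp_diff Zp_mult) auto
    qed
    also have "(1 - 2 * (of_nat p * ?H)) * (1 - 2 * (of_nat p * ?x)) = (1 - 2 * (of_nat p * (?H + ?x))) + of_nat p ^ 2 * (4 * (?H * ?x))"
    proof -
      have "(1 - 2 * (a * b)) * (1 - 2 * (a * c)) = (1 - 2 * (a * (b + c))) + a ^ 2 * (4 * (b * c))" for a b c :: rat
        by (simp add: algebra_simps power2_eq_square)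
      then show ?thesis .
    qed
    also have "congp 2 \<dots> ((1 - 2 * (of_nat p * (?H + ?x))) + 0)"
      using HZ xZ by (intro congp_add congp_refl psq Zp_mult) auto
    also have "?H + ?x = (\<Sum>i = 1..<Suc j. 1 / of_nat i)"
      using step(1) by (simp add: sum.atLeastLessThan_Suc)
    finally show ?case by simp
  qed simp
  let ?H = "\<Sum>i = 1..<j. 1 / of_nat i :: rat"
  have j: "0 < j" "j < p" using assms by auto
  have HZ: "?H \<in> Zp" using j by (intro Zp_sum Zp_divide unit_of_nat) auto
  have "of_nat p * lagrange_coeff (p - 1) j = 2 * (of_nat p - of_nat j) * (\<Prod>i = 1..<j. ?q i)"
    using lagrange_coeff_prod[OF assms] p_pos by simp
  also have "congp 2 \<dots> (2 * (of_nat p - of_nat j) * (1 - 2 * (of_nat p * ?H)))"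
    using assms by (intro congp_cmult pr) auto
  also have "2 * (of_nat p - of_nat j) * (1 - 2 * (of_nat p * ?H))
      = of_nat j * (2 * (of_nat p * (?H + (?H + 1 / of_nat j))) - 2) + of_nat p ^ 2 * (- 4 * ?H)"
  proof -
    have "2 * (x - y) * (1 - 2 * (x * h)) = y * (2 * (x * (h + (h + 1 / y))) - 2) + x ^ 2 * (- 4 * h)"
      if "y \<noteq> 0" for x y h :: rat
      using that by (simp add: field_simps power2_eq_square)
    then show ?thesis using j by simp
  qed
  also have "congp 2 \<dots> (of_nat j * (2 * (of_nat p * (?H + (?H + 1 / of_nat j))) - 2) + 0)"
    using HZ by (intro congp_add congp_refl psq Zp_mult) auto
  also have "?H + (?H + 1 / of_nat j) = harm2 1 j"
  proof -
    have "{1..j} = insert j {1..<j}" using j by auto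
    then show ?thesis by (simp add: harm2_def)
  qed
  finally show ?thesis by simp
qed

section \<open>Reduction of the interpolation formula and of the remainder\<close>

lemma sqpoly_Zp: "k \<le> p \<Longrightarrow> coeff (sqpoly k) m \<in> Zp"
proof (induction k arbitrary: m)
  case 0
  then show ?case by (cases m) (simp_all add: sqpoly_def)
next
  case (Suc k)
  show ?case
  proof (cases "k = 0")
    case True
    then show ?thesis by (cases m) simp_all
  next
    case False
    have "1 / of_nat k ^ 2 \<in> Zp"
      using Suc.prems False by (intro Zp_divide unit_power unit_of_nat) auto
    moreover have "coeff (sqpoly k) m \<in> Zp" for m
      using Suc by simp
    moreover have "sqpoly (Suc k) = sqpoly k * [:1, - (1 / of_nat k ^ 2):]"
      using False by (intro sqpoly_Suc) simp
    ultimately show ?thesis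
      by (cases m) (simp_all only: coeff_mult_linear Zp_add Zp_mult Zp_minus Zp_1)
  qed
qed

lemma hcoeff_Zp: "k \<le> p \<Longrightarrow> hcoeff k m \<in> Zp"
  unfolding hcoeff_def by (rule sqpoly_Zp)

text \<open>The interpolation formula is the convolution of the coefficients of P_p with the sums U k.  The
  non-constant coefficients of P_p and all these sums are divisible by p, so modulo p^2 only the
  constant coefficient contributes.\<close>

lemma interpolation_sum_congp:
  fixes w U m
  defines "U \<equiv> \<lambda>k. \<Sum>j = 1..p-1. of_nat p * lagrange_coeff (p - 1) j * w j / of_nat j ^ (2 * k + 2)"
  assumes "2 * m + 2 \<le> p" and U: "\<And>k. k \<le> m \<Longrightarrow> congp 1 (U k) 0"
  shows "congp 2 (of_nat p * (\<Sum>j = 1..p-1. lagrange_coeff (p - 1) j * w j * quotient_coeff j (sqpoly p) m)) (U m)"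
proof -
  have "of_nat p * (\<Sum>j = 1..p-1. lagrange_coeff (p - 1) j * w j * quotient_coeff j (sqpoly p) m)
     = (\<Sum>i\<le>m. coeff (sqpoly p) i * U (m - i))"
    unfolding U_def quotient_coeff_def sum_distrib_left
    by (subst sum.swap) (intro sum.cong refl, simp)
  also have "\<dots> = coeff (sqpoly p) 0 * U m + (\<Sum>i = 1..m. coeff (sqpoly p) i * U (m - i))"
    by (simp add: atMost_atLeast0 sum.atLeast_Suc_atMost)
  also have "congp 2 \<dots> (coeff (sqpoly p) 0 * U m + 0)"
  proof (intro congp_add congp_refl congp_zero_sum)
    fix i assume i: "i \<in> {1..m}"
    show "congp 2 (coeff (sqpoly p) i * U (m - i)) 0"
      using congp_zero_mult[OF sqpoly_p_congp_1[of i] U[of "m - i"]] i assms(2) by (simp add: numeral_2_eq_2)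
  qed
  finally show ?thesis by simp
qed

text \<open>Exactly, p (p - k) times the remainder is the product of the j^2/(j^2 - p^2) for j < k, which is
  1 modulo p^2.\<close>

lemma congp_apery_remainder:
  assumes "1 \<le> k" "k \<le> p - 1"
  shows "congp 2 (of_nat p * apery_remainder (p - 1) k) (- (1 / of_nat k + of_nat p / of_nat k ^ 2))"
proof -
  have k: "k < p" "k - 1 < p" using assms by auto
  have f1: "fact (p - 1 + k) = (of_nat p * square_diff_prod p (k - 1) * fact (p - k) :: rat)"
  proof -
    have "p - 1 + k = p + (k - 1)" "p - (k - 1) - 1 = p - k" using assms by auto
    then show ?thesis using square_diff_prod_fact[OF k(2)] by (simp add: divide_eq_eq nonzero_eq_divide_eq)
  qed
  have f2: "fact (p - k) = (of_nat (p - k) * fact (p - 1 - k) :: rat)"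
    using k fact_reduce[of "p - k", where 'a = rat] by (simp add: diff_right_commute)
  have dnz: "square_diff_prod p (k - 1) \<noteq> 0" using square_diff_prod_nonzero[OF k(2)] .
  have "of_nat p * apery_remainder (p - 1) k = (-1) ^ (k - 1) * fact (k - 1) ^ 2 / square_diff_prod p (k - 1) * (1 / of_nat (p - k))"
    unfolding apery_remainder_def f1 f2 using k dnz by simp
  also have "(-1) ^ (k - 1) * fact (k - 1) ^ 2 / square_diff_prod p (k - 1) = (\<Prod>j = 1..k-1. - (of_nat j ^ 2) / (of_nat p ^ 2 - of_nat j ^ 2) :: rat)"
    unfolding square_diff_prod_def prod_dividef prod_uminus fact_prod of_nat_prod prod_power_distrib by simp
  also have "congp 2 ((\<Prod>j = 1..k-1. - (of_nat j ^ 2) / (of_nat p ^ 2 - of_nat j ^ 2)) * (1 / of_nat (p - k)))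
      (1 * - (1 / of_nat k + of_nat p / of_nat k ^ 2))"
  proof (intro congp_mult congp_prod_one congp_inverse_reflect assms Zp_prod)
    fix j assume j: "j \<in> {1..k-1}"
    have u: "unit (of_nat p ^ 2 - of_nat j ^ 2)"
      using unit_mult[OF unit_minus_p[of j] unit_plus_p[of j]] j k
      by (simp add: power2_eq_square algebra_simps)
    then show "- (of_nat j ^ 2) / (of_nat p ^ 2 - of_nat j ^ 2) \<in> Zp"
      by (intro Zp_divide Zp_minus Zp_power Zp_of_nat)
    have "- y / (x - y) - 1 = x * (- 1 / (x - y))" if "x - y \<noteq> 0" for x y :: rat
      using that by (simp add: field_simps)
    from this[OF unit_nonzero[OF u]] show "congp 2 (- (of_nat j ^ 2) / (of_nat p ^ 2 - of_nat j ^ 2)) 1"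
      unfolding congp_def using u by simp
  next
    have "of_nat p / of_nat k ^ 2 \<in> Zp" "1 / of_nat k \<in> Zp"
      using assms k by (intro Zp_divide unit_power unit_of_nat; simp)+
    then show "- (1 / of_nat k + of_nat p / of_nat k ^ 2) \<in> Zp"
      by (intro Zp_minus Zp_add)
  qed
  finally show ?thesis by simp
qed

section \<open>The sums of coefficients over k and k^3 modulo p\<close>

lemma minus_one_power_reflect: "j \<le> p \<Longrightarrow> (-1) ^ (p - j) = - ((-1) ^ j :: rat)"
  using odd_p by (simp add: minus_one_power_iff even_diff_nat)

lemma inverse_power_Zp:
  assumes "1 \<le> j" "j \<le> p - 1"
  shows "1 / of_nat j ^ s \<in> Zp"
proof -
  have "0 < j" "j < p" using assms p_pos by linarith+
  from Zp_divide[OF Zp_1 unit_power[OF unit_of_nat[OF this]]] show ?thesis .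
qed

text \<open>Modulo p^2 the weights leave a sum of (-1)^j/j^(2k), evaluated by reflection, and p times a sum
  that is antisymmetric under reflection and therefore vanishes modulo p.\<close>

lemma even_weight_congp:
  assumes "p \<ge> 5" "2 * k + 2 \<le> p"
  shows "congp 2 (\<Sum>j = 1..p-1. of_nat p * lagrange_coeff (p - 1) j * ((-1) ^ (j - 1) * of_nat j) / of_nat j ^ (2 * k + 2))
     (of_nat p * (- of_nat (2 * k) * (\<Sum>j = 1..p-1. (-1) ^ j / of_nat j ^ (2 * k + 1))))"
proof -
  let ?a = "\<lambda>j. (-1) ^ j * (1 / of_nat j ^ (2 * k)) :: rat"
  let ?b = "\<lambda>j. (-1) ^ j * (1 / of_nat j ^ (2 * k)) * harm2 1 j :: rat"
  note Z = inverse_power_Zp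
  have A: "congp 2 (2 * (\<Sum>j = 1..p-1. ?a j)) (\<Sum>j = 1..p-1. of_nat p * (- of_nat (2 * k) * ((-1) ^ j / of_nat j ^ (2 * k + 1))))"
  proof (rule congp_reflect)
    fix j assume j: "1 \<le> j" "j \<le> p - 1"
    have s: "(-1) ^ (p - j) = - ((-1) ^ j :: rat)" using j by (intro minus_one_power_reflect) simp
    have "congp 2 (?a (p - j)) (- ((-1) ^ j) * ((-1) ^ (2 * k) * (1 / of_nat j ^ (2 * k) + of_nat p * (of_nat (2 * k) / of_nat j ^ Suc (2 * k)))))"
      unfolding s by (rule congp_cmult[OF Zp_minus[OF minus_one_power_Zp] congp_inverse_power_reflect[OF j]])
    then have "congp 2 (?a j + ?a (p - j)) (?a j + - ((-1) ^ j) * ((-1) ^ (2 * k) * (1 / of_nat j ^ (2 * k) + of_nat p * (of_nat (2 * k) / of_nat j ^ Suc (2 * k)))))"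
      by (rule congp_add[OF congp_refl])
    also have "?a j + - ((-1) ^ j) * ((-1) ^ (2 * k) * (1 / of_nat j ^ (2 * k) + of_nat p * (of_nat (2 * k) / of_nat j ^ Suc (2 * k))))
        = of_nat p * (- of_nat (2 * k) * ((-1) ^ j / of_nat j ^ (2 * k + 1)))"
      by (simp add: algebra_simps)
    finally show "congp 2 (?a j + ?a (p - j)) (of_nat p * (- of_nat (2 * k) * ((-1) ^ j / of_nat j ^ (2 * k + 1))))" .
  qed
  have B: "congp 1 (\<Sum>j = 1..p-1. ?b j) 0"
  proof (rule congp_reflect_0)
    fix j assume j: "1 \<le> j" "j \<le> p - 1"
    have pj: "1 \<le> p - j" "p - j \<le> p - 1" using j by auto
    have s: "(-1) ^ (p - j) = - ((-1) ^ j :: rat)" using j by (intro minus_one_power_reflect) simp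
    have "congp 1 (?b (p - j)) (- ((-1) ^ j) * ((-1) ^ (2 * k) * (1 / of_nat j ^ (2 * k))) * harm2 1 j)"
    proof (rule congp_mult)
      show "congp 1 ((-1) ^ (p - j) * (1 / of_nat (p - j) ^ (2 * k))) (- ((-1) ^ j) * ((-1) ^ (2 * k) * (1 / of_nat j ^ (2 * k))))"
        unfolding s by (rule congp_cmult[OF Zp_minus[OF minus_one_power_Zp] congp_inverse_power_reflect_1[OF j]])
      show "congp 1 (harm2 1 (p - j)) (harm2 1 j)" by (rule harm2_reflect_1[OF assms(1) j])
      show "(-1) ^ (p - j) * (1 / of_nat (p - j) ^ (2 * k)) \<in> Zp" by (rule Zp_mult[OF minus_one_power_Zp Z[OF pj]])
      show "harm2 1 j \<in> Zp" by (rule harm2_Zp) (use j in linarith)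
    qed
    then have "congp 1 (?b j + ?b (p - j)) (?b j + - ((-1) ^ j) * ((-1) ^ (2 * k) * (1 / of_nat j ^ (2 * k))) * harm2 1 j)"
      by (rule congp_add[OF congp_refl])
    then show "congp 1 (?b j + ?b (p - j)) 0" by simp
  qed
  have "(\<Sum>j = 1..p-1. of_nat p * lagrange_coeff (p - 1) j * ((-1) ^ (j - 1) * of_nat j) / of_nat j ^ (2 * k + 2))
      = (\<Sum>j = 1..p-1. (-1) ^ (j - 1) * (1 / of_nat j ^ (2 * k + 1)) * (of_nat p * lagrange_coeff (p - 1) j))"
  proof (intro sum.cong refl)
    fix j assume "j \<in> {1..p-1}"
    then have "x * (e * of_nat j) / of_nat j ^ (2 * k + 2) = e * (1 / of_nat j ^ (2 * k + 1)) * x" for x e :: rat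
      by simp
    then show "of_nat p * lagrange_coeff (p - 1) j * ((-1) ^ (j - 1) * of_nat j) / of_nat j ^ (2 * k + 2)
       = (-1) ^ (j - 1) * (1 / of_nat j ^ (2 * k + 1)) * (of_nat p * lagrange_coeff (p - 1) j)" .
  qed
  also have "congp 2 \<dots> (\<Sum>j = 1..p-1. (-1) ^ (j - 1) * (1 / of_nat j ^ (2 * k + 1)) * (of_nat j * (2 * (of_nat p * harm2 1 j) - 2)))"
  proof (rule congp_sum)
    fix j assume "j \<in> {1..p-1}"
    then have j: "1 \<le> j" "j \<le> p - 1" by auto
    show "congp 2 ((-1) ^ (j - 1) * (1 / of_nat j ^ (2 * k + 1)) * (of_nat p * lagrange_coeff (p - 1) j))
        ((-1) ^ (j - 1) * (1 / of_nat j ^ (2 * k + 1)) * (of_nat j * (2 * (of_nat p * harm2 1 j) - 2)))"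
      by (rule congp_cmult[OF Zp_mult[OF minus_one_power_Zp Z[OF j]] congp_lagrange_coeff[OF j]])
  qed
  also have "\<dots> = (\<Sum>j = 1..p-1. 2 * ?a j - of_nat p * (2 * ?b j))"
  proof (intro sum.cong refl)
    fix j assume j: "j \<in> {1..p-1}"
    then have "(-1) ^ (j - 1) = - ((-1) ^ j :: rat)" by (simp add: minus_one_power_iff even_diff_nat)
    then show "(-1) ^ (j - 1) * (1 / of_nat j ^ (2 * k + 1)) * (of_nat j * (2 * (of_nat p * harm2 1 j) - 2)) = 2 * ?a j - of_nat p * (2 * ?b j)"
      using j by (simp add: algebra_simps)
  qed
  also have "\<dots> = 2 * (\<Sum>j = 1..p-1. ?a j) - of_nat p * (2 * (\<Sum>j = 1..p-1. ?b j))"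
    by (simp only: sum_subtractf sum_distrib_left)
  also have "congp 2 \<dots> ((\<Sum>j = 1..p-1. of_nat p * (- of_nat (2 * k) * ((-1) ^ j / of_nat j ^ (2 * k + 1)))) - of_nat p * (2 * 0))"
    by (rule congp_diff[OF A congp_scale_p[OF congp_cmult[OF Zp_numeral B]]])
  also have "(\<Sum>j = 1..p-1. of_nat p * (- of_nat (2 * k) * ((-1) ^ j / of_nat j ^ (2 * k + 1)))) - of_nat p * (2 * 0)
     = of_nat p * (- of_nat (2 * k) * (\<Sum>j = 1..p-1. (-1) ^ j / of_nat j ^ (2 * k + 1)) :: rat)"
    by (simp only: sum_distrib_left mult_zero_right diff_0_right)
  finally show ?thesis .
qed

lemma sum_hcoeff_over_k_congp:
  assumes "p \<ge> 5" "2 * m + 2 \<le> p"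
  shows "congp 1 (\<Sum>k = 1..p-1. hcoeff k m / of_nat k)
     (- of_nat (2 * m) * (\<Sum>j = 1..p-1. (-1) ^ j / of_nat j ^ (2 * m + 1)))"
proof -
  let ?U = "\<lambda>k. \<Sum>j = 1..p-1. of_nat p * lagrange_coeff (p - 1) j * ((-1) ^ (j - 1) * of_nat j) / of_nat j ^ (2 * k + 2)"
  have S: "Suc (p - 1) = p" using p_pos by simp
  have "of_nat p * (\<Sum>k = 1..p-1. hcoeff k m / of_nat k)
      = of_nat p * (\<Sum>j = 1..p-1. lagrange_coeff (p - 1) j * ((-1) ^ (j - 1) * of_nat j) * quotient_coeff j (sqpoly p) m)"
    using sum_hcoeff_over_k[of "p - 1" m, unfolded S] p_gt_1 by (simp only: mult.assoc)
  also have "congp 2 \<dots> (?U m)"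
  proof (rule interpolation_sum_congp)
    fix k assume k: "k \<le> m"
    have "(\<Sum>j = 1..p-1. (-1) ^ j / of_nat j ^ (2 * k + 1)) \<in> Zp"
      by (intro Zp_sum Zp_divide unit_power unit_of_nat) auto
    then have "congp 1 (of_nat p * (- of_nat (2 * k) * (\<Sum>j = 1..p-1. (-1) ^ j / of_nat j ^ (2 * k + 1)))) 0"
      by (intro congp_p_mult_zero Zp_mult Zp_minus Zp_of_nat)
    from congp_trans[OF congp_weaken[OF even_weight_congp] this] show "congp 1 (?U k) 0"
      using assms k by simp
  qed (use assms in auto)
  also have "congp 2 \<dots> (of_nat p * (- of_nat (2 * m) * (\<Sum>j = 1..p-1. (-1) ^ j / of_nat j ^ (2 * m + 1))))"
    using assms by (intro even_weight_congp) auto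
  finally show ?thesis unfolding congp_2_p .
qed

lemma harm2_sum_congp:
  assumes "1 \<le> s" "1 \<le> t" "s + t + 2 \<le> p"
  shows "congp 1 (\<Sum>j = 1..p-1. harm2 s j / of_nat j ^ t)
     (2 * ((-1) ^ t * fact (s + t - 1) / (fact s * fact t) * bernoulli (p - s - t)))"
proof -
  have "(\<Sum>j = 1..p-1. harm2 s j / of_nat j ^ t)
     = (\<Sum>j = 1..p-1. 2 * ((\<Sum>i = 1..<j. 1 / of_nat i ^ s) / of_nat j ^ t) + 1 / of_nat j ^ (s + t))"
  proof (intro sum.cong refl)
    fix j assume j: "j \<in> {1..p-1}"
    have "{1..j} = insert j {1..<j}" using j by auto
    then show "harm2 s j / of_nat j ^ t = 2 * ((\<Sum>i = 1..<j. 1 / of_nat i ^ s) / of_nat j ^ t) + 1 / of_nat j ^ (s + t)"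
      by (simp add: harm2_def power_add add_divide_distrib)
  qed
  also have "\<dots> = 2 * (\<Sum>j = 1..p-1. (\<Sum>i = 1..<j. 1 / of_nat i ^ s) / of_nat j ^ t) + (\<Sum>j = 1..p-1. 1 / of_nat j ^ (s + t))"
    by (simp only: sum.distrib sum_distrib_left)
  also have "congp 1 \<dots> (2 * ((-1) ^ t * fact (s + t - 1) / (fact s * fact t) * bernoulli (p - s - t)) + 0)"
    using assms by (intro congp_add congp_cmult congp_double_harmonic_sum congp_inverse_power_sum) auto
  finally show ?thesis by simp
qed

text \<open>The same for the values (H_j + H_{j-1})/j^2: reflection leaves two double harmonic sums, which
  contribute - 2 (k+1) and 2 (2k+1) times the same Bernoulli number.\<close>

lemma odd_weight_congp:
  assumes "2 * k + 5 \<le> p"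
  shows "congp 2 (\<Sum>j = 1..p-1. of_nat p * lagrange_coeff (p - 1) j * harm2 1 j / of_nat j ^ (2 * k + 2))
     (of_nat p * (of_nat (2 * k) * bernoulli (p - 2 * k - 3)))"
proof -
  have p5: "p \<ge> 5" using assms by simp
  let ?a = "\<lambda>j. 1 / of_nat j ^ (2 * k + 1) * harm2 1 j :: rat"
  let ?b = "\<lambda>j. 1 / of_nat j ^ (2 * k + 1) * harm2 1 j ^ 2 :: rat"
  let ?c = "\<lambda>j. harm2 2 j / of_nat j ^ (2 * k + 1) + of_nat (2 * k + 1) * (harm2 1 j / of_nat j ^ (2 * k + 2)) :: rat"
  let ?B = "bernoulli (p - 2 * k - 3)"
  note Z = inverse_power_Zp
  have hZ: "harm2 s j \<in> Zp" if "1 \<le> j" "j \<le> p - 1" for j s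
    by (rule harm2_Zp) (use that p_pos in linarith)
  have C: "congp 1 (\<Sum>j = 1..p-1. ?c j) (of_nat (2 * k) * ?B)"
  proof -
    have "(\<Sum>j = 1..p-1. ?c j) = (\<Sum>j = 1..p-1. harm2 2 j / of_nat j ^ (2 * k + 1)) + of_nat (2 * k + 1) * (\<Sum>j = 1..p-1. harm2 1 j / of_nat j ^ (2 * k + 2))"
      by (simp only: sum.distrib sum_distrib_left)
    also have "congp 1 \<dots> (2 * ((-1) ^ (2 * k + 1) * fact (2 + (2 * k + 1) - 1) / (fact 2 * fact (2 * k + 1)) * bernoulli (p - 2 - (2 * k + 1)))
        + of_nat (2 * k + 1) * (2 * ((-1) ^ (2 * k + 2) * fact (1 + (2 * k + 2) - 1) / (fact 1 * fact (2 * k + 2)) * bernoulli (p - 1 - (2 * k + 2)))))"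
      using assms by (intro congp_add congp_cmult harm2_sum_congp) auto
    also have "p - 2 - (2 * k + 1) = p - 2 * k - 3" by simp
    also have "p - 1 - (2 * k + 2) = p - 2 * k - 3" by simp
    also have "2 * ((-1) ^ (2 * k + 1) * fact (2 + (2 * k + 1) - 1) / (fact 2 * fact (2 * k + 1)) * ?B)
        + of_nat (2 * k + 1) * (2 * ((-1) ^ (2 * k + 2) * fact (1 + (2 * k + 2) - 1) / (fact 1 * fact (2 * k + 2)) * ?B))
        = of_nat (2 * k) * ?B"
    proof -
      have 1: "fact (2 + (2 * k + 1) - 1) = (of_nat (2 * k + 2) * fact (2 * k + 1) :: rat)" by simp
      have 2: "1 + (2 * k + 2) - 1 = 2 * k + 2" by simp
      have "2 * (-1 * (w * f) / (2 * f) * b) + v * (2 * (1 * g / (1 * g) * b)) = (2 * v - w) * b"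
        if "f \<noteq> 0" "g \<noteq> 0" for b f g v w :: rat
        using that by (simp add: algebra_simps)
      moreover have "2 * of_nat (2 * k + 1) - of_nat (2 * k + 2) = (of_nat (2 * k) :: rat)" by simp
      moreover have "(-1) ^ (2 * k + 1) = (-1 :: rat)" "(-1) ^ (2 * k + 2) = (1 :: rat)"
        "fact 1 = (1 :: rat)" "fact 2 = (2 :: rat)" by simp_all
      ultimately show ?thesis unfolding 1 2 by (simp only: fact_nonzero not_False_eq_True)
    qed
    finally show ?thesis .
  qed
  have A: "congp 2 (2 * (\<Sum>j = 1..p-1. ?a j)) (\<Sum>j = 1..p-1. - (of_nat p * ?c j))"
  proof (rule congp_reflect)
    fix j assume j: "1 \<le> j" "j \<le> p - 1"
    have pj: "p - j < p" "1 \<le> p - j" "p - j \<le> p - 1" using j by auto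
    let ?i = "1 / of_nat j ^ (2 * k + 1) :: rat" and ?i' = "of_nat (2 * k + 1) / of_nat j ^ Suc (2 * k + 1) :: rat"
    have i'Z: "?i' \<in> Zp" using j by (intro Zp_divide unit_power unit_of_nat) auto
    have "congp 2 (?a (p - j)) ((-1) ^ (2 * k + 1) * (?i + of_nat p * ?i') * (harm2 1 j + of_nat p * harm2 2 j))"
      by (rule congp_mult[OF congp_inverse_power_reflect[OF j] harm2_reflect[OF p5 j] Z[OF pj(2,3)]
            Zp_add[OF hZ[OF j] Zp_mult[OF Zp_of_nat hZ[OF j]]]])
    then have "congp 2 (?a j + ?a (p - j)) (?a j + (-1) ^ (2 * k + 1) * (?i + of_nat p * ?i') * (harm2 1 j + of_nat p * harm2 2 j))"
      by (rule congp_add[OF congp_refl])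
    also have "?a j + (-1) ^ (2 * k + 1) * (?i + of_nat p * ?i') * (harm2 1 j + of_nat p * harm2 2 j)
        = - (of_nat p * ?c j) + of_nat p ^ 2 * (- ?i' * harm2 2 j)"
    proof -
      have "i * h + e * (i + P * i') * (h + P * g) = - (P * (g * i + i' * h)) + P ^ 2 * (- i' * g)"
        if "e = -1" for e i h P i' g :: rat
        using that by (simp add: algebra_simps power2_eq_square)
      moreover have "(-1) ^ (2 * k + 1) = (-1 :: rat)" by simp
      ultimately have "?a j + (-1) ^ (2 * k + 1) * (?i + of_nat p * ?i') * (harm2 1 j + of_nat p * harm2 2 j)
        = - (of_nat p * (harm2 2 j * ?i + ?i' * harm2 1 j)) + of_nat p ^ 2 * (- ?i' * harm2 2 j)"
        by blast
      also have "harm2 2 j * ?i + ?i' * harm2 1 j = ?c j" by simp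
      finally show ?thesis .
    qed
    also have "congp 2 \<dots> (- (of_nat p * ?c j) + 0)"
    proof (intro congp_add congp_refl)
      have "- ?i' * harm2 2 j \<in> Zp" using i'Z hZ[OF j] by (intro Zp_mult Zp_minus)
      then show "congp 2 (of_nat p ^ 2 * (- ?i' * harm2 2 j)) 0"
        unfolding congp_def diff_0_right by (subst nonzero_mult_div_cancel_left) simp_all
    qed
    finally show "congp 2 (?a j + ?a (p - j)) (- (of_nat p * ?c j))" by simp
  qed
  have B: "congp 1 (\<Sum>j = 1..p-1. ?b j) 0"
  proof (rule congp_reflect_0)
    fix j assume j: "1 \<le> j" "j \<le> p - 1"
    have pj: "1 \<le> p - j" "p - j \<le> p - 1" using j by auto
    have "congp 1 (?b (p - j)) (((-1) ^ (2 * k + 1) * (1 / of_nat j ^ (2 * k + 1))) * harm2 1 j ^ 2)"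
      by (rule congp_mult[OF congp_inverse_power_reflect_1[OF j] congp_power[OF harm2_reflect_1[OF p5 j] hZ[OF j]]
            Z[OF pj] Zp_power[OF hZ[OF j]]])
    then have "congp 1 (?b j + ?b (p - j)) (?b j + ((-1) ^ (2 * k + 1) * (1 / of_nat j ^ (2 * k + 1))) * harm2 1 j ^ 2)"
      by (rule congp_add[OF congp_refl])
    then show "congp 1 (?b j + ?b (p - j)) 0" by simp
  qed
  have "(\<Sum>j = 1..p-1. of_nat p * lagrange_coeff (p - 1) j * harm2 1 j / of_nat j ^ (2 * k + 2))
      = (\<Sum>j = 1..p-1. 1 / of_nat j ^ (2 * k + 2) * harm2 1 j * (of_nat p * lagrange_coeff (p - 1) j))"
    by (intro sum.cong refl) (simp add: mult_ac)
  also have "congp 2 \<dots> (\<Sum>j = 1..p-1. 1 / of_nat j ^ (2 * k + 2) * harm2 1 j * (of_nat j * (2 * (of_nat p * harm2 1 j) - 2)))"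
  proof (rule congp_sum)
    fix j assume "j \<in> {1..p-1}"
    then have j: "1 \<le> j" "j \<le> p - 1" by auto
    show "congp 2 (1 / of_nat j ^ (2 * k + 2) * harm2 1 j * (of_nat p * lagrange_coeff (p - 1) j))
        (1 / of_nat j ^ (2 * k + 2) * harm2 1 j * (of_nat j * (2 * (of_nat p * harm2 1 j) - 2)))"
      by (rule congp_cmult[OF Zp_mult[OF Z[OF j] hZ[OF j]] congp_lagrange_coeff[OF j]])
  qed
  also have "\<dots> = (\<Sum>j = 1..p-1. of_nat p * (2 * ?b j) - 2 * ?a j)"
  proof (intro sum.cong refl)
    fix j assume j: "j \<in> {1..p-1}"
    then show "1 / of_nat j ^ (2 * k + 2) * harm2 1 j * (of_nat j * (2 * (of_nat p * harm2 1 j) - 2)) = of_nat p * (2 * ?b j) - 2 * ?a j"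
      by (simp add: algebra_simps power2_eq_square diff_divide_distrib)
  qed
  also have "\<dots> = of_nat p * (2 * (\<Sum>j = 1..p-1. ?b j)) - 2 * (\<Sum>j = 1..p-1. ?a j)"
    by (simp only: sum_subtractf sum_distrib_left)
  also have "congp 2 \<dots> (of_nat p * (2 * 0) - (\<Sum>j = 1..p-1. - (of_nat p * ?c j)))"
    by (rule congp_diff[OF congp_scale_p[OF congp_cmult[OF Zp_numeral B]] A])
  also have "of_nat p * (2 * 0) - (\<Sum>j = 1..p-1. - (of_nat p * ?c j)) = of_nat p * (\<Sum>j = 1..p-1. ?c j)"
    by (simp only: sum_negf sum_distrib_left[symmetric] mult_zero_right diff_minus_eq_add add_0_left)
  also have "congp 2 \<dots> (of_nat p * (of_nat (2 * k) * ?B))"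
    by (intro congp_scale_p C)
  finally show ?thesis .
qed

lemma sum_hcoeff_over_k3_congp:
  assumes "2 * m + 5 \<le> p"
  shows "congp 1 (\<Sum>k = 1..p-1. hcoeff k m / of_nat k ^ 3) (of_nat (2 * m) * bernoulli (p - 2 * m - 3))"
proof -
  let ?U = "\<lambda>k. \<Sum>j = 1..p-1. of_nat p * lagrange_coeff (p - 1) j * harm2 1 j / of_nat j ^ (2 * k + 2)"
  have S: "Suc (p - 1) = p" using p_pos by simp
  have "of_nat p * (\<Sum>k = 1..p-1. hcoeff k m / of_nat k ^ 3)
      = of_nat p * (\<Sum>j = 1..p-1. lagrange_coeff (p - 1) j * harm2 1 j * quotient_coeff j (sqpoly p) m)"
    using sum_hcoeff_over_k3[of "p - 1" m, unfolded S] p_gt_1 by simp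
  also have "congp 2 \<dots> (?U m)"
  proof (rule interpolation_sum_congp)
    fix k assume k: "k \<le> m"
    have "bernoulli (p - 2 * k - 3) \<in> Zp"
      using assms k by (intro bernoulli_number_Zp) auto
    then have "congp 1 (of_nat p * (of_nat (2 * k) * bernoulli (p - 2 * k - 3))) 0"
      by (intro congp_p_mult_zero Zp_mult Zp_of_nat)
    from congp_trans[OF congp_weaken[OF odd_weight_congp] this] show "congp 1 (?U k) 0"
      using assms k by simp
  qed (use assms in auto)
  also have "congp 2 \<dots> (of_nat p * (of_nat (2 * m) * bernoulli (p - 2 * m - 3)))"
    using assms by (intro odd_weight_congp) auto
  finally show ?thesis unfolding congp_2_p .
qed

section \<open>The finite zeta values\<close>

lemma zeta_fin_even_congp:
  assumes "2 * m + 3 < p"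
  shows "congp 1 (2 * of_nat p * zeta_fin_even p m)
    (- (4 * of_nat m * (1 - 1 / 2 ^ (2 * m)) / of_nat (2 * m + 1)) * bernoulli (p - 2 * m - 1))"
proof -
  have p5: "p \<ge> 5" using assms odd_p by (cases "p = 4") auto
  let ?S = "\<Sum>n = 1..p-1. (-1) ^ (n - 1) / of_nat n ^ (2 * m + 2) :: rat"
  let ?A = "\<Sum>j = 1..p-1. (-1) ^ j / of_nat j ^ (2 * m + 1) :: rat"
  have SZ: "2 * ?S \<in> Zp"
    by (intro Zp_mult Zp_sum Zp_divide unit_power unit_of_nat minus_one_power_Zp) auto
  have "2 * of_nat p * zeta_fin_even p m = of_nat p * (2 * ?S) + (\<Sum>k = 1..p-1. hcoeff k m * (of_nat p * apery_remainder (p - 1) k))"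
  proof -
    have S: "Suc (p - 1) = p" using p_pos by simp
    have "even (p - 1)" using odd_p by simp
    then have "zeta_fin_even p m = ?S + (\<Sum>k = 1..p-1. hcoeff k m * apery_remainder (p - 1) k) / 2"
      using zeta_fin_even_exact[of "p - 1" m, unfolded S] by blast
    moreover have "(\<Sum>k = 1..p-1. hcoeff k m * (of_nat p * apery_remainder (p - 1) k))
        = of_nat p * (\<Sum>k = 1..p-1. hcoeff k m * apery_remainder (p - 1) k)"
      unfolding sum_distrib_left by (intro sum.cong refl mult.left_commute)
    moreover have "2 * q * (s + t / 2) = q * (2 * s) + q * t" for q s t :: rat
      by (simp add: algebra_simps)
    ultimately show ?thesis by (simp only:)
  qed
  also have "congp 1 \<dots> (0 + (\<Sum>k = 1..p-1. hcoeff k m * - (1 / of_nat k + of_nat p * (1 / of_nat k ^ 2))))"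
  proof (rule congp_add[OF congp_p_mult_zero[OF SZ] congp_sum])
    fix k assume "k \<in> {1..p-1}"
    then have k: "1 \<le> k" "k \<le> p - 1" by auto
    have "congp 1 (of_nat p * apery_remainder (p - 1) k) (- (1 / of_nat k + of_nat p * (1 / of_nat k ^ 2)))"
      using congp_weaken[OF congp_apery_remainder[OF k]] by simp
    then show "congp 1 (hcoeff k m * (of_nat p * apery_remainder (p - 1) k)) (hcoeff k m * - (1 / of_nat k + of_nat p * (1 / of_nat k ^ 2)))"
      using k by (intro congp_cmult hcoeff_Zp) auto
  qed
  also have "congp 1 \<dots> (0 + (\<Sum>k = 1..p-1. hcoeff k m * - (1 / of_nat k + 0)))"
  proof (rule congp_add[OF congp_refl congp_sum])
    fix k assume k: "k \<in> {1..p-1}"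
    have "1 / of_nat k ^ 2 \<in> Zp" using k by (intro Zp_divide unit_power unit_of_nat) auto
    then show "congp 1 (hcoeff k m * - (1 / of_nat k + of_nat p * (1 / of_nat k ^ 2))) (hcoeff k m * - (1 / of_nat k + 0))"
      using k by (intro congp_cmult hcoeff_Zp congp_minus congp_add[OF congp_refl congp_p_mult_zero]) auto
  qed
  also have "0 + (\<Sum>k = 1..p-1. hcoeff k m * - (1 / of_nat k + 0)) = - (\<Sum>k = 1..p-1. hcoeff k m / of_nat k)"
    by (simp add: sum_negf)
  also have "congp 1 \<dots> (- (- of_nat (2 * m) * ?A))"
    using assms p5 by (intro congp_minus sum_hcoeff_over_k_congp) auto
  also have "- (- of_nat (2 * m) * ?A) = of_nat (2 * m) * ?A" by simp
  also have "congp 1 \<dots> (of_nat (2 * m) * (- 2 * (1 - 1 / 2 ^ (2 * m + 1 - 1)) / of_nat (2 * m + 1) * bernoulli (p - (2 * m + 1))))"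
  \<comment> \<open>For m = 0 the Bernoulli number need not be p-integral, but the factor m makes both sides zero.\<close>
  proof (cases "m = 0")
    case False
    then show ?thesis
      using assms by (intro congp_cmult congp_alternating_inverse_power_sum) auto
  qed simp
  also have "of_nat (2 * m) * (- 2 * (1 - 1 / 2 ^ (2 * m + 1 - 1)) / of_nat (2 * m + 1) * bernoulli (p - (2 * m + 1)))
     = - (4 * of_nat m * (1 - 1 / 2 ^ (2 * m)) / of_nat (2 * m + 1)) * bernoulli (p - 2 * m - 1)"
  proof -
    have "(2 * u) * (- 2 * c / d * b) = - (4 * u * c / d) * b" for u c d b :: rat by simp
    then show ?thesis by (simp only: of_nat_mult of_nat_numeral add_diff_cancel_right' diff_diff_left)
  qed
  finally show ?thesis .
qed

text \<open>Multiplied by 2 (2m+3), the sum over h_k/k^2 contributes - 2 and the sum over h_k/k^3 contributes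
  - 2m (2m+3) times the Bernoulli number; together this is - 2 (m+1)(2m+1).\<close>

lemma zeta_fin_odd_congp:
  assumes "2 * m + 3 < p"
  shows "congp 1 (zeta_fin_odd p m)
    (- (of_nat ((m + 1) * (2 * m + 1)) / of_nat (2 * m + 3)) * bernoulli (p - 2 * m - 3))"
proof -
  \<comment> \<open>Parity excludes p = 2m + 4, so that all weights stay below p - 1.\<close>
  have p4: "p \<noteq> 2 * m + 4" using odd_p by auto
  then have p5: "p \<ge> 5" "2 * m + 5 \<le> p" using assms by auto
  let ?S = "\<Sum>n = 1..p-1. 1 / of_nat n ^ (2 * m + 3) :: rat"
  let ?P = "coeff (sqpoly p) (Suc m)" and ?B = "bernoulli (p - 2 * m - 3)"
  let ?T = "\<Sum>k = 1..p-1. hcoeff k m / of_nat k ^ 3"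
  have "of_nat p * (2 * zeta_fin_odd p m) = of_nat p * (2 * ?S) + (\<Sum>k = 1..p-1. hcoeff k m / of_nat k * (of_nat p * apery_remainder (p - 1) k))"
  proof -
    have S: "Suc (p - 1) = p" using p_pos by simp
    have "zeta_fin_odd p m = ?S + (\<Sum>k = 1..p-1. hcoeff k m * apery_remainder (p - 1) k / (2 * of_nat k))"
      using zeta_fin_odd_exact[of "p - 1" m, unfolded S] .
    moreover have "(\<Sum>k = 1..p-1. hcoeff k m / of_nat k * (of_nat p * apery_remainder (p - 1) k))
        = 2 * of_nat p * (\<Sum>k = 1..p-1. hcoeff k m * apery_remainder (p - 1) k / (2 * of_nat k))"
      unfolding sum_distrib_left by (intro sum.cong refl) simp
    moreover have "q * (2 * (s + t)) = q * (2 * s) + 2 * q * t" for q s t :: rat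
      by (simp add: algebra_simps)
    ultimately show ?thesis by (simp only:)
  qed
  also have "congp 2 \<dots> (of_nat p * (2 * 0) + (\<Sum>k = 1..p-1. hcoeff k m / of_nat k * - (1 / of_nat k + of_nat p / of_nat k ^ 2)))"
  proof (rule congp_add[OF congp_scale_p[OF congp_cmult[OF Zp_numeral congp_inverse_power_sum]] congp_sum])
    fix k assume "k \<in> {1..p-1}"
    then have k: "1 \<le> k" "k \<le> p - 1" by auto
    show "congp 2 (hcoeff k m / of_nat k * (of_nat p * apery_remainder (p - 1) k))
        (hcoeff k m / of_nat k * - (1 / of_nat k + of_nat p / of_nat k ^ 2))"
      using k by (intro congp_cmult congp_apery_remainder Zp_divide hcoeff_Zp unit_of_nat) auto
  qed (use p5 in auto)
  also have "of_nat p * (2 * 0) + (\<Sum>k = 1..p-1. hcoeff k m / of_nat k * - (1 / of_nat k + of_nat p / of_nat k ^ 2))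
      = - (\<Sum>k = 1..p-1. hcoeff k m / of_nat k ^ 2) - of_nat p * ?T"
  proof -
    have "(\<Sum>k = 1..p-1. hcoeff k m / of_nat k * - (1 / of_nat k + of_nat p / of_nat k ^ 2))
       = (\<Sum>k = 1..p-1. - (hcoeff k m / of_nat k ^ 2) - of_nat p * (hcoeff k m / of_nat k ^ 3))"
      by (intro sum.cong refl) (simp add: algebra_simps power2_eq_square power3_eq_cube)
    then show ?thesis by (simp only: sum_subtractf sum_negf sum_distrib_left mult_zero_right add_0_left)
  qed
  also have "\<dots> = ?P - of_nat p * ?T"
    using sum_hcoeff_over_k2[where N = "p - 1" and m = m] p_gt_1 by simp
  also have "congp 2 \<dots> (?P - of_nat p * (of_nat (2 * m) * ?B))"
    by (rule congp_diff[OF congp_refl congp_scale_p[OF sum_hcoeff_over_k3_congp[OF p5(2)]]])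
  finally have Z: "congp 2 (of_nat p * (2 * zeta_fin_odd p m)) (?P - of_nat p * (of_nat (2 * m) * ?B))" .
  have "congp 2 (of_nat (2 * m + 3) * ?P) (of_nat (2 * m + 3) * (2 * coeff (inv_elem_prod (p - 1)) (2 * Suc m)))"
    using p5 by (intro congp_cmult sqpoly_p_congp_2) auto
  also have "\<dots> = 2 * (of_nat (2 * Suc m + 1) * coeff (inv_elem_prod (p - 1)) (2 * Suc m))"
    by simp
  also have "congp 2 \<dots> (2 * - (of_nat p * bernoulli (p - 1 - 2 * Suc m)))"
    using p5 by (intro congp_cmult inv_elem_prod_congp) auto
  also have "p - 1 - 2 * Suc m = p - 2 * m - 3" by simp
  finally have P: "congp 2 (of_nat (2 * m + 3) * ?P) (2 * - (of_nat p * ?B))" .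
  have "congp 2 (of_nat (2 * m + 3) * (of_nat p * (2 * zeta_fin_odd p m)))
      (of_nat (2 * m + 3) * (?P - of_nat p * (of_nat (2 * m) * ?B)))"
    by (intro congp_cmult Z) auto
  also have "\<dots> = of_nat (2 * m + 3) * ?P - of_nat (2 * m + 3) * (of_nat p * (of_nat (2 * m) * ?B))"
    by (rule right_diff_distrib)
  also have "congp 2 \<dots> (2 * - (of_nat p * ?B) - of_nat (2 * m + 3) * (of_nat p * (of_nat (2 * m) * ?B)))"
    by (intro congp_diff P congp_refl)
  finally have "congp 2 (of_nat p * (2 * of_nat (2 * m + 3) * zeta_fin_odd p m))
      (of_nat p * (- (2 + of_nat (2 * m + 3) * of_nat (2 * m)) * ?B))"
    by (simp add: algebra_simps)
  then have "congp 1 (2 * of_nat (2 * m + 3) * zeta_fin_odd p m) (- (2 + of_nat (2 * m + 3) * of_nat (2 * m)) * ?B)"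
    unfolding congp_2_p .
  also have "- (2 + of_nat (2 * m + 3) * of_nat (2 * m)) * ?B
      = 2 * of_nat (2 * m + 3) * (- (of_nat ((m + 1) * (2 * m + 1)) / of_nat (2 * m + 3)) * ?B)"
  proof -
    have "(of_nat (2 * m + 3) :: rat) \<noteq> 0" by (simp only: of_nat_eq_0_iff)
    then have "2 * of_nat (2 * m + 3) * (- (of_nat ((m + 1) * (2 * m + 1)) / of_nat (2 * m + 3)) * ?B)
       = - (2 * of_nat ((m + 1) * (2 * m + 1)) * ?B)"
    proof -
      have "2 * d * (- (u / d) * b) = - (2 * u * b)" if "d \<noteq> 0" for d u b :: rat
        using that by simp
      then show ?thesis using \<open>(of_nat (2 * m + 3) :: rat) \<noteq> 0\<close> by blast
    qed
    then show ?thesis by (simp add: algebra_simps)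
  qed
  finally show ?thesis
  proof (rule congp_cancel[rotated])
    show "unit (2 * of_nat (2 * m + 3))"
      using unit_of_nat[of 2] p_gt_2 assms by (intro unit_mult unit_of_nat) auto
  qed
qed

end

theorem theorem6p1:
  fixes m p :: nat
  assumes "prime p" and "p > 2 * m + 3"
  shows "rat_cong (2 * of_nat p * zeta_fin p (2 * m + 2))
           (- (4 * of_nat m * (1 - 1 / 2 ^ (2 * m)) / of_nat (2 * m + 1))
              * bernoulli (p - 2 * m - 1)) p
       \<and> rat_cong (zeta_fin p (2 * m + 3))
           (- (of_nat ((m + 1) * (2 * m + 1)) / of_nat (2 * m + 3))
              * bernoulli (p - 2 * m - 3)) p"
proof -
  have "odd p" using assms prime_odd_nat[of p] by auto
  then interpret odd_prime p using assms(1) by unfold_locales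
  show ?thesis
    unfolding zeta_fin_even_arg zeta_fin_odd_arg
    using zeta_fin_even_congp[OF assms(2)] zeta_fin_odd_congp[OF assms(2)] rat_cong_if_congp by blast
qed

end
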